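(* Let $\Phi$ be a quasi-classical generalized CRF structure on a manifold $M$, defined by a pair $(A,\pi)$, such that $Q=\ker A$ defines a foliation (i.e. $Q$ is involutive) and the bivector field $\pi$ is projectable to the local transversal submanifolds of the leaves of $Q$. Then $A$ induces a transversal holomorphic structure of $Q$, and $\pi$ projects to a $Q$-transversal holomorphic Poisson structure.
   Context: All manifolds and objects are $C^\infty$; an upper index $c$ denotes complexification. Big tangent bundle: $\mathbf{T}M=TM\oplus T^*M$ with pairing metric $g((X,\alpha),(Y,\beta))=\frac12(\alpha(Y)+\beta(X))$ and Courant bracket $[(X,\alpha),(Y,\beta)]=([X,Y],\,L_X\beta-L_Y\alpha+\frac12 d(\alpha(Y)-\beta(X)))$, extended complex-bilinearly to $\mathbf{T}^cM$. For $A\in End(TM)$, $A^*\alpha=\alpha\circ A$; for a bivector field $\pi$, $\sharp_\pi\alpha=i(\alpha)\pi$, i.e. $\beta(\sharp_\pi\alpha)=\pi(\alpha,\beta)$. An F structure is $A\in End(TM)$ with $A^3+A=0$. A generalized F structure is a $g$-skew-symmetric endomorphism $\Phi$ of $\mathbf{T}M$ with $\Phi^3+\Phi=0$; it is integrable (generalized CRF) if its $i$-eigenbundle in $\mathbf{T}^cM$ is closed under Courant brackets; it is quasi-classical if $\Phi(TM)\subseteq TM$ and $\Phi^2(T^*M)\subseteq T^*M$. A quasi-classical generalized F structure has the form $\Phi(X,\alpha)=(AX+\sharp_\pi\alpha,-A^*\alpha)$ with $A$ an F structure and $\pi$ a bivector field such that $A\circ\sharp_\pi=\sharp_\pi\circ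 A^*$ and $\mathrm{im}\,\sharp_\pi\subseteq\mathrm{im}\,A$; $\Phi$ is said to be defined by $(A,\pi)$. A quasi-classical generalized CRF structure is an integrable quasi-classical generalized F structure. Projectability. A (local) vector field $X$ is $Q$-projectable if $[X,Y]\in Q$ for all $Y\in Q$; then it has an image $[X]_Q$ on the local transversal submanifolds (local leaf spaces) of $Q$. The bivector field $\pi$ is $Q$-projectable if there is a bivector field $\tilde\pi$ on the local transversal submanifolds of the leaves of $Q$ such that $\pi$ and $\tilde\pi$ are related by the natural (local) projection. That $A$ induces a transversal holomorphic structure of $Q$ means that the formula $\tilde A[X]_Q=[AX]_Q$, for $Q$-projectable $X$, gives a well-defined tensor field $\tilde A$ on the local transversal submanifolds which is an (integrable) complex structure. That $\pi$ projects to a $Q$-transversal holomorphic Poisson structure means that $\tilde\pi$ is a holomorphic Poisson structure with respect to $\tilde A$, i.e. $[\tilde\pi,\tilde\pi]=0$ (Schouten-Nijenhuis bracket) and, in local $\tilde A$-complex analytic coordinates $(z^i)$, $\tilde\pi=\frac12\big(\pi^{ij}\frac{\partial}{\partial z^i}\wedge\frac{\partial}{\partial z^j}+\bar\pi^{ij}\frac{\partial}{\partial\bar z^i}\wedge\frac{\partial}{\partial\bar z^j}\big)$ with holomorphic functions $\pi^{ij}$. *)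

theory Defs
  imports "HOL-Analysis.Analysis"
begin

section \<open>Smooth maps between Euclidean spaces\<close>

fun Ck_on :: "nat \<Rightarrow> 'e::real_normed_vector set \<Rightarrow> ('e \<Rightarrow> 'f::real_normed_vector) \<Rightarrow> bool" where
  "Ck_on 0 S f \<longleftrightarrow> continuous_on S f"
| "Ck_on (Suc n) S f \<longleftrightarrow>
     (\<forall>x\<in>S. f differentiable at x) \<and> (\<forall>v. Ck_on n S (\<lambda>x. frechet_derivative f (at x) v))"

text \<open>Only used for open sets \<open>S\<close>.\<close>

definition smooth_on :: "'e::real_normed_vector set \<Rightarrow> ('e \<Rightarrow> 'f::real_normed_vector) \<Rightarrow> bool" where
  "smooth_on S f \<longleftrightarrow> (\<forall>n. Ck_on n S f)"

definition Dmap :: "('e::real_normed_vector \<Rightarrow> 'f::real_normed_vector) \<Rightarrow> 'e \<Rightarrow> 'e \<Rightarrow>\<^sub>L 'f" where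
  "Dmap f x = Blinfun (frechet_derivative f (at x))"


section \<open>Smooth manifolds and tensor fields\<close>

text \<open>
  A manifold is the union of the domains of the charts of a smooth atlas.  The tangent space at
  \<open>p\<close> is the model space \<open>'e\<close>, read in the fixed chart \<open>chart_at \<A> p\<close>; cotangent vectors
  at \<open>p\<close> are the linear forms on it.  Representatives in other charts are obtained with the
  derivatives of the coordinate changes, and smoothness is always tested in all charts.
\<close>

type_synonym ('a, 'e) chart = "'a set \<times> ('a \<Rightarrow> 'e)"
type_synonym ('a, 'e) atlas = "('a, 'e) chart set"
type_synonym 'e covec = "'e \<Rightarrow>\<^sub>L real"

definition dom :: "('a, 'e) chart \<Rightarrow> 'a set" where
  "dom c = fst c"

definition chmap :: "('a, 'e) chart \<Rightarrow> 'a \<Rightarrow> 'e" where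
  "chmap c = snd c"

definition chinv :: "('a, 'e) chart \<Rightarrow> 'e \<Rightarrow> 'a" where
  "chinv c = inv_into (dom c) (chmap c)"

definition carrier :: "('a, 'e) atlas \<Rightarrow> 'a set" where
  "carrier \<A> = (\<Union>c\<in>\<A>. dom c)"

definition smooth_manifold ::
  "('a::{t2_space,second_countable_topology}, 'e::euclidean_space) atlas \<Rightarrow> bool" where
  "smooth_manifold \<A> \<longleftrightarrow>
     (\<forall>c\<in>\<A>. open (dom c) \<and> open (chmap c ` dom c) \<and>
        homeomorphism (dom c) (chmap c ` dom c) (chmap c) (chinv c)) \<and>
     (\<forall>c\<in>\<A>. \<forall>d\<in>\<A>. smooth_on (chmap c ` (dom c \<inter> dom d)) (chmap d \<circ> chinv c))"

definition chart_at :: "('a, 'e) atlas \<Rightarrow> 'a \<Rightarrow> ('a, 'e) chart" where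
  "chart_at \<A> p = (SOME c. c \<in> \<A> \<and> p \<in> dom c)"

text \<open>\<open>to_chart \<A> c p\<close> maps the tangent space at \<open>p\<close> to its representation in the chart \<open>c\<close>,
  and \<open>from_chart \<A> c p\<close> is its inverse.\<close>

definition to_chart ::
  "('a, 'e::euclidean_space) atlas \<Rightarrow> ('a, 'e) chart \<Rightarrow> 'a \<Rightarrow> 'e \<Rightarrow>\<^sub>L 'e" where
  "to_chart \<A> c p = Dmap (chmap c \<circ> chinv (chart_at \<A> p)) (chmap (chart_at \<A> p) p)"

definition from_chart ::
  "('a, 'e::euclidean_space) atlas \<Rightarrow> ('a, 'e) chart \<Rightarrow> 'a \<Rightarrow> 'e \<Rightarrow>\<^sub>L 'e" where
  "from_chart \<A> c p = Dmap (chmap (chart_at \<A> p) \<circ> chinv c) (chmap c p)"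

definition vec_rep ::
  "('a, 'e::euclidean_space) atlas \<Rightarrow> ('a, 'e) chart \<Rightarrow> ('a \<Rightarrow> 'e) \<Rightarrow> 'e \<Rightarrow> 'e" where
  "vec_rep \<A> c X x = to_chart \<A> c (chinv c x) (X (chinv c x))"

definition form_rep ::
  "('a, 'e::euclidean_space) atlas \<Rightarrow> ('a, 'e) chart \<Rightarrow> ('a \<Rightarrow> 'e covec) \<Rightarrow> 'e \<Rightarrow> 'e covec" where
  "form_rep \<A> c \<alpha> x = \<alpha> (chinv c x) o\<^sub>L from_chart \<A> c (chinv c x)"

definition open_in_manifold :: "('a::topological_space, 'e) atlas \<Rightarrow> 'a set \<Rightarrow> bool" where
  "open_in_manifold \<A> V \<longleftrightarrow> open V \<and> V \<subseteq> carrier \<A>"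

definition smooth_fun ::
  "('a, 'e::euclidean_space) atlas \<Rightarrow> 'a set \<Rightarrow> ('a \<Rightarrow> 'v::real_normed_vector) \<Rightarrow> bool" where
  "smooth_fun \<A> V f \<longleftrightarrow> (\<forall>c\<in>\<A>. smooth_on (chmap c ` (dom c \<inter> V)) (f \<circ> chinv c))"

definition vector_field ::
  "('a, 'e::euclidean_space) atlas \<Rightarrow> 'a set \<Rightarrow> ('a \<Rightarrow> 'e) \<Rightarrow> bool" where
  "vector_field \<A> V X \<longleftrightarrow> (\<forall>c\<in>\<A>. smooth_on (chmap c ` (dom c \<inter> V)) (vec_rep \<A> c X))"

definition one_form ::
  "('a, 'e::euclidean_space) atlas \<Rightarrow> 'a set \<Rightarrow> ('a \<Rightarrow> 'e covec) \<Rightarrow> bool" where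
  "one_form \<A> V \<alpha> \<longleftrightarrow> (\<forall>c\<in>\<A>. smooth_on (chmap c ` (dom c \<inter> V)) (form_rep \<A> c \<alpha>))"

definition differential ::
  "('a, 'e::euclidean_space) atlas \<Rightarrow> ('a \<Rightarrow> 'v::real_normed_vector) \<Rightarrow> 'a \<Rightarrow> 'e \<Rightarrow>\<^sub>L 'v" where
  "differential \<A> f p = Dmap (f \<circ> chinv (chart_at \<A> p)) (chmap (chart_at \<A> p) p)"

definition lie_bracket ::
  "('a, 'e::euclidean_space) atlas \<Rightarrow> ('a \<Rightarrow> 'e) \<Rightarrow> ('a \<Rightarrow> 'e) \<Rightarrow> 'a \<Rightarrow> 'e" where
  "lie_bracket \<A> X Y p =
     (let c = chart_at \<A> p; x = chmap c p; X' = vec_rep \<A> c X; Y' = vec_rep \<A> c Y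
      in Dmap Y' x (X' x) - Dmap X' x (Y' x))"

text \<open>\<open>(L\<^sub>X \<beta>)\<^sub>j = X\<^sup>i \<partial>\<^sub>i \<beta>\<^sub>j + \<beta>\<^sub>i \<partial>\<^sub>j X\<^sup>i\<close> in local coordinates.\<close>

definition lie_derivative ::
  "('a, 'e::euclidean_space) atlas \<Rightarrow> ('a \<Rightarrow> 'e) \<Rightarrow> ('a \<Rightarrow> 'e covec) \<Rightarrow> 'a \<Rightarrow> 'e covec" where
  "lie_derivative \<A> X \<beta> p =
     (let c = chart_at \<A> p; x = chmap c p; X' = vec_rep \<A> c X; \<beta>' = form_rep \<A> c \<beta>
      in Dmap \<beta>' x (X' x) + (\<beta>' x o\<^sub>L Dmap X' x))"

text \<open>A field of endomorphisms, given by linear maps of the tangent spaces, is smooth if it maps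
  smooth local fields to smooth local fields; likewise for bivector fields.\<close>

definition endo_field ::
  "('a::topological_space, 'e::euclidean_space) atlas \<Rightarrow> ('a \<Rightarrow> 'e \<Rightarrow>\<^sub>L 'e) \<Rightarrow> bool" where
  "endo_field \<A> A \<longleftrightarrow>
     (\<forall>V X. open_in_manifold \<A> V \<and> vector_field \<A> V X \<longrightarrow> vector_field \<A> V (\<lambda>p. A p (X p)))"

type_synonym 'e bivec = "'e covec \<Rightarrow> 'e covec \<Rightarrow> real"

definition bivector_field ::
  "('a::topological_space, 'e::euclidean_space) atlas \<Rightarrow> ('a \<Rightarrow> 'e bivec) \<Rightarrow> bool" where
  "bivector_field \<A> \<pi> \<longleftrightarrow>
     (\<forall>p\<in>carrier \<A>. bilinear (\<pi> p) \<and> (\<forall>\<alpha> \<beta>. \<pi> p \<alpha> \<beta> = - \<pi> p \<beta> \<alpha>)) \<and>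
     (\<forall>V \<alpha> \<beta>. open_in_manifold \<A> V \<and> one_form \<A> V \<alpha> \<and> one_form \<A> V \<beta> \<longrightarrow>
        smooth_fun \<A> V (\<lambda>p. \<pi> p (\<alpha> p) (\<beta> p)))"

definition sharp :: "'e::euclidean_space bivec \<Rightarrow> 'e covec \<Rightarrow> 'e" where
  "sharp P \<alpha> = (THE v. \<forall>\<beta>. blinfun_apply \<beta> v = P \<alpha> \<beta>)"

definition bivec_rep ::
  "('a, 'e::euclidean_space) atlas \<Rightarrow> ('a, 'e) chart \<Rightarrow> ('a \<Rightarrow> 'e bivec) \<Rightarrow> 'e \<Rightarrow> 'e bivec" where
  "bivec_rep \<A> c \<pi> x \<alpha> \<beta> =
     \<pi> (chinv c x) (\<alpha> o\<^sub>L to_chart \<A> c (chinv c x)) (\<beta> o\<^sub>L to_chart \<A> c (chinv c x))"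

text \<open>
  The Schouten-Nijenhuis bracket of two bivector fields, evaluated on three covectors:
  in local coordinates
  \<open>[P, R]\<^sup>i\<^sup>j\<^sup>k = P\<^sup>i\<^sup>l \<partial>\<^sub>l R\<^sup>j\<^sup>k + R\<^sup>i\<^sup>l \<partial>\<^sub>l P\<^sup>j\<^sup>k + cyclic permutations of (i, j, k)\<close>.
\<close>

definition schouten ::
  "('a, 'e::euclidean_space) atlas \<Rightarrow> ('a \<Rightarrow> 'e bivec) \<Rightarrow> ('a \<Rightarrow> 'e bivec) \<Rightarrow>
    'a \<Rightarrow> 'e covec \<Rightarrow> 'e covec \<Rightarrow> 'e covec \<Rightarrow> real" where
  "schouten \<A> P R p \<alpha> \<beta> \<gamma> =
     (let c = chart_at \<A> p; x = chmap c p; P' = bivec_rep \<A> c P; R' = bivec_rep \<A> c R;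
          t = (\<lambda>a b d. Dmap (\<lambda>y. R' y b d) x (sharp (P' x) a) + Dmap (\<lambda>y. P' y b d) x (sharp (R' x) a))
      in t \<alpha> \<beta> \<gamma> + t \<beta> \<gamma> \<alpha> + t \<gamma> \<alpha> \<beta>)"


section \<open>The big tangent bundle and generalized F structures\<close>

type_synonym 'e big = "'e \<times> 'e covec"

definition big_section ::
  "('a, 'e::euclidean_space) atlas \<Rightarrow> 'a set \<Rightarrow> ('a \<Rightarrow> 'e big) \<Rightarrow> bool" where
  "big_section \<A> V s \<longleftrightarrow> vector_field \<A> V (\<lambda>p. fst (s p)) \<and> one_form \<A> V (\<lambda>p. snd (s p))"

definition pairing :: "'e::euclidean_space big \<Rightarrow> 'e big \<Rightarrow> real" where
  "pairing s t = (blinfun_apply (snd s) (fst t) + blinfun_apply (snd t) (fst s)) / 2"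

definition courant ::
  "('a, 'e::euclidean_space) atlas \<Rightarrow> ('a \<Rightarrow> 'e big) \<Rightarrow> ('a \<Rightarrow> 'e big) \<Rightarrow> 'a \<Rightarrow> 'e big" where
  "courant \<A> s t p =
     (let X = (\<lambda>q. fst (s q)); \<alpha> = (\<lambda>q. snd (s q)); Y = (\<lambda>q. fst (t q)); \<beta> = (\<lambda>q. snd (t q))
      in (lie_bracket \<A> X Y p,
          lie_derivative \<A> X \<beta> p - lie_derivative \<A> Y \<alpha> p +
          (1/2) *\<^sub>R differential \<A> (\<lambda>q. blinfun_apply (\<alpha> q) (Y q) - blinfun_apply (\<beta> q) (X q)) p))"

definition gen_F_structure ::
  "('a::topological_space, 'e::euclidean_space) atlas \<Rightarrow> ('a \<Rightarrow> 'e big \<Rightarrow> 'e big) \<Rightarrow> bool" where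
  "gen_F_structure \<A> \<Phi> \<longleftrightarrow>
     (\<forall>p\<in>carrier \<A>. linear (\<Phi> p) \<and>
        (\<forall>s t. pairing (\<Phi> p s) t + pairing s (\<Phi> p t) = 0) \<and>
        (\<forall>s. \<Phi> p (\<Phi> p (\<Phi> p s)) + \<Phi> p s = 0)) \<and>
     (\<forall>V s. open_in_manifold \<A> V \<and> big_section \<A> V s \<longrightarrow> big_section \<A> V (\<lambda>p. \<Phi> p (s p)))"

text \<open>A section of the complexified bundle is written \<open>s + i s'\<close> with real sections \<open>s, s'\<close>;
  then \<open>\<Phi>(s + i s') = i (s + i s')\<close> means \<open>\<Phi> s = - s'\<close> and \<open>\<Phi> s' = s\<close>.\<close>

definition i_eigen_section ::
  "('a, 'e::euclidean_space) atlas \<Rightarrow> ('a \<Rightarrow> 'e big \<Rightarrow> 'e big) \<Rightarrow> 'a set \<Rightarrow>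
    ('a \<Rightarrow> 'e big) \<Rightarrow> ('a \<Rightarrow> 'e big) \<Rightarrow> bool" where
  "i_eigen_section \<A> \<Phi> V s s' \<longleftrightarrow>
     big_section \<A> V s \<and> big_section \<A> V s' \<and> (\<forall>p\<in>V. \<Phi> p (s p) = - s' p \<and> \<Phi> p (s' p) = s p)"

definition gen_CRF_structure ::
  "('a::topological_space, 'e::euclidean_space) atlas \<Rightarrow> ('a \<Rightarrow> 'e big \<Rightarrow> 'e big) \<Rightarrow> bool" where
  "gen_CRF_structure \<A> \<Phi> \<longleftrightarrow> gen_F_structure \<A> \<Phi> \<and>
     (\<forall>V s s' t t'. open_in_manifold \<A> V \<and>
        i_eigen_section \<A> \<Phi> V s s' \<and> i_eigen_section \<A> \<Phi> V t t' \<longrightarrow>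
        i_eigen_section \<A> \<Phi> V
          (\<lambda>p. courant \<A> s t p - courant \<A> s' t' p)
          (\<lambda>p. courant \<A> s t' p + courant \<A> s' t p))"

definition quasi_classical ::
  "('a, 'e::euclidean_space) atlas \<Rightarrow> ('a \<Rightarrow> 'e big \<Rightarrow> 'e big) \<Rightarrow> bool" where
  "quasi_classical \<A> \<Phi> \<longleftrightarrow>
     (\<forall>p\<in>carrier \<A>. (\<forall>X. snd (\<Phi> p (X, 0)) = 0) \<and> (\<forall>\<alpha>. fst (\<Phi> p (\<Phi> p (0, \<alpha>))) = 0))"

definition F_structure ::
  "('a::topological_space, 'e::euclidean_space) atlas \<Rightarrow> ('a \<Rightarrow> 'e \<Rightarrow>\<^sub>L 'e) \<Rightarrow> bool" where
  "F_structure \<A> A \<longleftrightarrow> endo_field \<A> A \<and> (\<forall>p\<in>carrier \<A>. \<forall>v. A p (A p (A p v)) + A p v = 0)"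

definition defined_by ::
  "('a::topological_space, 'e::euclidean_space) atlas \<Rightarrow> ('a \<Rightarrow> 'e big \<Rightarrow> 'e big) \<Rightarrow>
    ('a \<Rightarrow> 'e \<Rightarrow>\<^sub>L 'e) \<Rightarrow> ('a \<Rightarrow> 'e bivec) \<Rightarrow> bool" where
  "defined_by \<A> \<Phi> A \<pi> \<longleftrightarrow> F_structure \<A> A \<and> bivector_field \<A> \<pi> \<and>
     (\<forall>p\<in>carrier \<A>.
        (\<forall>\<alpha>. A p (sharp (\<pi> p) \<alpha>) = sharp (\<pi> p) (\<alpha> o\<^sub>L A p)) \<and>
        range (sharp (\<pi> p)) \<subseteq> range (blinfun_apply (A p)) \<and>
        (\<forall>X \<alpha>. \<Phi> p (X, \<alpha>) = (A p X + sharp (\<pi> p) \<alpha>, - (\<alpha> o\<^sub>L A p))))"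


section \<open>Foliations and their local leaf spaces\<close>

definition ker_dist :: "('a \<Rightarrow> 'e::euclidean_space \<Rightarrow>\<^sub>L 'e) \<Rightarrow> 'a \<Rightarrow> 'e set" where
  "ker_dist A p = {v. A p v = 0}"

definition field_in ::
  "('a, 'e::euclidean_space) atlas \<Rightarrow> ('a \<Rightarrow> 'e set) \<Rightarrow> 'a set \<Rightarrow> ('a \<Rightarrow> 'e) \<Rightarrow> bool" where
  "field_in \<A> Q V Y \<longleftrightarrow> vector_field \<A> V Y \<and> (\<forall>p\<in>V. Y p \<in> Q p)"

definition involutive ::
  "('a::topological_space, 'e::euclidean_space) atlas \<Rightarrow> ('a \<Rightarrow> 'e set) \<Rightarrow> bool" where
  "involutive \<A> Q \<longleftrightarrow>
     (\<forall>V X Y. open_in_manifold \<A> V \<and> field_in \<A> Q V X \<and> field_in \<A> Q V Y \<longrightarrow>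
        field_in \<A> Q V (lie_bracket \<A> X Y))"

definition projectable_field ::
  "('a::topological_space, 'e::euclidean_space) atlas \<Rightarrow> ('a \<Rightarrow> 'e set) \<Rightarrow> 'a set \<Rightarrow>
    ('a \<Rightarrow> 'e) \<Rightarrow> bool" where
  "projectable_field \<A> Q V X \<longleftrightarrow> vector_field \<A> V X \<and>
     (\<forall>W Y. open W \<and> W \<subseteq> V \<and> field_in \<A> Q W Y \<longrightarrow> field_in \<A> Q W (lie_bracket \<A> X Y))"

definition smooth_map ::
  "('a::topological_space, 'e::euclidean_space) atlas \<Rightarrow> ('b::topological_space, 'f::euclidean_space) atlas
    \<Rightarrow> 'a set \<Rightarrow> ('a \<Rightarrow> 'b) \<Rightarrow> bool" where
  "smooth_map \<A> \<B> U f \<longleftrightarrow> continuous_on U f \<and> f ` U \<subseteq> carrier \<B> \<and>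
     (\<forall>c\<in>\<A>. \<forall>d\<in>\<B>. smooth_on (chmap c ` (dom c \<inter> U \<inter> f -` dom d)) (chmap d \<circ> f \<circ> chinv c))"

definition tangent_map ::
  "('a, 'e::euclidean_space) atlas \<Rightarrow> ('b, 'f::euclidean_space) atlas \<Rightarrow> ('a \<Rightarrow> 'b) \<Rightarrow>
    'a \<Rightarrow> 'e \<Rightarrow>\<^sub>L 'f" where
  "tangent_map \<A> \<B> f p =
     Dmap (chmap (chart_at \<B> (f p)) \<circ> f \<circ> chinv (chart_at \<A> p)) (chmap (chart_at \<A> p) p)"

text \<open>
  A local leaf space (local transversal submanifold) of the foliation \<open>Q\<close>: the manifold \<open>\<B>\<close> is the
  quotient of the open set \<open>U\<close> by the leaves of \<open>Q\<close> in \<open>U\<close>, which are the (connected)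
  fibres of the submersion \<open>f\<close>.
\<close>

definition local_leaf_space ::
  "('a::topological_space, 'e::euclidean_space) atlas \<Rightarrow> ('a \<Rightarrow> 'e set) \<Rightarrow> 'a set \<Rightarrow> ('a \<Rightarrow> 'b) \<Rightarrow>
    ('b::{t2_space,second_countable_topology}, 'f::euclidean_space) atlas \<Rightarrow> bool" where
  "local_leaf_space \<A> Q U f \<B> \<longleftrightarrow>
     open_in_manifold \<A> U \<and> smooth_manifold \<B> \<and> smooth_map \<A> \<B> U f \<and> f ` U = carrier \<B> \<and>
     (\<forall>p\<in>U. surj (blinfun_apply (tangent_map \<A> \<B> f p)) \<and>
            {v. tangent_map \<A> \<B> f p v = 0} = Q p) \<and>
     (\<forall>y\<in>carrier \<B>. connected (U \<inter> f -` {y}))"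

definition field_projects_to ::
  "('a, 'e::euclidean_space) atlas \<Rightarrow> ('b, 'f::euclidean_space) atlas \<Rightarrow> 'a set \<Rightarrow> ('a \<Rightarrow> 'b) \<Rightarrow>
    ('a \<Rightarrow> 'e) \<Rightarrow> ('b \<Rightarrow> 'f) \<Rightarrow> bool" where
  "field_projects_to \<A> \<B> V f X X' \<longleftrightarrow> (\<forall>p\<in>V. tangent_map \<A> \<B> f p (X p) = X' (f p))"

definition bivector_projects_to ::
  "('a, 'e::euclidean_space) atlas \<Rightarrow> ('b, 'f::euclidean_space) atlas \<Rightarrow> 'a set \<Rightarrow> ('a \<Rightarrow> 'b) \<Rightarrow>
    ('a \<Rightarrow> 'e bivec) \<Rightarrow> ('b \<Rightarrow> 'f bivec) \<Rightarrow> bool" where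
  "bivector_projects_to \<A> \<B> U f \<pi> \<pi>' \<longleftrightarrow>
     (\<forall>p\<in>U. \<forall>\<alpha> \<beta>. \<pi> p (\<alpha> o\<^sub>L tangent_map \<A> \<B> f p) (\<beta> o\<^sub>L tangent_map \<A> \<B> f p) = \<pi>' (f p) \<alpha> \<beta>)"

text \<open>\<open>J [X]\<^sub>Q = [A X]\<^sub>Q\<close> for all \<open>Q\<close>-projectable local fields \<open>X\<close>, where \<open>X'\<close> is the
  image \<open>[X]\<^sub>Q\<close> on the leaf space.  (That \<open>A X\<close> is again projectable is not part of this
  definition.)\<close>

definition induces_on_leaf_space ::
  "('a::topological_space, 'e::euclidean_space) atlas \<Rightarrow> ('a \<Rightarrow> 'e set) \<Rightarrow> 'a set \<Rightarrow> ('a \<Rightarrow> 'b) \<Rightarrow>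
    ('b, 'f::euclidean_space) atlas \<Rightarrow> ('a \<Rightarrow> 'e \<Rightarrow>\<^sub>L 'e) \<Rightarrow> ('b \<Rightarrow> 'f \<Rightarrow>\<^sub>L 'f) \<Rightarrow> bool" where
  "induces_on_leaf_space \<A> Q U f \<B> A J \<longleftrightarrow>
     (\<forall>V X X'. open V \<and> V \<subseteq> U \<and> projectable_field \<A> Q V X \<and> field_projects_to \<A> \<B> V f X X' \<longrightarrow>
        field_projects_to \<A> \<B> V f (\<lambda>p. A p (X p)) (\<lambda>y. J y (X' y)))"


section \<open>Complex structures and holomorphic Poisson structures\<close>

text \<open>Integrability is the vanishing of the Nijenhuis tensor; existence of complex analytic
  coordinates (Newlander-Nirenberg) is not part of the definition.\<close>

definition complex_structure ::
  "('b::topological_space, 'f::euclidean_space) atlas \<Rightarrow> ('b \<Rightarrow> 'f \<Rightarrow>\<^sub>L 'f) \<Rightarrow> bool" where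
  "complex_structure \<B> J \<longleftrightarrow> endo_field \<B> J \<and>
     (\<forall>y\<in>carrier \<B>. \<forall>v. J y (J y v) = - v) \<and>
     (\<forall>V X Y. open_in_manifold \<B> V \<and> vector_field \<B> V X \<and> vector_field \<B> V Y \<longrightarrow>
        (\<forall>y\<in>V. lie_bracket \<B> (\<lambda>q. J q (X q)) (\<lambda>q. J q (Y q)) y
              - J y (lie_bracket \<B> (\<lambda>q. J q (X q)) Y y)
              - J y (lie_bracket \<B> X (\<lambda>q. J q (Y q)) y)
              - lie_bracket \<B> X Y y = 0))"

definition J_holomorphic ::
  "('b, 'f::euclidean_space) atlas \<Rightarrow> ('b \<Rightarrow> 'f \<Rightarrow>\<^sub>L 'f) \<Rightarrow> 'b set \<Rightarrow> ('b \<Rightarrow> complex) \<Rightarrow> bool" where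
  "J_holomorphic \<B> J W h \<longleftrightarrow> smooth_fun \<B> W h \<and>
     (\<forall>y\<in>W. \<forall>v. differential \<B> h y (J y v) = \<i> * differential \<B> h y v)"

text \<open>\<open>z 0, \<dots>, z (m - 1)\<close> are complex analytic coordinates on \<open>W\<close>: by the dimension count,
  they define a diffeomorphism of \<open>W\<close> onto an open subset of complex \<open>m\<close>-space, which carries
  \<open>J\<close> to multiplication by \<open>\<i>\<close>.\<close>

definition complex_coordinates ::
  "('b::topological_space, 'f::euclidean_space) atlas \<Rightarrow> ('b \<Rightarrow> 'f \<Rightarrow>\<^sub>L 'f) \<Rightarrow> 'b set \<Rightarrow> nat \<Rightarrow>
    (nat \<Rightarrow> 'b \<Rightarrow> complex) \<Rightarrow> bool" where
  "complex_coordinates \<B> J W m z \<longleftrightarrow>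
     open_in_manifold \<B> W \<and> DIM('f) = 2 * m \<and>
     (\<forall>i<m. J_holomorphic \<B> J W (z i)) \<and>
     (\<forall>y\<in>W. \<forall>y'\<in>W. (\<forall>i<m. z i y = z i y') \<longrightarrow> y = y') \<and>
     (\<forall>y\<in>W. \<forall>v. (\<forall>i<m. differential \<B> (z i) y v = 0) \<longrightarrow> v = 0)"

definition coord_vec ::
  "('b, 'f::euclidean_space) atlas \<Rightarrow> nat \<Rightarrow> (nat \<Rightarrow> 'b \<Rightarrow> complex) \<Rightarrow> 'b \<Rightarrow> nat \<Rightarrow> complex \<Rightarrow> 'f" where
  "coord_vec \<B> m z y i w =
     (THE v. \<forall>j<m. differential \<B> (z j) y v = (if j = i then w else 0))"

text \<open>For \<open>z\<^sup>i = x\<^sup>i + \<i> y\<^sup>i\<close> the coordinate fields of \<open>x\<^sup>i\<close> and \<open>y\<^sup>i\<close> are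
  \<open>coord_vec \<B> m z y i 1\<close> and \<open>coord_vec \<B> m z y i \<i>\<close>.  The following are the values of a
  real covector on \<open>\<partial>/\<partial>z\<^sup>i = (\<partial>/\<partial>x\<^sup>i - \<i> \<partial>/\<partial>y\<^sup>i) / 2\<close> and on its conjugate.\<close>

definition on_dz ::
  "('b, 'f::euclidean_space) atlas \<Rightarrow> nat \<Rightarrow> (nat \<Rightarrow> 'b \<Rightarrow> complex) \<Rightarrow> 'b \<Rightarrow> nat \<Rightarrow> 'f covec \<Rightarrow> complex" where
  "on_dz \<B> m z y i \<alpha> =
     (of_real (\<alpha> (coord_vec \<B> m z y i 1)) - \<i> * of_real (\<alpha> (coord_vec \<B> m z y i \<i>))) / 2"

definition on_dzbar ::
  "('b, 'f::euclidean_space) atlas \<Rightarrow> nat \<Rightarrow> (nat \<Rightarrow> 'b \<Rightarrow> complex) \<Rightarrow> 'b \<Rightarrow> nat \<Rightarrow> 'f covec \<Rightarrow> complex" where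
  "on_dzbar \<B> m z y i \<alpha> =
     (of_real (\<alpha> (coord_vec \<B> m z y i 1)) + \<i> * of_real (\<alpha> (coord_vec \<B> m z y i \<i>))) / 2"

definition holomorphic_Poisson ::
  "('b::topological_space, 'f::euclidean_space) atlas \<Rightarrow> ('b \<Rightarrow> 'f \<Rightarrow>\<^sub>L 'f) \<Rightarrow> ('b \<Rightarrow> 'f bivec) \<Rightarrow> bool" where
  "holomorphic_Poisson \<B> J \<pi> \<longleftrightarrow> bivector_field \<B> \<pi> \<and>
     (\<forall>y\<in>carrier \<B>. \<forall>\<alpha> \<beta> \<gamma>. schouten \<B> \<pi> \<pi> y \<alpha> \<beta> \<gamma> = 0) \<and>
     (\<forall>W m z. complex_coordinates \<B> J W m z \<longrightarrow>
        (\<exists>P :: nat \<Rightarrow> nat \<Rightarrow> 'b \<Rightarrow> complex.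
           (\<forall>i<m. \<forall>j<m. J_holomorphic \<B> J W (P i j) \<and> (\<forall>y\<in>W. P i j y = - P j i y)) \<and>
           (\<forall>y\<in>W. \<forall>\<alpha> \<beta>. of_real (\<pi> y \<alpha> \<beta>) = (1/2) * (\<Sum>i<m. \<Sum>j<m.
              P i j y * (on_dz \<B> m z y i \<alpha> * on_dz \<B> m z y j \<beta>
                       - on_dz \<B> m z y j \<alpha> * on_dz \<B> m z y i \<beta>) +
              cnj (P i j y) * (on_dzbar \<B> m z y i \<alpha> * on_dzbar \<B> m z y j \<beta>
                             - on_dzbar \<B> m z y j \<alpha> * on_dzbar \<B> m z y i \<beta>)))))"

end

theory Submission
  imports Defs
begin

text \<open>
  Let \<open>H\<close> be the \<open>\<i>\<close>-eigenbundle of \<open>A\<close>, so that the complex tangent bundle is the sum of \<open>Q\<close>, \<open>H\<close> and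
  the conjugate of \<open>H\<close>. The \<open>\<i>\<close>-eigenbundle of \<open>\<Phi>\<close> consists of \<open>H\<close> and of pairs \<open>(\<sharp>\<alpha> / 2\<i>, \<alpha>)\<close>, up to \<open>H\<close>,
  where \<open>\<alpha> \<circ> A = - \<i> \<alpha>\<close>. Integrability, applied to a few well chosen sections, contains all that is needed.

  \<^item> Two fields in \<open>H\<close>: the Nijenhuis identity holds for fields with values in the image of \<open>A\<close>
    (\<open>nijenhuis_image_A\<close>).
  \<^item> A field in \<open>H\<close> and a form: \<open>[H, Q]\<close> lies in \<open>H + Q\<close>. For a real field \<open>Z\<close> in the image of \<open>A\<close> it follows that
    \<open>[AZ, Y]\<close> is in \<open>Q\<close> if \<open>[Z, Y]\<close> is, for \<open>Y\<close> in \<open>Q\<close> (\<open>kernel_bracket\<close>). As \<open>Q\<close> is involutive, \<open>A\<close> preserves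
    projectable fields (\<open>projectable_field_A\<close>).
  \<^item> Two forms that come from exact forms \<open>da\<close>, \<open>db\<close>, which vanish on \<open>Q\<close>: with \<open>{a, b} = \<pi>(da, db)\<close> one gets
    \<open>[\<sharp>da, \<sharp>db] = \<sharp>d{a, b}\<close> (\<open>integrability_exact\<close>), and \<open>d{a, b'} = - d{a, b} \<circ> A\<close> if \<open>da' = - da \<circ> A\<close> and
    \<open>db' = - db \<circ> A\<close> are exact too (\<open>differential_bracket_conjugate\<close>).

  Now let \<open>f\<close> be the projection to a local leaf space. A field on the leaf space has local lifts \<open>Z\<close> in the image of \<open>A\<close>
  (\<open>lift_field\<close>). They are projectable, hence so is \<open>AZ\<close>, and \<open>df(AZ)\<close> is locally constant along the fibres of \<open>f\<close>.
  The fibres are connected; therefore \<open>J \<circ> df = df \<circ> A\<close> defines an endomorphism \<open>J\<close> on the leaf space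
  (\<open>J_tangent\<close>). Since brackets of related fields are related, the first item gives the Nijenhuis identity of \<open>J\<close>.

  The bivector field on the leaf space is treated through the Poisson brackets of functions. For functions pulled back
  by \<open>f\<close> the third item yields the Jacobi identity, and the Jacobi identity of linear coordinates
  is the vanishing of the Schouten bracket. In complex coordinates
  \<open>A \<circ> \<sharp> = \<sharp> \<circ> A\<^sup>*\<close> says that \<open>{z\<^sub>i, conj z\<^sub>j} = 0\<close>, so that only the coefficients \<open>{z\<^sub>i, z\<^sub>j}\<close> and their conjugates
  occur. The second formula of the third item, for the real and imaginary parts of \<open>z\<^sub>i\<close> and \<open>z\<^sub>j\<close>, is the
  Cauchy-Riemann equation for \<open>{z\<^sub>i, z\<^sub>j}\<close>.

  Three tools about smooth maps carry the transfer: symmetry of second derivatives, which makes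
  the Lie bracket natural, the smooth inverse function theorem, and the normal form of a submersion.
\<close>

section \<open>Calculus of smooth maps\<close>

lemma Ck_on_subset: "Ck_on n S f \<Longrightarrow> T \<subseteq> S \<Longrightarrow> Ck_on n T f"
  by (induction n arbitrary: f) (auto intro: continuous_on_subset)

lemma has_derivative_cong_open:
  assumes "open S" "x \<in> S" "\<And>y. y \<in> S \<Longrightarrow> f y = g y"
  shows "(f has_derivative D) (at x) \<longleftrightarrow> (g has_derivative D) (at x)"
  using assms has_derivative_transform_within_open[of f D x UNIV S g]
    has_derivative_transform_within_open[of g D x UNIV S f] by auto

lemma frechet_derivative_cong_open:
  assumes "open S" "x \<in> S" "\<And>y. y \<in> S \<Longrightarrow> f y = g y"
  shows "frechet_derivative f (at x) = frechet_derivative g (at x)"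
  unfolding frechet_derivative_def using has_derivative_cong_open[OF assms] by simp

lemma Dmap_cong_open:
  assumes "open S" "x \<in> S" "\<And>y. y \<in> S \<Longrightarrow> f y = g y"
  shows "Dmap f x = Dmap g x"
  unfolding Dmap_def using frechet_derivative_cong_open[OF assms] by simp

lemma Dmap_eqI:
  assumes "(f has_derivative blinfun_apply L) (at x)"
  shows "Dmap f x = L"
  unfolding Dmap_def using frechet_derivative_at[OF assms] by (metis blinfun_apply_inverse)

lemma has_derivative_Dmap:
  assumes "f differentiable (at x)"
  shows "(f has_derivative blinfun_apply (Dmap f x)) (at x)"
proof -
  have "(f has_derivative frechet_derivative f (at x)) (at x)"
    using assms frechet_derivative_works by blast
  then show ?thesis
    unfolding Dmap_def by (simp add: bounded_linear_Blinfun_apply has_derivative_bounded_linear)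
qed

lemma Dmap_apply:
  assumes "(f has_derivative f') (at x)"
  shows "Dmap f x v = f' v"
  unfolding Dmap_def using frechet_derivative_at[OF assms] assms
  by (metis bounded_linear_Blinfun_apply has_derivative_bounded_linear)

lemma Dmap_const [simp]: "Dmap (\<lambda>y. k) x = 0"
  by (rule Dmap_eqI) (simp add: zero_blinfun.rep_eq)

lemma Ck_on_cong:
  assumes "open S"
  shows "Ck_on n S f \<Longrightarrow> (\<And>x. x \<in> S \<Longrightarrow> f x = g x) \<Longrightarrow> Ck_on n S g"
proof (induction n arbitrary: f g)
  case 0
  then show ?case using continuous_on_cong[OF refl, of S f g] by simp
next
  case (Suc n)
  have eq: "frechet_derivative f (at x) = frechet_derivative g (at x)" if "x \<in> S" for x
    using frechet_derivative_cong_open[OF assms that Suc.prems(2)] .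
  have "g differentiable (at x)" if "x \<in> S" for x
  proof -
    have "(f has_derivative D) (at x) \<longleftrightarrow> (g has_derivative D) (at x)" for D
      by (rule has_derivative_cong_open[OF assms that Suc.prems(2)])
    moreover have "f differentiable (at x)" using Suc.prems(1) that by simp
    ultimately show ?thesis unfolding differentiable_def by blast
  qed
  moreover have "Ck_on n S (\<lambda>x. frechet_derivative g (at x) v)" for v
    using Suc.IH[of "\<lambda>x. frechet_derivative f (at x) v"] Suc.prems(1) eq by auto
  ultimately show ?case by simp
qed

lemma Ck_on_SucD: "Ck_on (Suc n) S f \<Longrightarrow> Ck_on n S f"
proof (induction n arbitrary: f)
  case 0
  then show ?case
    by (simp add: continuous_on_eq_continuous_within continuous_at_imp_continuous_at_within
        differentiable_imp_continuous_within)
next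
  case (Suc n)
  then show ?case using Ck_on.simps(2) by blast
qed

lemma Ck_on_local:
  "(\<And>x. x \<in> S \<Longrightarrow> \<exists>T. open T \<and> x \<in> T \<and> Ck_on n T f) \<Longrightarrow> Ck_on n S f"
proof (induction n arbitrary: f)
  case 0
  have "continuous (at x within S) f" if x: "x \<in> S" for x
  proof -
    obtain T where "open T" "x \<in> T" "continuous_on T f" using 0 x by auto
    then show ?thesis
      by (metis continuous_at_imp_continuous_at_within continuous_on_eq_continuous_at)
  qed
  then show ?case by (simp add: continuous_on_eq_continuous_within)
next
  case (Suc n)
  have "f differentiable (at x)" if "x \<in> S" for x using Suc.prems[OF that] by auto
  moreover have "Ck_on n S (\<lambda>x. frechet_derivative f (at x) v)" for v
  proof (rule Suc.IH)
    fix x assume "x \<in> S"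
    then obtain T where "open T" "x \<in> T" "Ck_on (Suc n) T f" using Suc.prems by blast
    then show "\<exists>T. open T \<and> x \<in> T \<and> Ck_on n T (\<lambda>x. frechet_derivative f (at x) v)"
      by auto
  qed
  ultimately show ?case by simp
qed

lemma Ck_on_SucI:
  assumes "open S" "\<And>x. x \<in> S \<Longrightarrow> (f has_derivative f' x) (at x)"
    and "\<And>v. Ck_on n S (\<lambda>x. f' x v)"
  shows "Ck_on (Suc n) S f"
proof -
  have "Ck_on n S (\<lambda>x. frechet_derivative f (at x) v)" for v
    by (rule Ck_on_cong[OF assms(1) assms(3)]) (simp add: frechet_derivative_at[OF assms(2), symmetric])
  then show ?thesis using assms(2) by (auto simp: differentiable_def)
qed

lemma Ck_on_SucE:
  assumes "Ck_on (Suc n) S f" "x \<in> S"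
  shows "(f has_derivative frechet_derivative f (at x)) (at x)"
  using assms frechet_derivative_works by auto

lemma Ck_on_const: "open S \<Longrightarrow> Ck_on n S (\<lambda>x. k)"
proof (induction n arbitrary: k)
  case (Suc n)
  then show ?case by (intro Ck_on_SucI[where f' = "\<lambda>x v. 0"]) simp_all
qed auto

lemma Ck_on_bounded_linear:
  assumes "bounded_linear L" "open S"
  shows "Ck_on n S f \<Longrightarrow> Ck_on n S (\<lambda>x. L (f x))"
proof (induction n arbitrary: f)
  case 0
  then show ?case using assms linear_continuous_on_compose
    by (auto simp: bounded_linear.continuous_on)
next
  case (Suc n)
  show ?case
  proof (rule Ck_on_SucI[OF assms(2)])
    fix x assume "x \<in> S"
    show "((\<lambda>x. L (f x)) has_derivative (\<lambda>v. L (frechet_derivative f (at x) v))) (at x)"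
      using bounded_linear.has_derivative[OF assms(1) Ck_on_SucE[OF Suc.prems \<open>x \<in> S\<close>]] .
  qed (use Suc in auto)
qed

lemma Ck_on_add:
  assumes "open S"
  shows "Ck_on n S f \<Longrightarrow> Ck_on n S g \<Longrightarrow> Ck_on n S (\<lambda>x. f x + g x)"
proof (induction n arbitrary: f g)
  case (Suc n)
  show ?case
  proof (rule Ck_on_SucI[OF assms])
    fix x assume "x \<in> S"
    show "((\<lambda>x. f x + g x) has_derivative
        (\<lambda>v. frechet_derivative f (at x) v + frechet_derivative g (at x) v)) (at x)"
      by (rule has_derivative_add[OF Ck_on_SucE[OF Suc.prems(1) \<open>x \<in> S\<close>] Ck_on_SucE[OF Suc.prems(2) \<open>x \<in> S\<close>]])
  qed (use Suc in auto)
qed (auto intro: continuous_intros)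

lemma Ck_on_sum:
  assumes "open S" "\<And>i. i \<in> I \<Longrightarrow> Ck_on n S (f i)"
  shows "Ck_on n S (\<lambda>x. \<Sum>i\<in>I. f i x)"
  using assms(2)
proof (induction I rule: infinite_finite_induct)
  case (insert i I)
  then show ?case using Ck_on_add[OF assms(1), of n "f i" "\<lambda>x. \<Sum>i\<in>I. f i x"] by simp
qed (simp_all add: Ck_on_const assms(1))

lemma Ck_on_bilinear:
  assumes "bounded_bilinear B" "open S"
  shows "Ck_on n S f \<Longrightarrow> Ck_on n S g \<Longrightarrow> Ck_on n S (\<lambda>x. B (f x) (g x))"
proof (induction n arbitrary: f g)
  case 0
  then show ?case using bounded_bilinear.continuous_on[OF assms(1)] by auto
next
  case (Suc n)
  show ?case
  proof (rule Ck_on_SucI[OF assms(2)])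
    fix x assume "x \<in> S"
    show "((\<lambda>x. B (f x) (g x)) has_derivative
        (\<lambda>v. B (f x) (frechet_derivative g (at x) v) + B (frechet_derivative f (at x) v) (g x))) (at x)"
      by (intro bounded_bilinear.FDERIV[OF assms(1)] Ck_on_SucE[OF Suc.prems(1) \<open>x \<in> S\<close>]
          Ck_on_SucE[OF Suc.prems(2) \<open>x \<in> S\<close>])
  next
    fix v
    show "Ck_on n S (\<lambda>x. B (f x) (frechet_derivative g (at x) v) + B (frechet_derivative f (at x) v) (g x))"
    proof (rule Ck_on_add[OF assms(2)])
      show "Ck_on n S (\<lambda>x. B (f x) (frechet_derivative g (at x) v))"
        by (rule Suc.IH[OF Ck_on_SucD[OF Suc.prems(1)]]) (use Suc.prems(2) in simp)
      show "Ck_on n S (\<lambda>x. B (frechet_derivative f (at x) v) (g x))"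
        by (rule Suc.IH[OF _ Ck_on_SucD[OF Suc.prems(2)]]) (use Suc.prems(1) in simp)
    qed
  qed
qed

text \<open>The derivative of \<open>g \<circ> f\<close> in the direction \<open>v\<close> is \<open>\<Sum>\<^sub>b (Df v \<bullet> b) Dg b\<close>: a sum of products of maps
  that are one degree less regular, to which the induction hypothesis applies.\<close>

lemma Ck_on_compose:
  fixes f :: "'e::real_normed_vector \<Rightarrow> 'f::euclidean_space" and g :: "'f \<Rightarrow> 'v::real_normed_vector"
  assumes "open S" "open T" "f ` S \<subseteq> T"
  shows "Ck_on n S f \<Longrightarrow> Ck_on n T g \<Longrightarrow> Ck_on n S (\<lambda>x. g (f x))"
proof (induction n arbitrary: g)
  case 0
  then show ?case using continuous_on_compose2[of T g S f] assms(3) by simp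
next
  case (Suc n)
  let ?Df = "\<lambda>x. frechet_derivative f (at x)" and ?Dg = "\<lambda>y. frechet_derivative g (at y)"
  show ?case
  proof (rule Ck_on_SucI[OF assms(1)])
    fix x assume x: "x \<in> S"
    have Df: "(f has_derivative ?Df x) (at x)" 
      by (rule Ck_on_SucE[OF Suc.prems(1) x])
    have Dg: "(g has_derivative ?Dg (f x)) (at (f x))"
      by (rule Ck_on_SucE[OF Suc.prems(2)]) (use x assms(3) in blast)
    have der: "((\<lambda>x. g (f x)) has_derivative (\<lambda>v. ?Dg (f x) (?Df x v))) (at x)"
      using has_derivative_compose[OF Df Dg] by simp
    have eq: "?Dg (f x) w = (\<Sum>b\<in>Basis. (w \<bullet> b) *\<^sub>R ?Dg (f x) b)" for w
    proof -
      have "?Dg (f x) w = ?Dg (f x) (\<Sum>b\<in>Basis. (w \<bullet> b) *\<^sub>R b)" by (simp only: euclidean_representation)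
      also have "\<dots> = (\<Sum>b\<in>Basis. (w \<bullet> b) *\<^sub>R ?Dg (f x) b)"
        by (simp only: linear_sum[OF has_derivative_linear[OF Dg]] linear_scale[OF has_derivative_linear[OF Dg]])
      finally show ?thesis .
    qed
    show "((\<lambda>x. g (f x)) has_derivative
        (\<lambda>v. (\<Sum>b\<in>Basis. (?Df x v \<bullet> b) *\<^sub>R ?Dg (f x) b))) (at x)"
      unfolding eq[symmetric] by (rule der)
  next
    fix v
    have 1: "Ck_on n S (\<lambda>x. ?Df x v \<bullet> b)" for b
      by (rule Ck_on_bounded_linear[OF bounded_linear_inner_left assms(1)]) (use Suc.prems(1) in simp)
    have 2: "Ck_on n S (\<lambda>x. ?Dg (f x) b)" for b
      by (rule Suc.IH[OF Ck_on_SucD[OF Suc.prems(1)]]) (use Suc.prems(2) in simp)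
    show "Ck_on n S (\<lambda>x. \<Sum>b\<in>Basis. (?Df x v \<bullet> b) *\<^sub>R ?Dg (f x) b)"
      by (rule Ck_on_sum[OF assms(1)], rule Ck_on_bilinear[OF bounded_bilinear_scaleR assms(1) 1 2])
  qed
qed

lemma smooth_on_subset: "smooth_on S f \<Longrightarrow> T \<subseteq> S \<Longrightarrow> smooth_on T f"
  unfolding smooth_on_def using Ck_on_subset by blast

lemma smooth_on_cong: "smooth_on S f \<Longrightarrow> open S \<Longrightarrow> (\<And>x. x \<in> S \<Longrightarrow> f x = g x) \<Longrightarrow> smooth_on S g"
  unfolding smooth_on_def by (intro allI, rule Ck_on_cong[of S _ f g]) simp_all

lemma smooth_on_local: "(\<And>x. x \<in> S \<Longrightarrow> \<exists>T. open T \<and> x \<in> T \<and> smooth_on T f) \<Longrightarrow> smooth_on S f"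
  unfolding smooth_on_def by (intro allI, rule Ck_on_local) blast

lemma smooth_on_const: "open S \<Longrightarrow> smooth_on S (\<lambda>x. k)"
  unfolding smooth_on_def by (intro allI, rule Ck_on_const) simp_all

lemma smooth_on_bounded_linear:
  "bounded_linear L \<Longrightarrow> open S \<Longrightarrow> smooth_on S f \<Longrightarrow> smooth_on S (\<lambda>x. L (f x))"
  unfolding smooth_on_def by (intro allI, rule Ck_on_bounded_linear) simp_all

lemma smooth_on_id: "open S \<Longrightarrow> smooth_on S (\<lambda>x. x)"
proof -
  assume S: "open S"
  have "Ck_on (Suc n) S (\<lambda>x. x)" for n
    by (rule Ck_on_SucI[OF S, where f' = "\<lambda>x v. v"]) (auto intro: Ck_on_const S)
  then have "Ck_on n S (\<lambda>x. x)" for n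
    by (rule Ck_on_SucD)
  then show ?thesis unfolding smooth_on_def by blast
qed

lemma smooth_on_add:
  "open S \<Longrightarrow> smooth_on S f \<Longrightarrow> smooth_on S g \<Longrightarrow> smooth_on S (\<lambda>x. f x + g x)"
  unfolding smooth_on_def by (intro allI, rule Ck_on_add) simp_all

lemma smooth_on_minus: "open S \<Longrightarrow> smooth_on S f \<Longrightarrow> smooth_on S (\<lambda>x. - f x)"
  by (rule smooth_on_bounded_linear[OF bounded_linear_minus[OF bounded_linear_ident]])

lemma smooth_on_diff:
  "open S \<Longrightarrow> smooth_on S f \<Longrightarrow> smooth_on S g \<Longrightarrow> smooth_on S (\<lambda>x. f x - g x)"
  using smooth_on_add[of S f "\<lambda>x. - g x"] smooth_on_minus[of S g] by simp

lemma smooth_on_sum: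
  "open S \<Longrightarrow> (\<And>i. i \<in> I \<Longrightarrow> smooth_on S (f i)) \<Longrightarrow> smooth_on S (\<lambda>x. \<Sum>i\<in>I. f i x)"
  unfolding smooth_on_def by (intro allI, rule Ck_on_sum) simp_all

lemma smooth_on_bilinear:
  "bounded_bilinear B \<Longrightarrow> open S \<Longrightarrow> smooth_on S f \<Longrightarrow> smooth_on S g \<Longrightarrow> smooth_on S (\<lambda>x. B (f x) (g x))"
  unfolding smooth_on_def by (intro allI, rule Ck_on_bilinear) simp_all

lemmas smooth_on_blinfun_apply = smooth_on_bilinear[OF bounded_bilinear_blinfun_apply]
lemmas smooth_on_blinfun_compose = smooth_on_bilinear[OF bounded_bilinear_blinfun_compose]
lemma smooth_on_compose:
  fixes f :: "'e::real_normed_vector \<Rightarrow> 'f::euclidean_space"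
  shows "open S \<Longrightarrow> open T \<Longrightarrow> f ` S \<subseteq> T \<Longrightarrow> smooth_on S f \<Longrightarrow> smooth_on T g \<Longrightarrow> smooth_on S (\<lambda>x. g (f x))"
  unfolding smooth_on_def by (intro allI, rule Ck_on_compose[of S T f _ g]) simp_all

lemma smooth_on_continuous: "smooth_on S f \<Longrightarrow> continuous_on S f"
  unfolding smooth_on_def using Ck_on.simps(1) by blast

lemma smooth_on_differentiable: "smooth_on S f \<Longrightarrow> x \<in> S \<Longrightarrow> f differentiable (at x)"
  unfolding smooth_on_def using Ck_on.simps(2) by blast

lemma smooth_on_has_derivative:
  "smooth_on S f \<Longrightarrow> x \<in> S \<Longrightarrow> (f has_derivative blinfun_apply (Dmap f x)) (at x)"
  by (simp add: has_derivative_Dmap smooth_on_differentiable)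

lemma smooth_on_blinfunI:
  fixes F :: "'e::real_normed_vector \<Rightarrow> 'f::euclidean_space \<Rightarrow>\<^sub>L 'v::real_normed_vector"
  assumes "open S" "\<And>v. smooth_on S (\<lambda>x. F x v)"
  shows "smooth_on S F"
proof -
  let ?J = "\<lambda>b w. blinfun_scaleR_left w o\<^sub>L blinfun_inner_left b"
  have lin: "bounded_linear (?J b)" for b :: 'f
    using bounded_linear_compose[OF bounded_bilinear.bounded_linear_left[OF bounded_bilinear_blinfun_compose]
        bounded_linear_blinfun_scaleR_left] .
  have "F x = (\<Sum>b\<in>Basis. ?J b (F x b))" for x
  proof (rule blinfun_eqI)
    fix v
    have "F x v = F x (\<Sum>b\<in>Basis. (v \<bullet> b) *\<^sub>R b)" by (simp add: euclidean_representation)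
    then show "F x v = (\<Sum>b\<in>Basis. ?J b (F x b)) v"
      by (simp add: blinfun.sum_right blinfun.sum_left blinfun.scaleR_right)
  qed
  moreover have "smooth_on S (\<lambda>x. \<Sum>b\<in>Basis. ?J b (F x b))"
    by (intro smooth_on_sum smooth_on_bounded_linear[OF lin] assms)
  ultimately show ?thesis by presburger
qed

lemma smooth_on_Dmap:
  fixes f :: "'e::euclidean_space \<Rightarrow> 'v::real_normed_vector"
  assumes "open S" "smooth_on S f"
  shows "smooth_on S (Dmap f)"
proof (rule smooth_on_blinfunI[OF assms(1)])
  fix v
  have "smooth_on S (\<lambda>x. frechet_derivative f (at x) v)"
    unfolding smooth_on_def
  proof
    fix n
    have "Ck_on (Suc n) S f" using assms(2) smooth_on_def by blast
    then show "Ck_on n S (\<lambda>x. frechet_derivative f (at x) v)" using Ck_on.simps(2) by blast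
  qed
  then show "smooth_on S (\<lambda>x. Dmap f x v)"
  proof (rule smooth_on_cong[OF _ assms(1)])
    fix x assume "x \<in> S"
    then have "f differentiable (at x)" by (rule smooth_on_differentiable[OF assms(2)])
    then have "(f has_derivative frechet_derivative f (at x)) (at x)"
      by (simp add: frechet_derivative_works)
    then show "frechet_derivative f (at x) v = Dmap f x v" by (rule Dmap_apply[symmetric])
  qed
qed

lemma Dmap_compose:
  assumes "g differentiable (at (f x))" "f differentiable (at x)"
  shows "Dmap (\<lambda>y. g (f y)) x = Dmap g (f x) o\<^sub>L Dmap f x"
proof (rule Dmap_eqI)
  have "blinfun_apply (Dmap g (f x) o\<^sub>L Dmap f x) = (\<lambda>v. Dmap g (f x) (Dmap f x v))" by auto
  then show "((\<lambda>y. g (f y)) has_derivative blinfun_apply (Dmap g (f x) o\<^sub>L Dmap f x)) (at x)"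
    using has_derivative_compose[OF has_derivative_Dmap[OF assms(2)] has_derivative_Dmap[OF assms(1)]]
    by simp
qed

lemma Dmap_bounded_linear:
  assumes "bounded_linear L" "f differentiable (at x)"
  shows "Dmap (\<lambda>y. L (f y)) x v = L (Dmap f x v)"
  using bounded_linear.has_derivative[OF assms(1) has_derivative_Dmap[OF assms(2)]] by (rule Dmap_apply)

lemma Dmap_blinfun_apply:
  assumes "F differentiable (at x)" "X differentiable (at x)"
  shows "Dmap (\<lambda>y. blinfun_apply (F y) (X y)) x v = F x (Dmap X x v) + (Dmap F x v) (X x)"
  using bounded_bilinear.FDERIV[OF bounded_bilinear_blinfun_apply
      has_derivative_Dmap[OF assms(1)] has_derivative_Dmap[OF assms(2)]] by (rule Dmap_apply)


section \<open>Symmetry of the second derivative\<close>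

lemma DERIV_along_line:
  assumes "(g has_derivative G) (at (a + s *\<^sub>R w))"
  shows "((\<lambda>s. g (a + s *\<^sub>R w)) has_real_derivative G w) (at s)"
proof -
  have "((\<lambda>s. a + s *\<^sub>R w) has_derivative (\<lambda>r. r *\<^sub>R w)) (at s)"
    by (auto intro!: derivative_eq_intros)
  from has_derivative_compose[OF this assms]
  have "((\<lambda>s. g (a + s *\<^sub>R w)) has_derivative (\<lambda>r. G (r *\<^sub>R w))) (at s)" .
  moreover have "(\<lambda>r. G (r *\<^sub>R w)) = (*) (G w)"
    by (simp add: fun_eq_iff linear_scale[OF has_derivative_linear[OF assms]])
  ultimately show ?thesis unfolding has_field_derivative_def by simp
qed

text \<open>Two applications of the mean value theorem turn the second difference into a second
  derivative at a nearby point; the second difference is symmetric in the two directions.\<close>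

lemma second_difference:
  fixes f :: "'e::euclidean_space \<Rightarrow> real"
  assumes S: "open S" "ball x \<delta> \<subseteq> S" and f: "smooth_on S f" and h: "0 < h" "h * (norm u + norm v) < \<delta>"
  shows "\<exists>y\<in>ball x \<delta>. f (x + h *\<^sub>R u + h *\<^sub>R v) - f (x + h *\<^sub>R u) - f (x + h *\<^sub>R v) + f x
      = h * (h * Dmap (\<lambda>z. Dmap f z u) y v)"
proof -
  have inS: "x + s *\<^sub>R u + t *\<^sub>R v \<in> ball x \<delta>" if "0 \<le> s" "s \<le> h" "0 \<le> t" "t \<le> h" for s t
  proof -
    have "norm (s *\<^sub>R u + t *\<^sub>R v) \<le> s * norm u + t * norm v"
      using norm_triangle_ineq[of "s *\<^sub>R u" "t *\<^sub>R v"] that by simp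
    also have "\<dots> \<le> h * norm u + h * norm v" by (intro add_mono mult_right_mono that) auto
    also have "\<dots> < \<delta>" using h by (simp add: algebra_simps)
    finally have "norm (s *\<^sub>R u + t *\<^sub>R v) < \<delta>" .
    moreover have "dist x (x + s *\<^sub>R u + t *\<^sub>R v) = norm (s *\<^sub>R u + t *\<^sub>R v)"
      by (metis add.assoc add_diff_cancel_left' dist_commute dist_norm)
    ultimately show ?thesis by simp
  qed
  have Du: "smooth_on S (\<lambda>z. Dmap f z u)"
    by (intro smooth_on_blinfun_apply smooth_on_Dmap smooth_on_const S f)
  have comm: "x + s *\<^sub>R u + t *\<^sub>R v = x + t *\<^sub>R v + s *\<^sub>R u" for s t by simp
  have d1: "((\<lambda>s. f (x + s *\<^sub>R u + t *\<^sub>R v)) has_real_derivative Dmap f (x + s *\<^sub>R u + t *\<^sub>R v) u) (at s)"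
    if "0 \<le> s" "s \<le> h" "0 \<le> t" "t \<le> h" for s t
    unfolding comm
    by (rule DERIV_along_line, rule smooth_on_has_derivative[OF f]) (use inS[OF that] S comm in auto)
  have d2: "((\<lambda>t. Dmap f (x + s *\<^sub>R u + t *\<^sub>R v) u) has_real_derivative
      Dmap (\<lambda>z. Dmap f z u) (x + s *\<^sub>R u + t *\<^sub>R v) v) (at t)"
    if "0 \<le> s" "s \<le> h" "0 \<le> t" "t \<le> h" for s t
    by (rule DERIV_along_line, rule smooth_on_has_derivative[OF Du]) (use inS[OF that] S in auto)
  let ?\<phi> = "\<lambda>s. f (x + s *\<^sub>R u + h *\<^sub>R v) - f (x + s *\<^sub>R u + 0 *\<^sub>R v)"
  have "\<exists>\<xi>>0. \<xi> < h \<and> ?\<phi> h - ?\<phi> 0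
      = (h - 0) * (Dmap f (x + \<xi> *\<^sub>R u + h *\<^sub>R v) u - Dmap f (x + \<xi> *\<^sub>R u + 0 *\<^sub>R v) u)"
    by (rule MVT2[OF h(1)], rule DERIV_diff; rule d1) (use h(1) in auto)
  then obtain \<xi> where \<xi>: "0 < \<xi>" "\<xi> < h"
    "?\<phi> h - ?\<phi> 0 = (h - 0) * (Dmap f (x + \<xi> *\<^sub>R u + h *\<^sub>R v) u - Dmap f (x + \<xi> *\<^sub>R u + 0 *\<^sub>R v) u)"
    by blast
  have "\<exists>\<eta>>0. \<eta> < h \<and> Dmap f (x + \<xi> *\<^sub>R u + h *\<^sub>R v) u - Dmap f (x + \<xi> *\<^sub>R u + 0 *\<^sub>R v) u
      = (h - 0) * Dmap (\<lambda>z. Dmap f z u) (x + \<xi> *\<^sub>R u + \<eta> *\<^sub>R v) v"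
    by (rule MVT2[OF h(1)], rule d2) (use \<xi> in auto)
  then obtain \<eta> where \<eta>: "0 < \<eta>" "\<eta> < h"
    "Dmap f (x + \<xi> *\<^sub>R u + h *\<^sub>R v) u - Dmap f (x + \<xi> *\<^sub>R u + 0 *\<^sub>R v) u
      = (h - 0) * Dmap (\<lambda>z. Dmap f z u) (x + \<xi> *\<^sub>R u + \<eta> *\<^sub>R v) v"
    by blast
  have in_ball: "x + \<xi> *\<^sub>R u + \<eta> *\<^sub>R v \<in> ball x \<delta>"
    by (rule inS) (use \<xi> \<eta> in auto)
  show ?thesis
  proof (rule bexI[OF _ in_ball])
    show "f (x + h *\<^sub>R u + h *\<^sub>R v) - f (x + h *\<^sub>R u) - f (x + h *\<^sub>R v) + f x
      = h * (h * Dmap (\<lambda>z. Dmap f z u) (x + \<xi> *\<^sub>R u + \<eta> *\<^sub>R v) v)"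
      using \<xi>(3) unfolding \<eta>(3) by simp
  qed
qed

lemma second_derivative_symmetric_real:
  fixes f :: "'e::euclidean_space \<Rightarrow> real"
  assumes S: "open S" "x \<in> S" and f: "smooth_on S f"
  shows "Dmap (\<lambda>z. Dmap f z u) x v = Dmap (\<lambda>z. Dmap f z v) x u"
proof (rule ccontr)
  define a where "a = (\<lambda>u v y. Dmap (\<lambda>z. Dmap f z u) y v)"
  assume "\<not> ?thesis"
  then have e: "0 < \<bar>a u v x - a v u x\<bar> / 2" (is "0 < ?e") unfolding a_def by simp
  have cont: "continuous_on S (a u v)" for u v
    unfolding a_def by (intro smooth_on_continuous smooth_on_blinfun_apply smooth_on_Dmap smooth_on_const S f)
  have "isCont (a u v) x" for u v using cont S continuous_on_eq_continuous_at by blast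
  then have "\<exists>d>0. \<forall>y. dist y x < d \<longrightarrow> dist (a u v y) (a u v x) < ?e" for u v
    using e unfolding continuous_at_eps_delta by blast
  then obtain d1 d2 where d: "d1 > 0" "d2 > 0"
    "\<And>y. dist y x < d1 \<Longrightarrow> dist (a u v y) (a u v x) < ?e"
    "\<And>y. dist y x < d2 \<Longrightarrow> dist (a v u y) (a v u x) < ?e" by meson
  obtain d3 where d3: "d3 > 0" "ball x d3 \<subseteq> S" using S open_contains_ball by blast
  define \<delta> where "\<delta> = min d1 (min d2 d3)"
  have \<delta>: "\<delta> > 0" "ball x \<delta> \<subseteq> S" using d d3 unfolding \<delta>_def by auto
  define h where "h = \<delta> / (norm u + norm v + 1)"
  have np: "norm u + norm v + 1 > 0" by (smt (verit) norm_ge_zero)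
  have h: "h > 0" using \<delta> np unfolding h_def by simp
  have "h * (norm u + norm v) < h * (norm u + norm v + 1)" using h by simp
  also have "\<dots> = \<delta>" unfolding h_def using np by simp
  finally have h2: "h * (norm u + norm v) < \<delta>" .
  obtain y where y: "y \<in> ball x \<delta>" "f (x + h *\<^sub>R u + h *\<^sub>R v) - f (x + h *\<^sub>R u) - f (x + h *\<^sub>R v) + f x = h * (h * a u v y)"
    using second_difference[OF S(1) \<delta>(2) f h h2] unfolding a_def by blast
  obtain y' where y': "y' \<in> ball x \<delta>" "f (x + h *\<^sub>R v + h *\<^sub>R u) - f (x + h *\<^sub>R v) - f (x + h *\<^sub>R u) + f x = h * (h * a v u y')"
    using second_difference[OF S(1) \<delta>(2) f h, of v u] h2 unfolding a_def by (auto simp: add.commute)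
  have "x + h *\<^sub>R u + h *\<^sub>R v = x + h *\<^sub>R v + h *\<^sub>R u" by simp
  then have "h * (h * a u v y) = h * (h * a v u y')" using y(2) y'(2) by (simp only: diff_diff_eq add.commute)
  then have "a u v y = a v u y'" using h by simp
  moreover have "dist (a u v y) (a u v x) < ?e" "dist (a v u y') (a v u x) < ?e"
    by (rule d(3), use y(1) in \<open>simp add: \<delta>_def dist_commute\<close>)
      (rule d(4), use y'(1) in \<open>simp add: \<delta>_def dist_commute\<close>)
  moreover have False if "p = q" "\<bar>p - r\<bar> < \<bar>r - t\<bar> / 2" "\<bar>q - t\<bar> < \<bar>r - t\<bar> / 2" for p q r t :: real
    using that by (auto simp: abs_if split: if_splits)
  ultimately show False unfolding dist_real_def by blast
qed

lemma second_derivative_symmetric: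
  fixes f :: "'e::euclidean_space \<Rightarrow> 'v::real_inner"
  assumes S: "open S" "x \<in> S" and f: "smooth_on S f"
  shows "Dmap (\<lambda>z. Dmap f z u) x v = Dmap (\<lambda>z. Dmap f z v) x u"
proof -
  have *: "Dmap (\<lambda>z. Dmap f z u) x v \<bullet> w = Dmap (\<lambda>z. Dmap (\<lambda>y. f y \<bullet> w) z u) x v" for u v w
  proof -
    have "Dmap (\<lambda>z. Dmap (\<lambda>y. f y \<bullet> w) z u) x = Dmap (\<lambda>z. Dmap f z u \<bullet> w) x"
      by (rule Dmap_cong_open[OF S])
        (auto intro!: Dmap_bounded_linear bounded_linear_inner_left smooth_on_differentiable[OF f])
    also have "\<dots> v = Dmap (\<lambda>z. Dmap f z u) x v \<bullet> w"
      by (intro Dmap_bounded_linear bounded_linear_inner_left smooth_on_differentiable[OF _ S(2)]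
          smooth_on_blinfun_apply smooth_on_Dmap smooth_on_const S f)
    finally show ?thesis by simp
  qed
  have "smooth_on S (\<lambda>y. f y \<bullet> w)" for w
    by (intro smooth_on_bounded_linear[OF bounded_linear_inner_left] S f)
  then have "Dmap (\<lambda>z. Dmap f z u) x v \<bullet> w = Dmap (\<lambda>z. Dmap f z v) x u \<bullet> w" for w
    unfolding * by (rule second_derivative_symmetric_real[OF S])
  then show ?thesis using vector_eq_rdot by blast
qed

section \<open>Inverse maps and submersions\<close>

text \<open>Two inverses satisfy \<open>G y - G x = - G y (F y - F x) G x\<close>. This gives first a bound on \<open>G y\<close> near \<open>x\<close>,
  hence continuity of \<open>G\<close>, and then its derivative.\<close>

lemma inverse_blinfun_difference:
  fixes F G :: "'x \<Rightarrow> 'e::real_normed_vector \<Rightarrow>\<^sub>L 'e"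
  assumes "G y o\<^sub>L F y = id_blinfun" "F x o\<^sub>L G x = id_blinfun"
  shows "G y - G x = - (G y o\<^sub>L (F y - F x) o\<^sub>L G x)"
proof (rule blinfun_eqI)
  fix v
  have 1: "F x (G x v) = v" using assms(2) by (metis blinfun_apply_blinfun_compose blinfun_apply_id_blinfun)
  have 2: "G y (F y (G x v)) = G x v" using assms(1) by (metis blinfun_apply_blinfun_compose blinfun_apply_id_blinfun)
  show "(G y - G x) v = (- (G y o\<^sub>L (F y - F x) o\<^sub>L G x)) v"
    using 1 2 by (simp add: blinfun.diff_left blinfun.minus_left blinfun.diff_right)
qed

lemma inverse_blinfun_continuous:
  fixes F G :: "'x::real_normed_vector \<Rightarrow> 'e::real_normed_vector \<Rightarrow>\<^sub>L 'e"
  assumes S: "open S" "x \<in> S" and F: "isCont F x"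
    and inv: "\<And>y. y \<in> S \<Longrightarrow> F y o\<^sub>L G y = id_blinfun" "\<And>y. y \<in> S \<Longrightarrow> G y o\<^sub>L F y = id_blinfun"
  shows "isCont G x"
proof -
  let ?a = "norm (G x)"
  have F0: "((\<lambda>y. norm (F y - F x)) \<longlongrightarrow> 0) (at x)"
    using F unfolding isCont_def by (simp add: LIM_zero tendsto_norm_zero)
  then have "((\<lambda>y. norm (F y - F x) * ?a) \<longlongrightarrow> 0) (at x)" by (simp add: tendsto_mult_left_zero)
  then have small: "\<forall>\<^sub>F y in at x. norm (F y - F x) * ?a < 1 / 2"
    by (rule order_tendstoD(2)) simp
  have inS: "\<forall>\<^sub>F y in at x. y \<in> S" using S eventually_at_in_open' by blast
  have "\<forall>\<^sub>F y in at x. norm (G y - G x) \<le> 2 * ?a * (norm (F y - F x) * ?a)"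
    using small inS
  proof eventually_elim
    case (elim y)
    have "norm (G y - G x) = norm (G y o\<^sub>L (F y - F x) o\<^sub>L G x)"
      using inverse_blinfun_difference[of G y F x] inv elim S by simp
    also have "\<dots> \<le> norm (G y o\<^sub>L (F y - F x)) * ?a" by (rule norm_blinfun_compose)
    also have "\<dots> \<le> norm (G y) * norm (F y - F x) * ?a"
      by (intro mult_right_mono norm_blinfun_compose) simp
    finally have 1: "norm (G y - G x) \<le> norm (G y) * (norm (F y - F x) * ?a)" by (simp add: mult.assoc)
    also have "\<dots> \<le> norm (G y) * (1 / 2)" using elim by (intro mult_left_mono) auto
    finally have "norm (G y - G x) \<le> norm (G y) / 2" by simp
    moreover have "norm (G y) \<le> norm (G y - G x) + ?a"
      using norm_triangle_ineq[of "G y - G x" "G x"] by simp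
    ultimately have "norm (G y) \<le> 2 * ?a" by linarith
    then have "norm (G y) * (norm (F y - F x) * ?a) \<le> 2 * ?a * (norm (F y - F x) * ?a)"
      by (intro mult_right_mono) auto
    with 1 show ?case by linarith
  qed
  moreover have "((\<lambda>y. 2 * ?a * (norm (F y - F x) * ?a)) \<longlongrightarrow> 0) (at x)"
    using F0 by (simp add: tendsto_mult_left_zero tendsto_mult_right_zero)
  ultimately have "((\<lambda>y. G y - G x) \<longlongrightarrow> 0) (at x)" by (rule Lim_null_comparison)
  then show ?thesis unfolding isCont_def by (simp add: LIM_zero_iff)
qed

lemma inverse_blinfun_has_derivative:
  fixes F G :: "'x::real_normed_vector \<Rightarrow> 'e::real_normed_vector \<Rightarrow>\<^sub>L 'e"
  assumes S: "open S" "x \<in> S" and F: "(F has_derivative F') (at x)"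
    and inv: "\<And>y. y \<in> S \<Longrightarrow> F y o\<^sub>L G y = id_blinfun" "\<And>y. y \<in> S \<Longrightarrow> G y o\<^sub>L F y = id_blinfun"
  shows "(G has_derivative (\<lambda>v. - (G x o\<^sub>L F' v o\<^sub>L G x))) (at x)"
proof -
  let ?a = "norm (G x)"
  let ?r = "\<lambda>y. norm (F y - F x - F' (y - x)) / norm (y - x)"
  have bl: "bounded_linear F'" using F has_derivative_bounded_linear by blast
  obtain K where K: "\<And>v. norm (F' v) \<le> norm v * K" using bl bounded_linear.bounded by blast
  have r0: "(?r \<longlongrightarrow> 0) (at x)" using F unfolding has_derivative_iff_norm by blast
  have "isCont F x" using F has_derivative_continuous by blast
  then have "isCont G x" by (rule inverse_blinfun_continuous[OF S _ inv])
  then have G0: "((\<lambda>y. norm (G y - G x)) \<longlongrightarrow> 0) (at x)"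
    unfolding isCont_def by (simp add: LIM_zero tendsto_norm_zero)
  have inS: "\<forall>\<^sub>F y in at x. y \<in> S" using S eventually_at_in_open' by blast
  have ne: "\<forall>\<^sub>F y in at x. y \<noteq> x" by (simp add: eventually_at_filter)
  have bound: "\<forall>\<^sub>F y in at x. norm (norm (G y - G x - - (G x o\<^sub>L F' (y - x) o\<^sub>L G x)) / norm (y - x))
      \<le> norm (G y - G x) * (?r y + K) * ?a + ?a * ?r y * ?a"
    using inS ne
  proof eventually_elim
    case (elim y)
    let ?\<Delta> = "F y - F x" and ?n = "norm (y - x)"
    have n: "?n > 0" using elim by simp
    have expand: "((G y - G x) o\<^sub>L \<Delta> o\<^sub>L G x) = (G y o\<^sub>L \<Delta> o\<^sub>L G x) - (G x o\<^sub>L \<Delta> o\<^sub>L G x)"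
      "(G x o\<^sub>L (\<Delta> - E) o\<^sub>L G x) = (G x o\<^sub>L \<Delta> o\<^sub>L G x) - (G x o\<^sub>L E o\<^sub>L G x)" for \<Delta> E
      by (rule blinfun_eqI, simp add: blinfun.bilinear_simps)+
    have "G y - G x = - (G y o\<^sub>L ?\<Delta> o\<^sub>L G x)"
      by (rule inverse_blinfun_difference) (use inv elim S in auto)
    then have "G y - G x - - (G x o\<^sub>L F' (y - x) o\<^sub>L G x)
        = - ((G y - G x) o\<^sub>L ?\<Delta> o\<^sub>L G x) - (G x o\<^sub>L (?\<Delta> - F' (y - x)) o\<^sub>L G x)"
      unfolding expand by (simp only:) simp
    then have "norm (G y - G x - - (G x o\<^sub>L F' (y - x) o\<^sub>L G x))
        \<le> norm ((G y - G x) o\<^sub>L ?\<Delta> o\<^sub>L G x) + norm (G x o\<^sub>L (?\<Delta> - F' (y - x)) o\<^sub>L G x)"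
      by (metis norm_minus_cancel norm_triangle_ineq4)
    also have "\<dots> \<le> norm (G y - G x) * norm ?\<Delta> * ?a + ?a * norm (?\<Delta> - F' (y - x)) * ?a"
      by (intro add_mono order_trans[OF norm_blinfun_compose] mult_right_mono norm_blinfun_compose) auto
    finally have "norm (G y - G x - - (G x o\<^sub>L F' (y - x) o\<^sub>L G x)) / ?n
        \<le> (norm (G y - G x) * norm ?\<Delta> * ?a + ?a * norm (?\<Delta> - F' (y - x)) * ?a) / ?n"
      using n by (simp add: divide_right_mono)
    also have "\<dots> = norm (G y - G x) * (norm ?\<Delta> / ?n) * ?a + ?a * ?r y * ?a"
      by (simp add: add_divide_distrib)
    also have "\<dots> \<le> norm (G y - G x) * (?r y + K) * ?a + ?a * ?r y * ?a"
    proof -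
      have "norm ?\<Delta> \<le> norm (?\<Delta> - F' (y - x)) + norm (F' (y - x))"
        using norm_triangle_ineq[of "?\<Delta> - F' (y - x)" "F' (y - x)"] by simp
      also have "\<dots> \<le> norm (?\<Delta> - F' (y - x)) + ?n * K" using K by simp
      finally have "norm ?\<Delta> / ?n \<le> (norm (?\<Delta> - F' (y - x)) + ?n * K) / ?n"
        using n by (simp add: divide_right_mono)
      also have "\<dots> = ?r y + K" using n by (simp add: add_divide_distrib)
      finally show ?thesis by (intro add_mono mult_right_mono mult_left_mono) auto
    qed
    finally show ?case by simp
  qed
  have "((\<lambda>y. norm (G y - G x) * (?r y + K) * ?a + ?a * ?r y * ?a) \<longlongrightarrow> 0 * (0 + K) * ?a + ?a * 0 * ?a) (at x)"
    by (intro tendsto_intros G0 r0)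
  then have "((\<lambda>y. norm (G y - G x) * (?r y + K) * ?a + ?a * ?r y * ?a) \<longlongrightarrow> 0) (at x)"
    by (simp only: mult_zero_left mult_zero_right add_0)
  with bound have "((\<lambda>y. norm (G y - G x - - (G x o\<^sub>L F' (y - x) o\<^sub>L G x)) / norm (y - x)) \<longlongrightarrow> 0) (at x)"
    by (rule Lim_null_comparison)
  moreover have "bounded_linear (\<lambda>v. - (G x o\<^sub>L F' v o\<^sub>L G x))"
    using bounded_linear_minus[OF bounded_linear_compose[OF
        bounded_bilinear.bounded_linear_left[OF bounded_bilinear_blinfun_compose, of "G x"]
        bounded_linear_compose[OF bounded_bilinear.bounded_linear_right[OF bounded_bilinear_blinfun_compose, of "G x"] bl]]] .
  ultimately show ?thesis unfolding has_derivative_iff_norm by blast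
qed

lemma smooth_on_inverse_blinfun:
  fixes F G :: "'x::euclidean_space \<Rightarrow> 'e::real_normed_vector \<Rightarrow>\<^sub>L 'e"
  assumes S: "open S" and F: "smooth_on S F"
    and inv: "\<And>y. y \<in> S \<Longrightarrow> F y o\<^sub>L G y = id_blinfun" "\<And>y. y \<in> S \<Longrightarrow> G y o\<^sub>L F y = id_blinfun"
  shows "smooth_on S G"
  unfolding smooth_on_def
proof
  fix n
  show "Ck_on n S G"
  proof (induction n)
    case 0
    have "isCont G x" if "x \<in> S" for x
      by (rule inverse_blinfun_continuous[OF S that _ inv])
        (use smooth_on_has_derivative[OF F that] has_derivative_continuous in auto)
    then show ?case by (simp add: continuous_on_eq_continuous_at[OF S])
  next
    case (Suc n)
    show ?case
    proof (rule Ck_on_SucI[OF S])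
      fix x assume x: "x \<in> S"
      show "(G has_derivative (\<lambda>v. - (G x o\<^sub>L Dmap F x v o\<^sub>L G x))) (at x)"
        by (rule inverse_blinfun_has_derivative[OF S x smooth_on_has_derivative[OF F x] inv])
    next
      fix v
      have "smooth_on S (\<lambda>x. Dmap F x v)"
        by (rule smooth_on_blinfun_apply[OF S smooth_on_Dmap[OF S F] smooth_on_const[OF S]])
      then have "Ck_on n S (\<lambda>x. Dmap F x v)" unfolding smooth_on_def by blast
      note * = Ck_on_bilinear[OF bounded_bilinear_blinfun_compose S
          Ck_on_bilinear[OF bounded_bilinear_blinfun_compose S Suc.IH this] Suc.IH]
      show "Ck_on n S (\<lambda>x. - (G x o\<^sub>L Dmap F x v o\<^sub>L G x))"
        by (rule Ck_on_bounded_linear[OF bounded_linear_minus[OF bounded_linear_ident] S *])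
    qed
  qed
qed

text \<open>The derivative of the inverse is \<open>D\<psi>(y) = (D\<phi>(\<psi> y))\<^sup>-\<^sup>1\<close>. If \<open>\<psi>\<close> is of class \<open>C\<^sup>n\<close>, then so is the
  right hand side, and \<open>\<psi>\<close> is of class \<open>C\<^sup>n\<^sup>+\<^sup>1\<close>.\<close>

lemma smooth_on_inverse_map:
  fixes \<phi> \<psi> :: "'e::euclidean_space \<Rightarrow> 'e"
  assumes U: "open U" and V: "open V" and hom: "homeomorphism U V \<phi> \<psi>" and \<phi>: "smooth_on U \<phi>"
    and \<psi>: "\<And>y. y \<in> V \<Longrightarrow> \<psi> differentiable (at y)"
  shows "smooth_on V \<psi>"
proof -
  have im: "\<phi> x \<in> V" "\<psi> (\<phi> x) = x" if "x \<in> U" for x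
    using hom that unfolding homeomorphism_def by auto
  have im': "\<psi> y \<in> U" "\<phi> (\<psi> y) = y" if "y \<in> V" for y
    using hom that unfolding homeomorphism_def by auto
  have id: "Dmap (\<lambda>z. z) x = id_blinfun" for x :: 'e
    by (rule Dmap_eqI) simp
  define G where "G x = Dmap \<psi> (\<phi> x)" for x
  have GF: "G x o\<^sub>L Dmap \<phi> x = id_blinfun" if "x \<in> U" for x
  proof -
    have "G x o\<^sub>L Dmap \<phi> x = Dmap (\<lambda>z. \<psi> (\<phi> z)) x"
      unfolding G_def by (rule Dmap_compose[symmetric]) (use \<psi> im that smooth_on_differentiable[OF \<phi>] in auto)
    also have "\<dots> = Dmap (\<lambda>z. z) x" by (rule Dmap_cong_open[OF U that]) (rule im)
    finally show ?thesis using id by simp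
  qed
  have FG: "Dmap \<phi> x o\<^sub>L G x = id_blinfun" if "x \<in> U" for x
  proof -
    have "Dmap \<phi> x o\<^sub>L G x = Dmap (\<lambda>z. \<phi> (\<psi> z)) (\<phi> x)"
      unfolding G_def using Dmap_compose[of \<phi> \<psi> "\<phi> x"] \<psi> im that smooth_on_differentiable[OF \<phi>] by simp
    also have "\<dots> = Dmap (\<lambda>z. z) (\<phi> x)" by (rule Dmap_cong_open[OF V im(1)[OF that]]) (rule im')
    finally show ?thesis using id by simp
  qed
  have G: "smooth_on U G"
    by (rule smooth_on_inverse_blinfun[OF U smooth_on_Dmap[OF U \<phi>] FG GF])
  show ?thesis
    unfolding smooth_on_def
  proof
    fix n
    show "Ck_on n V \<psi>"
    proof (induction n)
      case 0
      show ?case using hom unfolding homeomorphism_def by simp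
    next
      case (Suc n)
      show ?case
      proof (rule Ck_on_SucI[OF V])
        fix y assume "y \<in> V"
        then show "(\<psi> has_derivative blinfun_apply (G (\<psi> y))) (at y)"
          unfolding G_def using has_derivative_Dmap[OF \<psi>] im' by simp
      next
        fix v
        have "smooth_on U (\<lambda>x. G x v)"
          by (rule smooth_on_blinfun_apply[OF U G smooth_on_const[OF U]])
        then have "Ck_on n U (\<lambda>x. G x v)" unfolding smooth_on_def by blast
        note * = Ck_on_compose[OF V U _ Suc.IH this]
        show "Ck_on n V (\<lambda>y. G (\<psi> y) v)"
          by (rule *) (use im' in auto)
      qed
    qed
  qed
qed

text \<open>Coordinates \<open>\<phi>\<close> around \<open>x0\<close>, with inverse \<open>\<psi>\<close>, in which the submersion \<open>g\<close> is affine. The linear map \<open>R\<close> is a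
  section of \<open>Dg(x0)\<close>.\<close>

definition straightens ::
  "('e::euclidean_space \<Rightarrow> 'f::euclidean_space) \<Rightarrow> 'e set \<Rightarrow> 'e \<Rightarrow> ('f \<Rightarrow>\<^sub>L 'e) \<Rightarrow>
    ('e \<Rightarrow> 'e) \<Rightarrow> ('e \<Rightarrow> 'e) \<Rightarrow> 'e set \<Rightarrow> real \<Rightarrow> bool" where
  "straightens g S x0 R \<phi> \<psi> U \<epsilon> \<longleftrightarrow>
     Dmap g x0 o\<^sub>L R = id_blinfun \<and> open U \<and> x0 \<in> U \<and> U \<subseteq> S \<and> 0 < \<epsilon> \<and>
     smooth_on U \<phi> \<and> smooth_on (ball 0 \<epsilon>) \<psi> \<and> \<phi> x0 = 0 \<and>
     (\<forall>x\<in>U. \<phi> x \<in> ball 0 \<epsilon> \<and> \<psi> (\<phi> x) = x) \<and>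
     (\<forall>u\<in>ball 0 \<epsilon>. \<psi> u \<in> U \<and> g (\<psi> u) = g x0 + Dmap g x0 u)"

lemma straightensD:
  assumes "straightens g S x0 R \<phi> \<psi> U \<epsilon>"
  shows "Dmap g x0 o\<^sub>L R = id_blinfun" "open U" "x0 \<in> U" "U \<subseteq> S" "0 < \<epsilon>"
    "smooth_on U \<phi>" "smooth_on (ball 0 \<epsilon>) \<psi>" "\<phi> x0 = 0"
    "x \<in> U \<Longrightarrow> \<phi> x \<in> ball 0 \<epsilon>" "x \<in> U \<Longrightarrow> \<psi> (\<phi> x) = x" "u \<in> ball 0 \<epsilon> \<Longrightarrow> \<psi> u \<in> U"
    "u \<in> ball 0 \<epsilon> \<Longrightarrow> g (\<psi> u) = g x0 + Dmap g x0 u"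
  using assms unfolding straightens_def by blast+

text \<open>The map \<open>\<phi>\<close> follows \<open>g\<close> in a complement of the kernel of \<open>Dg(x0)\<close>, and the identity in the kernel. It has
  the derivative \<open>id\<close> at \<open>x0\<close>, and \<open>g\<close> is affine in the coordinates \<open>\<phi>\<close>.\<close>

lemma submersion_normal_form:
  fixes g :: "'e::euclidean_space \<Rightarrow> 'f::euclidean_space"
  assumes S: "open S" "x0 \<in> S" and g: "smooth_on S g" and surj: "surj (blinfun_apply (Dmap g x0))"
  shows "\<exists>R \<phi> \<psi> U \<epsilon>. straightens g S x0 R \<phi> \<psi> U \<epsilon>"
proof -
  let ?L = "Dmap g x0"
  obtain R' where R': "linear R'" "blinfun_apply ?L \<circ> R' = id"
    using linear_surjective_right_inverse[OF _ surj] bounded_linear.linear blinfun.bounded_linear_right by blast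
  define R where "R = Blinfun R'"
  have Rapp: "blinfun_apply R = R'"
    unfolding R_def by (rule bounded_linear_Blinfun_apply) (use R'(1) linear_conv_bounded_linear in blast)
  have LR: "?L o\<^sub>L R = id_blinfun"
    by (rule blinfun_eqI) (use R'(2) Rapp in \<open>auto simp: fun_eq_iff\<close>)
  have LR': "?L (R w) = w" for w using LR by (metis blinfun_apply_blinfun_compose blinfun_apply_id_blinfun)
  define \<phi> where "\<phi> x = R (g x - g x0 - ?L (x - x0)) + (x - x0)" for x
  define D where "D x = (R o\<^sub>L (Dmap g x - ?L)) + id_blinfun" for x
  have \<phi>sm: "smooth_on S \<phi>"
    unfolding \<phi>_def
    by (rule smooth_on_add smooth_on_bounded_linear[OF blinfun.bounded_linear_right] smooth_on_diff
        smooth_on_const smooth_on_id S g)+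
  have D: "(\<phi> has_derivative blinfun_apply (D x)) (at x)" if "x \<in> S" for x
  proof -
    have "blinfun_apply (D x) = (\<lambda>v. R (Dmap g x v - 0 - ?L (v - 0)) + (v - 0))"
      unfolding D_def by (auto simp: blinfun.bilinear_simps)
    then show ?thesis unfolding \<phi>_def
      by (simp only:) (intro has_derivative_add has_derivative_diff has_derivative_ident has_derivative_const
          bounded_linear.has_derivative[OF blinfun.bounded_linear_right] smooth_on_has_derivative[OF g that])
  qed
  have Dx0: "id_blinfun o\<^sub>L D x0 = id_blinfun"
    unfolding D_def by (rule blinfun_eqI) (simp add: blinfun.bilinear_simps)
  have contD: "continuous_on S D"
    using continuous_on_cong[OF refl, of S "Dmap \<phi>" D] Dmap_eqI[OF D]
      smooth_on_continuous[OF smooth_on_Dmap[OF S(1) \<phi>sm]] by blast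
  have "\<exists>U' V \<psi>. open U' \<and> U' \<subseteq> S \<and> x0 \<in> U' \<and> open V \<and> \<phi> x0 \<in> V \<and> homeomorphism U' V \<phi> \<psi>
      \<and> (\<forall>y\<in>V. \<psi> differentiable (at y))"
  proof (rule inverse_function_theorem[OF S(1) D contD S(2) Dx0])
    fix U' V \<psi> \<psi>'
    assume *: "open U'" "U' \<subseteq> S" "x0 \<in> U'" "open V" "\<phi> x0 \<in> V" "homeomorphism U' V \<phi> \<psi>"
      and "\<And>y. y \<in> V \<Longrightarrow> (\<psi> has_derivative (\<psi>' y)) (at y)"
    then have "\<forall>y\<in>V. \<psi> differentiable (at y)" unfolding differentiable_def by blast
    with * show ?thesis by blast
  qed
  then obtain U' V \<psi> where U': "open U'" "U' \<subseteq> S" "x0 \<in> U'" and V: "open V" "\<phi> x0 \<in> V"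
    and hom: "homeomorphism U' V \<phi> \<psi>" and \<psi>': "\<And>y. y \<in> V \<Longrightarrow> \<psi> differentiable (at y)"
    by blast
  have \<psi>sm: "smooth_on V \<psi>"
    by (rule smooth_on_inverse_map[OF U'(1) V(1) hom smooth_on_subset[OF \<phi>sm U'(2)]])
      (rule \<psi>')
  have \<phi>0: "\<phi> x0 = 0" unfolding \<phi>_def by (simp add: blinfun.zero_right)
  obtain \<epsilon> where \<epsilon>: "0 < \<epsilon>" "ball 0 \<epsilon> \<subseteq> V" using V \<phi>0 open_contains_ball by metis
  have im: "\<phi> x \<in> V" "\<psi> (\<phi> x) = x" if "x \<in> U'" for x
    using hom that unfolding homeomorphism_def by auto
  have im': "\<psi> y \<in> U'" "\<phi> (\<psi> y) = y" if "y \<in> V" for y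
    using hom that unfolding homeomorphism_def by auto
  define U where "U = U' \<inter> \<phi> -` ball 0 \<epsilon>"
  have "continuous_on U' \<phi>" using hom unfolding homeomorphism_def by blast
  then have "open U" unfolding U_def using U'(1) by (rule continuous_open_preimage[OF _ _ open_ball])
  moreover have "g (\<psi> u) = g x0 + ?L u" if "u \<in> ball 0 \<epsilon>" for u
  proof -
    have "u = \<phi> (\<psi> u)" using im' that \<epsilon> by force
    then have "?L u = ?L (R (g (\<psi> u) - g x0 - ?L (\<psi> u - x0)) + (\<psi> u - x0))"
      unfolding \<phi>_def by simp
    then show ?thesis by (simp add: blinfun.add_right LR')
  qed
  moreover have "smooth_on U \<phi>" by (rule smooth_on_subset[OF \<phi>sm]) (use U' in \<open>auto simp: U_def\<close>)
  moreover have "smooth_on (ball 0 \<epsilon>) \<psi>" by (rule smooth_on_subset[OF \<psi>sm \<epsilon>(2)])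
  ultimately have "straightens g S x0 R \<phi> \<psi> U \<epsilon>"
    unfolding straightens_def using LR U' \<epsilon> \<phi>0 im im' by (auto simp: U_def subset_iff)
  then show ?thesis by blast
qed

lemma blinfun_compose_assoc: "((a o\<^sub>L b) o\<^sub>L c) = (a o\<^sub>L (b o\<^sub>L c))"
  by (rule blinfun_eqI) simp

text \<open>In straightening coordinates \<open>g \<circ> \<psi>\<close> has the constant derivative \<open>Dg(x0)\<close>, so that \<open>D\<psi> \<circ> R\<close> is a right inverse
  of \<open>Dg\<close> at every point.\<close>

lemma submersion_smooth_right_inverse:
  fixes g :: "'e::euclidean_space \<Rightarrow> 'f::euclidean_space"
  assumes S: "open S" "x0 \<in> S" and g: "smooth_on S g" and surj: "surj (blinfun_apply (Dmap g x0))"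
  obtains U R where "open U" "x0 \<in> U" "U \<subseteq> S" "smooth_on U R" "\<And>x. x \<in> U \<Longrightarrow> Dmap g x o\<^sub>L R x = id_blinfun"
proof -
  obtain R \<phi> \<psi> U \<epsilon> where st: "straightens g S x0 R \<phi> \<psi> U \<epsilon>"
    using submersion_normal_form[OF assms] by (elim exE)
  have LR: "Dmap g x0 o\<^sub>L R = id_blinfun" and U: "open U" "x0 \<in> U" "U \<subseteq> S" and \<epsilon>: "0 < \<epsilon>"
    and sm: "smooth_on U \<phi>" "smooth_on (ball 0 \<epsilon>) \<psi>" and \<phi>0: "\<phi> x0 = 0"
    and m: "\<And>x. x \<in> U \<Longrightarrow> \<phi> x \<in> ball 0 \<epsilon>" "\<And>x. x \<in> U \<Longrightarrow> \<psi> (\<phi> x) = x" "\<And>u. u \<in> ball 0 \<epsilon> \<Longrightarrow> \<psi> u \<in> U"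
    and nf: "\<And>u. u \<in> ball 0 \<epsilon> \<Longrightarrow> g (\<psi> u) = g x0 + Dmap g x0 u"
    by (fact straightensD[OF st])+
  have "Dmap g x o\<^sub>L (Dmap \<psi> (\<phi> x) o\<^sub>L R) = id_blinfun" if "x \<in> U" for x
  proof -
    have "Dmap g x o\<^sub>L Dmap \<psi> (\<phi> x) = Dmap (\<lambda>u. g (\<psi> u)) (\<phi> x)"
      using Dmap_compose[of g \<psi> "\<phi> x"] m that U smooth_on_differentiable[OF g] smooth_on_differentiable[OF sm(2)]
      by (simp add: subset_iff)
    also have "\<dots> = Dmap (\<lambda>u. g x0 + Dmap g x0 u) (\<phi> x)"
      by (rule Dmap_cong_open[OF open_ball m(1)[OF that] nf])
    also have "\<dots> = Dmap g x0"
      by (rule Dmap_eqI) (auto intro!: derivative_eq_intros bounded_linear_imp_has_derivative blinfun.bounded_linear_right)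
    finally show ?thesis using LR by (simp add: blinfun_compose_assoc[symmetric])
  qed
  moreover have "smooth_on U (\<lambda>x. Dmap \<psi> (\<phi> x) o\<^sub>L R)"
    by (rule smooth_on_blinfun_compose[OF U(1) smooth_on_compose[OF U(1) open_ball _ sm(1) smooth_on_Dmap[OF open_ball sm(2)]]
          smooth_on_const[OF U(1)]]) (use m in auto)
  ultimately show ?thesis using that[OF U] by blast
qed

text \<open>A submersion has the smooth local sections \<open>z \<mapsto> \<psi>(R(z - g x0))\<close>, and \<open>k\<close> is the composition of \<open>k \<circ> g\<close> with
  a section.\<close>

lemma smooth_on_factor_through_submersion:
  fixes g :: "'e::euclidean_space \<Rightarrow> 'f::euclidean_space" and k :: "'f \<Rightarrow> 'v::real_normed_vector"
  assumes S: "open S" and g: "smooth_on S g" and surj: "\<And>x. x \<in> S \<Longrightarrow> surj (blinfun_apply (Dmap g x))"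
    and k: "smooth_on S (\<lambda>x. k (g x))"
  shows "open (g ` S)" "smooth_on (g ` S) k"
proof -
  have *: "\<exists>T. open T \<and> y \<in> T \<and> T \<subseteq> g ` S \<and> smooth_on T k" if y: "y \<in> g ` S" for y
  proof -
    obtain x0 where x0: "x0 \<in> S" "y = g x0" using y by blast
    obtain R \<phi> \<psi> U \<epsilon> where st: "straightens g S x0 R \<phi> \<psi> U \<epsilon>"
      using submersion_normal_form[OF S x0(1) g surj[OF x0(1)]] by (elim exE)
    have LR: "Dmap g x0 o\<^sub>L R = id_blinfun" and U: "open U" "x0 \<in> U" "U \<subseteq> S" and \<epsilon>: "0 < \<epsilon>"
      and sm: "smooth_on U \<phi>" "smooth_on (ball 0 \<epsilon>) \<psi>" and \<phi>0: "\<phi> x0 = 0"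
      and m: "\<And>x. x \<in> U \<Longrightarrow> \<phi> x \<in> ball 0 \<epsilon>" "\<And>x. x \<in> U \<Longrightarrow> \<psi> (\<phi> x) = x" "\<And>u. u \<in> ball 0 \<epsilon> \<Longrightarrow> \<psi> u \<in> U"
      and nf: "\<And>u. u \<in> ball 0 \<epsilon> \<Longrightarrow> g (\<psi> u) = g x0 + Dmap g x0 u"
      by (fact straightensD[OF st])+
    have LR': "Dmap g x0 (R w) = w" for w using LR by (metis blinfun_apply_blinfun_compose blinfun_apply_id_blinfun)
    define T where "T = (\<lambda>z. R (z - g x0)) -` ball 0 \<epsilon>"
    have T: "open T" unfolding T_def
      by (intro continuous_intros open_vimage open_ball)
    have "y \<in> T" unfolding T_def using x0 \<epsilon> by (simp add: blinfun.zero_right)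
    have Rsm: "smooth_on T (\<lambda>z. R (z - g x0))"
      by (rule smooth_on_bounded_linear[OF blinfun.bounded_linear_right] smooth_on_diff smooth_on_id smooth_on_const T)+
    have \<sigma>: "smooth_on T (\<lambda>z. \<psi> (R (z - g x0)))"
      by (rule smooth_on_compose[OF T open_ball _ Rsm sm(2)]) (auto simp: T_def)
    have "smooth_on T (\<lambda>z. k (g (\<psi> (R (z - g x0)))))"
      by (rule smooth_on_compose[OF T S _ \<sigma> k]) (use m(3) U(3) in \<open>force simp: T_def\<close>)
    then have "smooth_on T k"
      by (rule smooth_on_cong[OF _ T]) (simp add: nf T_def LR')
    moreover have "T \<subseteq> g ` S"
    proof
      fix z assume "z \<in> T"
      then have u: "R (z - g x0) \<in> ball 0 \<epsilon>" unfolding T_def by simp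
      have "z = g (\<psi> (R (z - g x0)))" using nf[OF u] by (simp add: LR')
      then show "z \<in> g ` S" using m(3)[OF u] U(3) by blast
    qed
    ultimately show ?thesis using T \<open>y \<in> T\<close> by blast
  qed
  show "open (g ` S)" using * open_subopen[of "g ` S"] by meson
  show "smooth_on (g ` S) k" by (rule smooth_on_local) (use * in blast)
qed

text \<open>In straightening coordinates the fibre through \<open>x0\<close> is the intersection of a ball with a linear subspace, hence
  convex; along the segment from \<open>0\<close> the derivative of \<open>F \<circ> \<psi>\<close> vanishes.\<close>

lemma locally_constant_on_fibres:
  fixes g :: "'e::euclidean_space \<Rightarrow> 'f::euclidean_space" and F :: "'e \<Rightarrow> 'v::real_normed_vector"
  assumes S: "open S" "x0 \<in> S" and g: "smooth_on S g" and surj: "surj (blinfun_apply (Dmap g x0))"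
    and F: "smooth_on S F" and ker: "\<And>x v. x \<in> S \<Longrightarrow> Dmap g x v = 0 \<Longrightarrow> Dmap F x v = 0"
  obtains U where "open U" "x0 \<in> U" "U \<subseteq> S" "\<And>x. x \<in> U \<Longrightarrow> g x = g x0 \<Longrightarrow> F x = F x0"
proof -
  obtain R \<phi> \<psi> U \<epsilon> where st: "straightens g S x0 R \<phi> \<psi> U \<epsilon>"
    using submersion_normal_form[OF S g surj] by (elim exE)
  have LR: "Dmap g x0 o\<^sub>L R = id_blinfun" and U: "open U" "x0 \<in> U" "U \<subseteq> S" and \<epsilon>: "0 < \<epsilon>"
    and sm: "smooth_on U \<phi>" "smooth_on (ball 0 \<epsilon>) \<psi>" and \<phi>0: "\<phi> x0 = 0"
    and m: "\<And>x. x \<in> U \<Longrightarrow> \<phi> x \<in> ball 0 \<epsilon>" "\<And>x. x \<in> U \<Longrightarrow> \<psi> (\<phi> x) = x" "\<And>u. u \<in> ball 0 \<epsilon> \<Longrightarrow> \<psi> u \<in> U"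
    and nf: "\<And>u. u \<in> ball 0 \<epsilon> \<Longrightarrow> g (\<psi> u) = g x0 + Dmap g x0 u"
    by (fact straightensD[OF st])+
  have F\<psi>: "smooth_on (ball 0 \<epsilon>) (\<lambda>u. F (\<psi> u))" 
    by (rule smooth_on_compose[OF open_ball S(1) _ sm(2) F]) (use m U in auto)
  have "F x = F x0" if x: "x \<in> U" "g x = g x0" for x
  proof -
    define u where "u = \<phi> x"
    have u: "u \<in> ball 0 \<epsilon>" "\<psi> u = x" using m x unfolding u_def by auto
    have Lu: "Dmap g x0 u = 0" using nf[OF u(1)] u(2) x(2) by simp
    have line: "s *\<^sub>R u \<in> ball 0 \<epsilon>" if "s \<in> {0..1}" for s
    proof -
      have "norm (s *\<^sub>R u) \<le> norm u" using that by (simp add: mult_left_le_one_le)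
      then show ?thesis using u(1) by simp
    qed
    have "((\<lambda>s. F (\<psi> (s *\<^sub>R u))) has_derivative (\<lambda>r. 0)) (at s within {0..1})" if s: "s \<in> {0..1}" for s
    proof -
      let ?p = "s *\<^sub>R u"
      have p: "?p \<in> ball 0 \<epsilon>" using line s .
      have d\<psi>: "\<psi> differentiable (at ?p)" by (rule smooth_on_differentiable[OF sm(2) p])
      have pS: "\<psi> ?p \<in> S" using m p U by blast
      have "Dmap g (\<psi> ?p) (Dmap \<psi> ?p u) = Dmap (\<lambda>u. g (\<psi> u)) ?p u"
        using Dmap_compose[OF smooth_on_differentiable[OF g pS] d\<psi>] by simp
      also have "Dmap (\<lambda>u. g (\<psi> u)) ?p = Dmap (\<lambda>u. g x0 + Dmap g x0 u) ?p"
        by (rule Dmap_cong_open[OF open_ball p nf])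
      also have "\<dots> = Dmap g x0"
        by (rule Dmap_eqI) (auto intro!: derivative_eq_intros bounded_linear_imp_has_derivative blinfun.bounded_linear_right)
      finally have "Dmap F (\<psi> ?p) (Dmap \<psi> ?p u) = 0" using ker[OF pS] Lu by simp
      then have 0: "Dmap (\<lambda>u. F (\<psi> u)) ?p u = 0"
        using Dmap_compose[OF smooth_on_differentiable[OF F pS] d\<psi>] by simp
      have "((\<lambda>s. s *\<^sub>R u) has_derivative (\<lambda>r. r *\<^sub>R u)) (at s)"
        by (auto intro!: derivative_eq_intros)
      from has_derivative_compose[OF this smooth_on_has_derivative[OF F\<psi> p]]
      have "((\<lambda>s. F (\<psi> (s *\<^sub>R u))) has_derivative (\<lambda>r. Dmap (\<lambda>u. F (\<psi> u)) ?p (r *\<^sub>R u))) (at s)" .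
      then have "((\<lambda>s. F (\<psi> (s *\<^sub>R u))) has_derivative (\<lambda>r. 0)) (at s)"
        by (simp add: blinfun.scaleR_right 0)
      then show ?thesis by (rule has_derivative_at_withinI)
    qed
    then have "F (\<psi> (1 *\<^sub>R u)) = F (\<psi> (0 *\<^sub>R u))"
      by (intro has_derivative_zero_unique[of "{0..1}" "\<lambda>s. F (\<psi> (s *\<^sub>R u))"]) auto
    moreover have "\<psi> 0 = x0" using m(2)[OF U(2)] \<phi>0 by simp
    ultimately show ?thesis using u(2) by simp
  qed
  then show ?thesis using that U by blast
qed


section \<open>The Lie bracket in coordinates\<close>

definition coord_bracket :: "('e::real_normed_vector \<Rightarrow> 'e) \<Rightarrow> ('e \<Rightarrow> 'e) \<Rightarrow> 'e \<Rightarrow> 'e" where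
  "coord_bracket X Y x = Dmap Y x (X x) - Dmap X x (Y x)"

text \<open>\<open>dk([X, Y]) = X(Y k) - Y(X k)\<close>: the terms with the second derivative of \<open>k\<close> cancel. For a vector valued
  \<open>k\<close> this says that brackets are natural.\<close>

lemma Dmap_coord_bracket:
  fixes k :: "'e::euclidean_space \<Rightarrow> 'v::real_inner"
  assumes S: "open S" "x \<in> S" and k: "smooth_on S k" and X: "X differentiable (at x)" and Y: "Y differentiable (at x)"
  shows "Dmap k x (coord_bracket X Y x) = Dmap (\<lambda>z. Dmap k z (Y z)) x (X x) - Dmap (\<lambda>z. Dmap k z (X z)) x (Y x)"
proof -
  have Dk: "Dmap k differentiable (at x)"
    by (rule smooth_on_differentiable[OF smooth_on_Dmap[OF S(1) k] S(2)])
  have sym: "Dmap (Dmap k) x (X x) (Y x) = Dmap (Dmap k) x (Y x) (X x)"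
  proof -
    have *: "Dmap (\<lambda>z. Dmap k z v) x w = Dmap (Dmap k) x w v" for v w
      using Dmap_blinfun_apply[OF Dk, of "\<lambda>z. v"] by (simp add: blinfun.zero_right)
    show ?thesis using second_derivative_symmetric[OF S k] unfolding * .
  qed
  show ?thesis
    unfolding coord_bracket_def Dmap_blinfun_apply[OF Dk X] Dmap_blinfun_apply[OF Dk Y]
    by (simp add: blinfun.diff_right sym)
qed

section \<open>Tensor fields on manifolds in charts\<close>

abbreviation img :: "('a, 'e) chart \<Rightarrow> 'a set \<Rightarrow> 'e set" where
  "img c V \<equiv> chmap c ` (dom c \<inter> V)"

definition trans_D :: "('a, 'e::euclidean_space) chart \<Rightarrow> ('a, 'e) chart \<Rightarrow> 'a \<Rightarrow> 'e \<Rightarrow>\<^sub>L 'e" where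
  "trans_D c d q = Dmap (\<lambda>x. chmap d (chinv c x)) (chmap c q)"

definition coord_field ::
  "('a, 'e::euclidean_space) atlas \<Rightarrow> ('a, 'e) chart \<Rightarrow> ('e \<Rightarrow> 'e) \<Rightarrow> 'a \<Rightarrow> 'e" where
  "coord_field \<A> c Y q = from_chart \<A> c q (Y (chmap c q))"

locale manifold =
  fixes \<A> :: "('a::{t2_space,second_countable_topology}, 'e::euclidean_space) atlas"
  assumes smooth_atlas: "smooth_manifold \<A>"
begin

lemma open_dom: "c \<in> \<A> \<Longrightarrow> open (dom c)"
  using smooth_atlas unfolding smooth_manifold_def by blast

lemma chart_homeomorphism:
  "c \<in> \<A> \<Longrightarrow> homeomorphism (dom c) (chmap c ` dom c) (chmap c) (chinv c)"
  using smooth_atlas unfolding smooth_manifold_def by blast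

lemma chinv_chmap: "c \<in> \<A> \<Longrightarrow> q \<in> dom c \<Longrightarrow> chinv c (chmap c q) = q"
  using chart_homeomorphism unfolding homeomorphism_def by blast

lemma img_open: 
  assumes c: "c \<in> \<A>" and V: "open V"
  shows "open (img c V)"
proof -
  have "openin (top_of_set (dom c)) (dom c \<inter> V)" using V by (simp add: openin_open_Int)
  then have "openin (top_of_set (chmap c ` dom c)) (img c V)"
    using homeomorphism_imp_open_map[OF chart_homeomorphism[OF c]] by blast
  moreover have "open (chmap c ` dom c)" using smooth_atlas c unfolding smooth_manifold_def by blast
  ultimately show ?thesis using openin_open_trans by blast
qed

lemma img_mono: "V \<subseteq> W \<Longrightarrow> img c V \<subseteq> img c W"
  by blast

lemma chmap_in_img: "q \<in> dom c \<Longrightarrow> q \<in> V \<Longrightarrow> chmap c q \<in> img c V"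
  by blast

lemma transition_smooth:
  assumes "c \<in> \<A>" "d \<in> \<A>"
  shows "smooth_on (img c (dom d)) (\<lambda>x. chmap d (chinv c x))"
  using smooth_atlas assms unfolding smooth_manifold_def comp_def by blast

lemma chart_at: "p \<in> carrier \<A> \<Longrightarrow> chart_at \<A> p \<in> \<A>" "p \<in> carrier \<A> \<Longrightarrow> p \<in> dom (chart_at \<A> p)"
proof -
  assume "p \<in> carrier \<A>"
  then have "\<exists>c. c \<in> \<A> \<and> p \<in> dom c" unfolding carrier_def by blast
  from someI_ex[OF this] show "chart_at \<A> p \<in> \<A>" "p \<in> dom (chart_at \<A> p)"
    unfolding chart_at_def by simp_all
qed

lemma dom_carrier: "c \<in> \<A> \<Longrightarrow> q \<in> dom c \<Longrightarrow> q \<in> carrier \<A>"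
  unfolding carrier_def by blast

lemma trans_D_compose:
  assumes c: "c \<in> \<A>" "q \<in> dom c" and d: "d \<in> \<A>" "q \<in> dom d" and e: "e \<in> \<A>" "q \<in> dom e"
  shows "(trans_D d e q o\<^sub>L trans_D c d q) = trans_D c e q"
proof -
  let ?O = "img c (dom d \<inter> dom e)"
  have O: "open ?O" by (rule img_open[OF c(1) open_Int[OF open_dom[OF d(1)] open_dom[OF e(1)]]])
  have qO: "chmap c q \<in> ?O" by (rule chmap_in_img[OF c(2) IntI[OF d(2) e(2)]])
  have "Dmap (\<lambda>x. chmap e (chinv c x)) (chmap c q)
      = Dmap (\<lambda>x. (\<lambda>z. chmap e (chinv d z)) (chmap d (chinv c x))) (chmap c q)"
    by (rule Dmap_cong_open[OF O qO]) (auto simp: chinv_chmap c d)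
  also have "\<dots> = (Dmap (\<lambda>z. chmap e (chinv d z)) (chmap d (chinv c (chmap c q)))
      o\<^sub>L Dmap (\<lambda>x. chmap d (chinv c x)) (chmap c q))"
  proof (rule Dmap_compose)
    show "(\<lambda>z. chmap e (chinv d z)) differentiable (at (chmap d (chinv c (chmap c q))))"
      by (rule smooth_on_differentiable[OF transition_smooth[OF d(1) e(1)]])
        (use c d e chinv_chmap[OF c] in auto)
    show "(\<lambda>x. chmap d (chinv c x)) differentiable (at (chmap c q))"
      by (rule smooth_on_differentiable[OF transition_smooth[OF c(1) d(1)]]) (use c d in auto)
  qed
  finally show ?thesis unfolding trans_D_def chinv_chmap[OF c] by simp
qed

lemma trans_D_self:
  assumes "c \<in> \<A>" "q \<in> dom c"
  shows "trans_D c c q = id_blinfun"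
proof -
  have "Dmap (\<lambda>x. chmap c (chinv c x)) (chmap c q) = Dmap (\<lambda>x. x) (chmap c q)"
    by (rule Dmap_cong_open[OF img_open[OF assms(1) open_dom[OF assms(1)]] chmap_in_img[OF assms(2) assms(2)]])
      (auto simp: chinv_chmap assms)
  also have "\<dots> = id_blinfun" by (rule Dmap_eqI) simp
  finally show ?thesis unfolding trans_D_def .
qed

lemma to_chart_eq: "to_chart \<A> c q = trans_D (chart_at \<A> q) c q"
  unfolding to_chart_def trans_D_def comp_def ..

lemma from_chart_eq: "from_chart \<A> c q = trans_D c (chart_at \<A> q) q"
  unfolding from_chart_def trans_D_def comp_def ..

lemma to_chart_change:
  assumes "c \<in> \<A>" "q \<in> dom c" "d \<in> \<A>" "q \<in> dom d"
  shows "to_chart \<A> d q v = trans_D c d q (to_chart \<A> c q v)"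
  unfolding to_chart_eq trans_D_compose[OF chart_at[OF dom_carrier[OF assms(1,2)]] assms, symmetric] by simp

lemma to_chart_from_chart:
  assumes "c \<in> \<A>" "q \<in> dom c"
  shows "to_chart \<A> c q (from_chart \<A> c q v) = v"
proof -
  note b = chart_at[OF dom_carrier[OF assms]]
  have "(trans_D (chart_at \<A> q) c q o\<^sub>L trans_D c (chart_at \<A> q) q) = id_blinfun"
    using trans_D_compose[OF assms b assms] trans_D_self[OF assms] by simp
  from arg_cong[OF this, of "\<lambda>L. blinfun_apply L v"] show ?thesis
    unfolding from_chart_eq to_chart_eq by simp
qed

lemma from_chart_to_chart:
  assumes "c \<in> \<A>" "q \<in> dom c"
  shows "from_chart \<A> c q (to_chart \<A> c q v) = v"
proof -
  note b = chart_at[OF dom_carrier[OF assms]]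
  have "(trans_D c (chart_at \<A> q) q o\<^sub>L trans_D (chart_at \<A> q) c q) = id_blinfun"
    using trans_D_compose[OF b assms b] trans_D_self[OF b] by simp
  from arg_cong[OF this, of "\<lambda>L. blinfun_apply L v"] show ?thesis
    unfolding from_chart_eq to_chart_eq by simp
qed

lemma to_chart_at:
  assumes "p \<in> carrier \<A>"
  shows "to_chart \<A> (chart_at \<A> p) p = id_blinfun"
  unfolding to_chart_eq by (rule trans_D_self[OF chart_at[OF assms]])

lemma vec_rep_chmap: "c \<in> \<A> \<Longrightarrow> q \<in> dom c \<Longrightarrow> vec_rep \<A> c X (chmap c q) = to_chart \<A> c q (X q)"
  unfolding vec_rep_def by (simp add: chinv_chmap)

lemma form_rep_chmap: "c \<in> \<A> \<Longrightarrow> q \<in> dom c \<Longrightarrow> form_rep \<A> c \<alpha> (chmap c q) = (\<alpha> q o\<^sub>L from_chart \<A> c q)"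
  unfolding form_rep_def by (simp add: chinv_chmap)

lemma smooth_funD: "smooth_fun \<A> V f \<Longrightarrow> c \<in> \<A> \<Longrightarrow> smooth_on (img c V) (\<lambda>x. f (chinv c x))"
  unfolding smooth_fun_def comp_def by blast

lemma vector_fieldD: "vector_field \<A> V X \<Longrightarrow> c \<in> \<A> \<Longrightarrow> smooth_on (img c V) (vec_rep \<A> c X)"
  unfolding vector_field_def by blast

lemma one_formD: "one_form \<A> V \<alpha> \<Longrightarrow> c \<in> \<A> \<Longrightarrow> smooth_on (img c V) (form_rep \<A> c \<alpha>)"
  unfolding one_form_def by blast

lemma smooth_fun_subset: "smooth_fun \<A> V f \<Longrightarrow> W \<subseteq> V \<Longrightarrow> smooth_fun \<A> W f"
  unfolding smooth_fun_def using smooth_on_subset img_mono by metis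

lemma vector_field_subset: "vector_field \<A> V X \<Longrightarrow> W \<subseteq> V \<Longrightarrow> vector_field \<A> W X"
  unfolding vector_field_def using smooth_on_subset img_mono by metis

lemma smooth_fun_cong:
  assumes "smooth_fun \<A> V f" "open V" "\<And>q. q \<in> V \<Longrightarrow> f q = g q"
  shows "smooth_fun \<A> V g"
  unfolding smooth_fun_def comp_def
proof
  fix c assume c: "c \<in> \<A>"
  show "smooth_on (img c V) (\<lambda>x. g (chinv c x))"
    by (rule smooth_on_cong[OF smooth_funD[OF assms(1) c] img_open[OF c assms(2)]])
      (auto simp: chinv_chmap[OF c] assms(3))
qed

lemma vector_field_cong:
  assumes "vector_field \<A> V X" "open V" "\<And>q. q \<in> V \<Longrightarrow> X q = Y q"
  shows "vector_field \<A> V Y"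
  unfolding vector_field_def
proof
  fix c assume c: "c \<in> \<A>"
  show "smooth_on (img c V) (vec_rep \<A> c Y)"
    by (rule smooth_on_cong[OF vector_fieldD[OF assms(1) c] img_open[OF c assms(2)]])
      (auto simp: vec_rep_def chinv_chmap[OF c] assms(3))
qed

lemma one_form_cong:
  assumes "one_form \<A> V \<alpha>" "open V" "\<And>q. q \<in> V \<Longrightarrow> \<alpha> q = \<beta> q"
  shows "one_form \<A> V \<beta>"
  unfolding one_form_def
proof
  fix c assume c: "c \<in> \<A>"
  show "smooth_on (img c V) (form_rep \<A> c \<beta>)"
    by (rule smooth_on_cong[OF one_formD[OF assms(1) c] img_open[OF c assms(2)]])
      (auto simp: form_rep_def chinv_chmap[OF c] assms(3))
qed

lemma transition_on:
  assumes "c \<in> \<A>" "d \<in> \<A>" "open W" "W \<subseteq> dom c" "W \<subseteq> dom d"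
  shows "smooth_on (img d W) (\<lambda>x. chmap c (chinv d x))" "(\<lambda>x. chmap c (chinv d x)) ` img d W \<subseteq> img c W"
    "open (img c W)" "open (img d W)"
proof -
  show "smooth_on (img d W) (\<lambda>x. chmap c (chinv d x))"
    by (rule smooth_on_subset[OF transition_smooth[OF assms(2,1)]]) (use assms in auto)
  show "(\<lambda>x. chmap c (chinv d x)) ` img d W \<subseteq> img c W"
    using assms by (auto simp: chinv_chmap)
  show "open (img c W)" "open (img d W)" using img_open assms by auto
qed

text \<open>Smoothness is required in all charts. The next two lemmas reduce it to one chart around each point, as
  representatives in different charts differ by smooth coordinate changes.\<close>

lemma smooth_fun_local:
  assumes "\<And>p. p \<in> V \<Longrightarrow> \<exists>c W. c \<in> \<A> \<and> open W \<and> p \<in> W \<and> W \<subseteq> dom c \<and> smooth_on (img c W) (\<lambda>x. f (chinv c x))"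
  shows "smooth_fun \<A> V f"
  unfolding smooth_fun_def comp_def
proof (intro ballI smooth_on_local)
  fix d x assume d: "d \<in> \<A>" and x: "x \<in> img d V"
  then obtain p where p: "p \<in> V" "p \<in> dom d" "x = chmap d p" by blast
  obtain c W where c: "c \<in> \<A>" and W: "open W" "p \<in> W" "W \<subseteq> dom c" and f: "smooth_on (img c W) (\<lambda>x. f (chinv c x))"
    using assms[OF p(1)] by blast
  let ?W = "W \<inter> dom d"
  have W': "open ?W" "?W \<subseteq> dom c" "?W \<subseteq> dom d" using W open_dom[OF d] by auto
  note t = transition_on[OF c d W']
  have "smooth_on (img d ?W) (\<lambda>x. f (chinv c (chmap c (chinv d x))))"
    by (rule smooth_on_compose[OF t(4) t(3) t(2) t(1) smooth_on_subset[OF f]]) auto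
  then have "smooth_on (img d ?W) (\<lambda>x. f (chinv d x))"
    by (rule smooth_on_cong[OF _ t(4)]) (use W' in \<open>auto simp: chinv_chmap c d subset_iff\<close>)
  then show "\<exists>T. open T \<and> x \<in> T \<and> smooth_on T (\<lambda>x. f (chinv d x))"
    using t(4) p W by blast
qed

lemma vector_field_local:
  assumes "\<And>p. p \<in> V \<Longrightarrow> \<exists>c W. c \<in> \<A> \<and> open W \<and> p \<in> W \<and> W \<subseteq> dom c \<and> smooth_on (img c W) (vec_rep \<A> c X)"
  shows "vector_field \<A> V X"
  unfolding vector_field_def
proof (intro ballI smooth_on_local)
  fix d x assume d: "d \<in> \<A>" and x: "x \<in> img d V"
  then obtain p where p: "p \<in> V" "p \<in> dom d" "x = chmap d p" by blast
  obtain c W where c: "c \<in> \<A>" and W: "open W" "p \<in> W" "W \<subseteq> dom c" and X: "smooth_on (img c W) (vec_rep \<A> c X)"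
    using assms[OF p(1)] by blast
  let ?W = "W \<inter> dom d"
  have W': "open ?W" "?W \<subseteq> dom c" "?W \<subseteq> dom d" using W open_dom[OF d] by auto
  note t = transition_on[OF c d W'] and t' = transition_on[OF d c W'(1,3,2)]
  have D: "smooth_on (img c ?W) (\<lambda>z. Dmap (\<lambda>x. chmap d (chinv c x)) z (vec_rep \<A> c X z))"
    by (rule smooth_on_blinfun_apply[OF t(3) smooth_on_Dmap[OF t(3) t'(1)] smooth_on_subset[OF X]]) auto
  have "smooth_on (img d ?W) (\<lambda>x. (\<lambda>z. Dmap (\<lambda>x. chmap d (chinv c x)) z (vec_rep \<A> c X z)) (chmap c (chinv d x)))"
    by (rule smooth_on_compose[OF t(4) t(3) t(2) t(1) D])
  then have "smooth_on (img d ?W) (vec_rep \<A> d X)"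
  proof (rule smooth_on_cong[OF _ t(4)])
    fix x assume "x \<in> img d ?W"
    then obtain q where q: "q \<in> ?W" "x = chmap d q" by blast
    then have qc: "q \<in> dom c" "q \<in> dom d" using W' by auto
    show "Dmap (\<lambda>x. chmap d (chinv c x)) (chmap c (chinv d x)) (vec_rep \<A> c X (chmap c (chinv d x))) = vec_rep \<A> d X x"
      unfolding q(2) chinv_chmap[OF d qc(2)] vec_rep_chmap[OF c qc(1)] vec_rep_chmap[OF d qc(2)]
        to_chart_change[OF c qc(1) d qc(2)] trans_D_def ..
  qed
  then show "\<exists>T. open T \<and> x \<in> T \<and> smooth_on T (vec_rep \<A> d X)"
    using t(4) p W by blast
qed

lemma smooth_fun_bounded_linear:
  "bounded_linear L \<Longrightarrow> open V \<Longrightarrow> smooth_fun \<A> V f \<Longrightarrow> smooth_fun \<A> V (\<lambda>q. L (f q))"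
  unfolding smooth_fun_def comp_def using smooth_on_bounded_linear[OF _ img_open] by blast

lemma smooth_fun_add:
  "open V \<Longrightarrow> smooth_fun \<A> V f \<Longrightarrow> smooth_fun \<A> V g \<Longrightarrow> smooth_fun \<A> V (\<lambda>q. f q + g q)"
  unfolding smooth_fun_def comp_def by (intro ballI smooth_on_add[OF img_open]) auto

lemma vector_field_add:
  "open V \<Longrightarrow> vector_field \<A> V X \<Longrightarrow> vector_field \<A> V Y \<Longrightarrow> vector_field \<A> V (\<lambda>q. X q + Y q)"
  unfolding vector_field_def vec_rep_def blinfun.add_right by (intro ballI smooth_on_add[OF img_open]) auto

lemma vector_field_scaleR:
  "open V \<Longrightarrow> vector_field \<A> V X \<Longrightarrow> vector_field \<A> V (\<lambda>q. r *\<^sub>R X q)"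
  unfolding vector_field_def vec_rep_def blinfun.scaleR_right
  by (intro ballI smooth_on_bounded_linear[OF bounded_linear_scaleR_right] img_open) auto

lemma vector_field_minus:
  "open V \<Longrightarrow> vector_field \<A> V X \<Longrightarrow> vector_field \<A> V (\<lambda>q. - X q)"
  using vector_field_scaleR[of V X "-1"] by simp

lemma one_form_scaleR:
  "open V \<Longrightarrow> one_form \<A> V \<alpha> \<Longrightarrow> one_form \<A> V (\<lambda>q. r *\<^sub>R \<alpha> q)"
  unfolding one_form_def form_rep_def bounded_bilinear.scaleR_left[OF bounded_bilinear_blinfun_compose]
  by (intro ballI smooth_on_bounded_linear[OF bounded_linear_scaleR_right] img_open) auto

lemma one_form_minus:
  "open V \<Longrightarrow> one_form \<A> V \<alpha> \<Longrightarrow> one_form \<A> V (\<lambda>q. - \<alpha> q)"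
  using one_form_scaleR[of V \<alpha> "-1"] by simp

lemma vector_field_zero: "open V \<Longrightarrow> vector_field \<A> V (\<lambda>q. 0)"
  unfolding vector_field_def vec_rep_def blinfun.zero_right by (intro ballI smooth_on_const img_open) auto

lemma one_form_zero: "open V \<Longrightarrow> one_form \<A> V (\<lambda>q. 0)"
  unfolding one_form_def form_rep_def bounded_bilinear.zero_left[OF bounded_bilinear_blinfun_compose]
  by (intro ballI smooth_on_const img_open) auto

lemma vec_rep_coord_field:
  assumes "c \<in> \<A>" "x \<in> img c V"
  shows "vec_rep \<A> c (coord_field \<A> c Y) x = Y x"
proof -
  obtain q where "q \<in> dom c" "x = chmap c q" using assms by blast
  then show ?thesis
    by (simp add: vec_rep_chmap assms(1) coord_field_def to_chart_from_chart)
qed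

lemma vector_field_coord_field:
  assumes c: "c \<in> \<A>" and W: "open W" "W \<subseteq> dom c" and Y: "smooth_on (img c W) Y"
  shows "vector_field \<A> W (coord_field \<A> c Y)"
proof (rule vector_field_local)
  fix p assume "p \<in> W"
  moreover have "smooth_on (img c W) (vec_rep \<A> c (coord_field \<A> c Y))"
    by (rule smooth_on_cong[OF Y img_open[OF c W(1)]]) (simp add: vec_rep_coord_field[OF c])
  ultimately show "\<exists>c' W'. c' \<in> \<A> \<and> open W' \<and> p \<in> W' \<and> W' \<subseteq> dom c' \<and> smooth_on (img c' W') (vec_rep \<A> c' (coord_field \<A> c Y))"
    using c W by blast
qed

lemma coord_field_apply: "c \<in> \<A> \<Longrightarrow> q \<in> dom c \<Longrightarrow> to_chart \<A> c q (coord_field \<A> c Y q) = Y (chmap c q)"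
  by (simp add: coord_field_def to_chart_from_chart)

lemma extend_vector:
  assumes "p \<in> carrier \<A>"
  obtains W Y where "open W" "p \<in> W" "W \<subseteq> carrier \<A>" "vector_field \<A> W Y" "Y p = v"
proof -
  let ?c = "chart_at \<A> p"
  note c = chart_at[OF assms]
  show ?thesis
  proof (rule that[of "dom ?c" "coord_field \<A> ?c (\<lambda>x. v)"])
    show "vector_field \<A> (dom ?c) (coord_field \<A> ?c (\<lambda>x. v))"
      by (rule vector_field_coord_field[OF c(1) open_dom[OF c(1)] _ smooth_on_const[OF img_open[OF c(1) open_dom[OF c(1)]]]])
        simp
    show "coord_field \<A> ?c (\<lambda>x. v) p = v"
      unfolding coord_field_def from_chart_eq by (simp add: trans_D_self[OF c])
  qed (use c open_dom[OF c(1)] dom_carrier[OF c(1)] in auto)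
qed

lemma chmap_smooth_fun:
  assumes "d \<in> \<A>"
  shows "smooth_fun \<A> (dom d) (chmap d)"
  unfolding smooth_fun_def comp_def using transition_smooth assms by blast

lemma differential_chart:
  assumes f: "smooth_fun \<A> V f" and p: "p \<in> V" "open V" and c: "c \<in> \<A>" "p \<in> dom c"
  shows "differential \<A> f p = (Dmap (\<lambda>x. f (chinv c x)) (chmap c p) o\<^sub>L to_chart \<A> c p)"
proof -
  let ?b = "chart_at \<A> p"
  note b = chart_at[OF dom_carrier[OF c]]
  let ?O = "img ?b (V \<inter> dom c)"
  have O: "open ?O" by (rule img_open[OF b(1) open_Int[OF p(2) open_dom[OF c(1)]]])
  have pO: "chmap ?b p \<in> ?O" by (rule chmap_in_img[OF b(2) IntI[OF p(1) c(2)]])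
  have "Dmap (\<lambda>x. f (chinv ?b x)) (chmap ?b p)
      = Dmap (\<lambda>x. (\<lambda>z. f (chinv c z)) (chmap c (chinv ?b x))) (chmap ?b p)"
    by (rule Dmap_cong_open[OF O pO]) (auto simp: chinv_chmap c b)
  also have "\<dots> = (Dmap (\<lambda>z. f (chinv c z)) (chmap c (chinv ?b (chmap ?b p)))
      o\<^sub>L Dmap (\<lambda>x. chmap c (chinv ?b x)) (chmap ?b p))"
  proof (rule Dmap_compose)
    show "(\<lambda>z. f (chinv c z)) differentiable (at (chmap c (chinv ?b (chmap ?b p))))"
      by (rule smooth_on_differentiable[OF smooth_funD[OF f c(1)]]) (use c p chinv_chmap[OF b] in auto)
    show "(\<lambda>x. chmap c (chinv ?b x)) differentiable (at (chmap ?b p))"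
      by (rule smooth_on_differentiable[OF transition_smooth[OF b(1) c(1)]]) (use c b in auto)
  qed
  finally show ?thesis
    unfolding differential_def to_chart_def comp_def chinv_chmap[OF b] .
qed

lemma differential_chart_at: "p \<in> carrier \<A> \<Longrightarrow> differential \<A> f p = Dmap (\<lambda>x. f (chinv (chart_at \<A> p) x)) (chmap (chart_at \<A> p) p)"
  unfolding differential_def comp_def ..

lemma differential_cong:
  assumes "open W" "p \<in> W" "W \<subseteq> carrier \<A>" "\<And>q. q \<in> W \<Longrightarrow> f q = g q"
  shows "differential \<A> f p = differential \<A> g p"
proof -
  have p: "p \<in> carrier \<A>" using assms by blast
  note b = chart_at[OF p]
  show ?thesis unfolding differential_chart_at[OF p]
    by (rule Dmap_cong_open[OF img_open[OF b(1) assms(1)] chmap_in_img[OF b(2) assms(2)]])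
      (auto simp: chinv_chmap[OF b(1)] assms(4))
qed

lemma form_rep_differential:
  assumes f: "smooth_fun \<A> V f" and V: "open V" and c: "c \<in> \<A>" and x: "x \<in> img c V"
  shows "form_rep \<A> c (differential \<A> f) x = Dmap (\<lambda>x. f (chinv c x)) x"
proof -
  obtain q where q: "q \<in> dom c" "q \<in> V" "x = chmap c q" using x by blast
  show ?thesis
    unfolding q(3) form_rep_chmap[OF c q(1)] differential_chart[OF f q(2) V c q(1)]
    by (rule blinfun_eqI) (simp add: to_chart_from_chart[OF c q(1)])
qed

lemma one_form_differential:
  fixes f :: "'a \<Rightarrow> real"
  assumes f: "smooth_fun \<A> V f" and V: "open V"
  shows "one_form \<A> V (differential \<A> f)"
  unfolding one_form_def
proof
  fix c assume c: "c \<in> \<A>"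
  show "smooth_on (img c V) (form_rep \<A> c (differential \<A> f))"
    by (rule smooth_on_cong[OF smooth_on_Dmap[OF img_open[OF c V] smooth_funD[OF f c]] img_open[OF c V]])
      (simp add: form_rep_differential[OF f V c])
qed

lemma pairing_rep:
  assumes "c \<in> \<A>" "q \<in> dom c"
  shows "form_rep \<A> c \<beta> (chmap c q) (vec_rep \<A> c Y (chmap c q)) = \<beta> q (Y q)"
  by (simp add: form_rep_chmap[OF assms] vec_rep_chmap[OF assms] from_chart_to_chart[OF assms])

lemma smooth_fun_pairing:
  assumes V: "open V" and \<beta>: "one_form \<A> V \<beta>" and Y: "vector_field \<A> V Y"
  shows "smooth_fun \<A> V (\<lambda>q. \<beta> q (Y q))"
  unfolding smooth_fun_def comp_def
proof
  fix c assume c: "c \<in> \<A>"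
  show "smooth_on (img c V) (\<lambda>x. \<beta> (chinv c x) (Y (chinv c x)))"
    by (rule smooth_on_cong[OF smooth_on_blinfun_apply[OF img_open[OF c V] one_formD[OF \<beta> c] vector_fieldD[OF Y c]] img_open[OF c V]])
      (auto simp: pairing_rep[OF c] chinv_chmap[OF c])
qed

lemma differential_apply_rep:
  assumes f: "smooth_fun \<A> V f" and V: "open V" and q: "q \<in> V" and c: "c \<in> \<A>" "q \<in> dom c"
  shows "Dmap (\<lambda>x. f (chinv c x)) (chmap c q) (vec_rep \<A> c Y (chmap c q)) = differential \<A> f q (Y q)"
  by (simp add: differential_chart[OF f q V c] vec_rep_chmap[OF c])

lemma smooth_fun_differential_apply:
  assumes V: "open V" and f: "smooth_fun \<A> V f" and Y: "vector_field \<A> V Y"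
  shows "smooth_fun \<A> V (\<lambda>q. differential \<A> f q (Y q))"
  unfolding smooth_fun_def comp_def
proof
  fix c assume c: "c \<in> \<A>"
  show "smooth_on (img c V) (\<lambda>x. differential \<A> f (chinv c x) (Y (chinv c x)))"
    by (rule smooth_on_cong[OF smooth_on_blinfun_apply[OF img_open[OF c V] smooth_on_Dmap[OF img_open[OF c V] smooth_funD[OF f c]]
            vector_fieldD[OF Y c]] img_open[OF c V]])
      (auto simp: differential_apply_rep[OF f V _ c] chinv_chmap[OF c])
qed

lemma differential_bounded_linear:
  assumes "bounded_linear L" "smooth_fun \<A> V f" "open V" "p \<in> V" "p \<in> carrier \<A>"
  shows "differential \<A> (\<lambda>q. L (f q)) p v = L (differential \<A> f p v)"
  unfolding differential_chart_at[OF assms(5)]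
  by (rule Dmap_bounded_linear[OF assms(1)])
    (rule smooth_on_differentiable[OF smooth_funD[OF assms(2) chart_at(1)[OF assms(5)]]
        chmap_in_img[OF chart_at(2)[OF assms(5)] assms(4)]])

lemma differential_const: "p \<in> carrier \<A> \<Longrightarrow> differential \<A> (\<lambda>q. k) p = 0"
  by (simp add: differential_chart_at)

end

section \<open>Brackets, Lie derivatives and smooth maps\<close>

lemma coord_bracket_related:
  fixes k :: "'e::euclidean_space \<Rightarrow> 'f::euclidean_space"
  assumes S: "open S" "x \<in> S" and k: "smooth_on S k"
    and X: "X differentiable (at x)" and Y: "Y differentiable (at x)"
    and X': "X' differentiable (at (k x))" and Y': "Y' differentiable (at (k x))"
    and rX: "\<And>z. z \<in> S \<Longrightarrow> Dmap k z (X z) = X' (k z)" and rY: "\<And>z. z \<in> S \<Longrightarrow> Dmap k z (Y z) = Y' (k z)"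
  shows "Dmap k x (coord_bracket X Y x) = coord_bracket X' Y' (k x)"
proof -
  note dk = smooth_on_differentiable[OF k S(2)]
  have 1: "Dmap (\<lambda>z. Dmap k z (Y z)) x = (Dmap Y' (k x) o\<^sub>L Dmap k x)"
    using Dmap_cong_open[OF S rY] Dmap_compose[OF Y' dk] by simp
  have 2: "Dmap (\<lambda>z. Dmap k z (X z)) x = (Dmap X' (k x) o\<^sub>L Dmap k x)"
    using Dmap_cong_open[OF S rX] Dmap_compose[OF X' dk] by simp
  show ?thesis
    unfolding Dmap_coord_bracket[OF S k X Y] 1 2
    by (simp add: coord_bracket_def rX[OF S(2)] rY[OF S(2)])
qed

context manifold
begin

lemma lie_bracket_chart_at:
  "lie_bracket \<A> X Y p = coord_bracket (vec_rep \<A> (chart_at \<A> p) X) (vec_rep \<A> (chart_at \<A> p) Y) (chmap (chart_at \<A> p) p)"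
  unfolding lie_bracket_def coord_bracket_def Let_def ..

text \<open>The bracket at \<open>q\<close> is defined in a chart that depends on \<open>q\<close>. Naturality under coordinate changes allows
  one to use a fixed chart, which is needed to differentiate or to test smoothness.\<close>

lemma vec_rep_lie_bracket:
  assumes V: "open V" and X: "vector_field \<A> V X" and Y: "vector_field \<A> V Y" and c: "c \<in> \<A>" "q \<in> dom c" "q \<in> V"
  shows "vec_rep \<A> c (lie_bracket \<A> X Y) (chmap c q) = coord_bracket (vec_rep \<A> c X) (vec_rep \<A> c Y) (chmap c q)"
proof -
  let ?b = "chart_at \<A> q"
  let ?k = "\<lambda>x. chmap c (chinv ?b x)"
  note b = chart_at[OF dom_carrier[OF c(1,2)]]
  let ?O = "img ?b (V \<inter> dom c)"
  have O: "open ?O" by (rule img_open[OF b(1) open_Int[OF V open_dom[OF c(1)]]])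
  have qO: "chmap ?b q \<in> ?O" by (rule chmap_in_img[OF b(2) IntI[OF c(3,2)]])
  have rel: "Dmap ?k z (vec_rep \<A> ?b Z z) = vec_rep \<A> c Z (?k z)" if z: "z \<in> ?O" for z Z
  proof -
    obtain r where r: "r \<in> dom ?b" "r \<in> dom c" "z = chmap ?b r" using z by blast
    show ?thesis
      unfolding r(3) chinv_chmap[OF b(1) r(1)] vec_rep_chmap[OF b(1) r(1)] vec_rep_chmap[OF c(1) r(2)]
        to_chart_change[OF b(1) r(1) c(1) r(2)] trans_D_def ..
  qed
  have d: "vec_rep \<A> ?b Z differentiable (at (chmap ?b q))" if "vector_field \<A> V Z" for Z
    by (rule smooth_on_differentiable[OF vector_fieldD[OF that b(1)] chmap_in_img[OF b(2) c(3)]])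
  have d': "vec_rep \<A> c Z differentiable (at (?k (chmap ?b q)))" if "vector_field \<A> V Z" for Z
    unfolding chinv_chmap[OF b]
    by (rule smooth_on_differentiable[OF vector_fieldD[OF that c(1)] chmap_in_img[OF c(2,3)]])
  have "Dmap ?k (chmap ?b q) (coord_bracket (vec_rep \<A> ?b X) (vec_rep \<A> ?b Y) (chmap ?b q))
      = coord_bracket (vec_rep \<A> c X) (vec_rep \<A> c Y) (?k (chmap ?b q))"
    by (rule coord_bracket_related[OF O qO smooth_on_subset[OF transition_smooth[OF b(1) c(1)]]
          d[OF X] d[OF Y] d'[OF X] d'[OF Y] rel rel]) auto
  then show ?thesis
    unfolding vec_rep_chmap[OF c(1,2)] lie_bracket_chart_at chinv_chmap[OF b] to_chart_eq trans_D_def .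
qed

lemma vector_field_lie_bracket:
  assumes V: "open V" and X: "vector_field \<A> V X" and Y: "vector_field \<A> V Y"
  shows "vector_field \<A> V (lie_bracket \<A> X Y)"
  unfolding vector_field_def
proof
  fix c assume c: "c \<in> \<A>"
  note O = img_open[OF c V]
  note X' = vector_fieldD[OF X c] and Y' = vector_fieldD[OF Y c]
  have "smooth_on (img c V) (coord_bracket (vec_rep \<A> c X) (vec_rep \<A> c Y))"
    unfolding coord_bracket_def
    by (rule smooth_on_diff[OF O smooth_on_blinfun_apply[OF O smooth_on_Dmap[OF O Y'] X']
          smooth_on_blinfun_apply[OF O smooth_on_Dmap[OF O X'] Y']])
  then show "smooth_on (img c V) (vec_rep \<A> c (lie_bracket \<A> X Y))"
    by (rule smooth_on_cong[OF _ O]) (use vec_rep_lie_bracket[OF V X Y c] in auto)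
qed

lemma vec_rep_cong_open:
  assumes "c \<in> \<A>" "\<And>q. q \<in> W \<Longrightarrow> X q = Y q" "x \<in> img c W"
  shows "vec_rep \<A> c X x = vec_rep \<A> c Y x"
proof -
  obtain q where q: "q \<in> dom c" "q \<in> W" "x = chmap c q" using assms(3) by blast
  show ?thesis unfolding q(3) vec_rep_chmap[OF assms(1) q(1)] assms(2)[OF q(2)] ..
qed

lemma lie_bracket_cong:
  assumes W: "open W" "p \<in> W" "W \<subseteq> carrier \<A>" and "\<And>q. q \<in> W \<Longrightarrow> X q = X' q" "\<And>q. q \<in> W \<Longrightarrow> Y q = Y' q"
  shows "lie_bracket \<A> X Y p = lie_bracket \<A> X' Y' p"
proof -
  have p: "p \<in> carrier \<A>" using W by blast
  note b = chart_at[OF p]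
  note O = img_open[OF b(1) W(1)] and pO = chmap_in_img[OF b(2) W(2)]
  have eX: "vec_rep \<A> (chart_at \<A> p) X x = vec_rep \<A> (chart_at \<A> p) X' x"
    and eY: "vec_rep \<A> (chart_at \<A> p) Y x = vec_rep \<A> (chart_at \<A> p) Y' x"
    if x: "x \<in> img (chart_at \<A> p) W" for x
    using vec_rep_cong_open[OF b(1) _ x, of X X'] vec_rep_cong_open[OF b(1) _ x, of Y Y'] assms(4,5) by auto
  have "Dmap (vec_rep \<A> (chart_at \<A> p) X) (chmap (chart_at \<A> p) p) = Dmap (vec_rep \<A> (chart_at \<A> p) X') (chmap (chart_at \<A> p) p)"
    "Dmap (vec_rep \<A> (chart_at \<A> p) Y) (chmap (chart_at \<A> p) p) = Dmap (vec_rep \<A> (chart_at \<A> p) Y') (chmap (chart_at \<A> p) p)"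
    by (rule Dmap_cong_open[OF O pO eX], assumption) (rule Dmap_cong_open[OF O pO eY], assumption)
  then show ?thesis
    unfolding lie_bracket_chart_at coord_bracket_def eX[OF pO] eY[OF pO] by simp
qed

lemma lie_bracket_add_left:
  assumes V: "open V" "p \<in> V" "V \<subseteq> carrier \<A>"
    and X: "vector_field \<A> V X" and X': "vector_field \<A> V X'"
  shows "lie_bracket \<A> (\<lambda>q. X q + X' q) Y p = lie_bracket \<A> X Y p + lie_bracket \<A> X' Y p"
proof -
  have p: "p \<in> carrier \<A>" using V by blast
  note b = chart_at[OF p]
  note pO = chmap_in_img[OF b(2) V(2)]
  note DX = smooth_on_has_derivative[OF vector_fieldD[OF X b(1)] pO]
    and DX' = smooth_on_has_derivative[OF vector_fieldD[OF X' b(1)] pO]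
  have r: "vec_rep \<A> c (\<lambda>q. X q + X' q) = (\<lambda>x. vec_rep \<A> c X x + vec_rep \<A> c X' x)" for c
    unfolding vec_rep_def blinfun.add_right ..
  have "Dmap (\<lambda>x. vec_rep \<A> (chart_at \<A> p) X x + vec_rep \<A> (chart_at \<A> p) X' x) (chmap (chart_at \<A> p) p)
      = Dmap (vec_rep \<A> (chart_at \<A> p) X) (chmap (chart_at \<A> p) p) + Dmap (vec_rep \<A> (chart_at \<A> p) X') (chmap (chart_at \<A> p) p)"
    by (rule Dmap_eqI, rule has_derivative_eq_rhs[OF has_derivative_add[OF DX DX']])
      (auto simp: blinfun.add_left)
  then show ?thesis
    unfolding lie_bracket_chart_at coord_bracket_def r by (simp add: blinfun.bilinear_simps)
qed

lemma vec_rep_zero: "vec_rep \<A> c (\<lambda>q. 0) = (\<lambda>x. 0)"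
  unfolding vec_rep_def by (simp add: blinfun.zero_right)

lemma form_rep_zero: "form_rep \<A> c (\<lambda>q. 0) = (\<lambda>x. 0)"
  unfolding form_rep_def by (simp add: bounded_bilinear.zero_left[OF bounded_bilinear_blinfun_compose])

lemma lie_bracket_zero [simp]: "lie_bracket \<A> (\<lambda>q. 0) Y p = 0" "lie_bracket \<A> X (\<lambda>q. 0) p = 0"
  unfolding lie_bracket_chart_at coord_bracket_def vec_rep_zero
  by (simp_all add: blinfun.zero_right blinfun.zero_left)

lemma lie_derivative_zero [simp]: "lie_derivative \<A> (\<lambda>q. 0) \<beta> p = 0" "lie_derivative \<A> X (\<lambda>q. 0) p = 0"
  unfolding lie_derivative_def Let_def vec_rep_zero form_rep_zero
  by (simp_all add: blinfun.zero_right blinfun.zero_left)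

lemma lie_bracket_differential:
  fixes k :: "'a \<Rightarrow> 'v::real_inner"
  assumes V: "open V" "p \<in> V" "V \<subseteq> carrier \<A>" and k: "smooth_fun \<A> V k"
    and X: "vector_field \<A> V X" and Y: "vector_field \<A> V Y"
  shows "differential \<A> k p (lie_bracket \<A> X Y p)
    = differential \<A> (\<lambda>q. differential \<A> k q (Y q)) p (X p) - differential \<A> (\<lambda>q. differential \<A> k q (X q)) p (Y p)"
proof -
  let ?b = "chart_at \<A> p"
  have p: "p \<in> carrier \<A>" using V by blast
  note b = chart_at[OF p]
  note O = img_open[OF b(1) V(1)] and pO = chmap_in_img[OF b(2) V(2)]
  have Z: "vec_rep \<A> ?b Z (chmap ?b p) = Z p" for Z
    by (simp add: vec_rep_chmap[OF b] to_chart_at[OF p])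
  have D: "Dmap (\<lambda>x. differential \<A> k (chinv ?b x) (Z (chinv ?b x))) (chmap ?b p)
      = Dmap (\<lambda>x. Dmap (\<lambda>x. k (chinv ?b x)) x (vec_rep \<A> ?b Z x)) (chmap ?b p)" for Z
    by (rule Dmap_cong_open[OF O pO]) (auto simp: differential_apply_rep[OF k V(1) _ b(1)] chinv_chmap[OF b(1)])
  show ?thesis
    unfolding differential_chart_at[OF p] D lie_bracket_chart_at
      Dmap_coord_bracket[OF O pO smooth_funD[OF k b(1)] smooth_on_differentiable[OF vector_fieldD[OF X b(1)] pO]
        smooth_on_differentiable[OF vector_fieldD[OF Y b(1)] pO]] Z ..
qed

lemma lie_derivative_apply:
  assumes V: "open V" "p \<in> V" "V \<subseteq> carrier \<A>"
    and X: "vector_field \<A> V X" and Y: "vector_field \<A> V Y" and \<beta>: "one_form \<A> V \<beta>"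
  shows "lie_derivative \<A> X \<beta> p (Y p) = differential \<A> (\<lambda>q. \<beta> q (Y q)) p (X p) - \<beta> p (lie_bracket \<A> X Y p)"
proof -
  let ?b = "chart_at \<A> p"
  let ?x = "chmap ?b p"
  have p: "p \<in> carrier \<A>" using V by blast
  note b = chart_at[OF p]
  note O = img_open[OF b(1) V(1)] and pO = chmap_in_img[OF b(2) V(2)]
  have Z: "vec_rep \<A> ?b Z ?x = Z p" for Z
    by (simp add: vec_rep_chmap[OF b] to_chart_at[OF p])
  have B: "form_rep \<A> ?b \<beta> ?x v = \<beta> p v" for v
    by (simp add: form_rep_chmap[OF b] from_chart_eq trans_D_self[OF b])
  have "Dmap (\<lambda>x. \<beta> (chinv ?b x) (Y (chinv ?b x))) ?x
      = Dmap (\<lambda>x. form_rep \<A> ?b \<beta> x (vec_rep \<A> ?b Y x)) ?x"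
    by (rule Dmap_cong_open[OF O pO]) (auto simp: pairing_rep[OF b(1)] chinv_chmap[OF b(1)])
  then show ?thesis
    unfolding differential_chart_at[OF p] lie_bracket_chart_at lie_derivative_def Let_def coord_bracket_def
    by (simp add: Dmap_blinfun_apply[OF smooth_on_differentiable[OF one_formD[OF \<beta> b(1)] pO]
          smooth_on_differentiable[OF vector_fieldD[OF Y b(1)] pO]] Z B blinfun.bilinear_simps)
qed

text \<open>Cartan's formula \<open>L\<^sub>X dh = d(dh(X))\<close>: on a field \<open>Y\<close> that extends a given vector both sides agree
  by \<open>lie_bracket_differential\<close>.\<close>

lemma lie_derivative_differential:
  fixes h :: "'a \<Rightarrow> real"
  assumes V: "open V" "p \<in> V" "V \<subseteq> carrier \<A>" and X: "vector_field \<A> V X" and h: "smooth_fun \<A> V h"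
  shows "lie_derivative \<A> X (differential \<A> h) p = differential \<A> (\<lambda>q. differential \<A> h q (X q)) p"
proof (rule blinfun_eqI)
  fix v
  have "p \<in> carrier \<A>" using V by blast
  then obtain W Y where W: "open W" "p \<in> W" "W \<subseteq> carrier \<A>" "vector_field \<A> W Y" and Yp: "Y p = v"
    by (rule extend_vector[where v = v])
  let ?V = "V \<inter> W"
  have V': "open ?V" "p \<in> ?V" "?V \<subseteq> carrier \<A>" using V W by auto
  have X': "vector_field \<A> ?V X" and Y': "vector_field \<A> ?V Y" and h': "smooth_fun \<A> ?V h"
    by (rule vector_field_subset[OF X] vector_field_subset[OF W(4)] smooth_fun_subset[OF h]; simp)+
  show "lie_derivative \<A> X (differential \<A> h) p v = differential \<A> (\<lambda>q. differential \<A> h q (X q)) p v"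
    using lie_derivative_apply[OF V' X' Y' one_form_differential[OF h' V'(1)]]
      lie_bracket_differential[OF V' h' X' Y'] unfolding Yp by simp
qed

lemma lie_derivative_cong:
  assumes W: "open W" "p \<in> W" "W \<subseteq> carrier \<A>" and eq: "\<And>q. q \<in> W \<Longrightarrow> \<beta> q = \<gamma> q"
  shows "lie_derivative \<A> X \<beta> p = lie_derivative \<A> X \<gamma> p"
proof -
  have p: "p \<in> carrier \<A>" using W by blast
  note b = chart_at[OF p]
  note O = img_open[OF b(1) W(1)] and pO = chmap_in_img[OF b(2) W(2)]
  have e: "form_rep \<A> (chart_at \<A> p) \<beta> x = form_rep \<A> (chart_at \<A> p) \<gamma> x" if "x \<in> img (chart_at \<A> p) W" for x
    using that by (auto simp: form_rep_chmap[OF b(1)] eq)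
  have "Dmap (form_rep \<A> (chart_at \<A> p) \<beta>) (chmap (chart_at \<A> p) p) = Dmap (form_rep \<A> (chart_at \<A> p) \<gamma>) (chmap (chart_at \<A> p) p)"
    by (rule Dmap_cong_open[OF O pO e])
  then show ?thesis
    unfolding lie_derivative_def Let_def e[OF pO] by simp
qed

lemma differential_chmap: "differential \<A> (chmap d) p = to_chart \<A> d p"
  unfolding differential_def to_chart_def ..

end

locale manifold_map = M: manifold \<A> + N: manifold \<B>
  for \<A> :: "('a::{t2_space,second_countable_topology}, 'e::euclidean_space) atlas"
    and \<B> :: "('b::{t2_space,second_countable_topology}, 'f::euclidean_space) atlas" +
  fixes U :: "'a set" and f :: "'a \<Rightarrow> 'b"
  assumes open_U: "open U" and U_carrier: "U \<subseteq> carrier \<A>" and smooth_f: "smooth_map \<A> \<B> U f"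
begin

lemma f_carrier: "p \<in> U \<Longrightarrow> f p \<in> carrier \<B>"
  using smooth_f unfolding smooth_map_def by blast

lemma open_preimage: "open V' \<Longrightarrow> open (U \<inter> f -` V')"
  using smooth_f open_U unfolding smooth_map_def by (metis continuous_open_preimage)

lemma smooth_f_chart:
  assumes "c \<in> \<A>" "d \<in> \<B>"
  shows "smooth_on (img c (U \<inter> f -` dom d)) (\<lambda>x. chmap d (f (chinv c x)))"
proof -
  have "smooth_on (chmap c ` (dom c \<inter> U \<inter> f -` dom d)) (chmap d \<circ> f \<circ> chinv c)"
    using smooth_f assms unfolding smooth_map_def by blast
  then show ?thesis by (simp add: comp_def Int_assoc)
qed

lemma smooth_fun_pullback:
  assumes V': "open V'" and k: "smooth_fun \<B> V' k"
  shows "smooth_fun \<A> (U \<inter> f -` V') (\<lambda>q. k (f q))"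
proof (rule M.smooth_fun_local)
  fix p assume p: "p \<in> U \<inter> f -` V'"
  let ?c = "chart_at \<A> p" and ?d = "chart_at \<B> (f p)"
  have c: "?c \<in> \<A>" "p \<in> dom ?c" using M.chart_at U_carrier p by auto
  have d: "?d \<in> \<B>" "f p \<in> dom ?d" using N.chart_at f_carrier p by auto
  let ?W = "dom ?c \<inter> (U \<inter> f -` (dom ?d \<inter> V'))"
  have W: "open ?W" by (rule open_Int[OF M.open_dom[OF c(1)] open_preimage[OF open_Int[OF N.open_dom[OF d(1)] V']]])
  note O = M.img_open[OF c(1) W] and O' = N.img_open[OF d(1) V']
  have g: "smooth_on (img ?c ?W) (\<lambda>x. chmap ?d (f (chinv ?c x)))"
    by (rule smooth_on_subset[OF smooth_f_chart[OF c(1) d(1)]]) auto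
  have "smooth_on (img ?c ?W) (\<lambda>x. k (chinv ?d (chmap ?d (f (chinv ?c x)))))"
    by (rule smooth_on_compose[OF O O' _ g N.smooth_funD[OF k d(1)]]) (auto simp: M.chinv_chmap[OF c(1)])
  then have "smooth_on (img ?c ?W) (\<lambda>x. k (f (chinv ?c x)))"
    by (rule smooth_on_cong[OF _ O]) (auto simp: M.chinv_chmap[OF c(1)] N.chinv_chmap[OF d(1)])
  then show "\<exists>c W. c \<in> \<A> \<and> open W \<and> p \<in> W \<and> W \<subseteq> dom c \<and> smooth_on (img c W) (\<lambda>x. k (f (chinv c x)))"
    using c d p W by blast
qed

lemma differential_pullback:
  assumes V': "open V'" and k: "smooth_fun \<B> V' k" and p: "p \<in> U" "f p \<in> V'"
  shows "differential \<A> (\<lambda>q. k (f q)) p = (differential \<B> k (f p) o\<^sub>L tangent_map \<A> \<B> f p)"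
proof -
  let ?c = "chart_at \<A> p" and ?d = "chart_at \<B> (f p)"
  have pc: "p \<in> carrier \<A>" and fpc: "f p \<in> carrier \<B>" using p U_carrier f_carrier by auto
  note c = M.chart_at[OF pc] and d = N.chart_at[OF fpc]
  have W: "open (U \<inter> f -` (dom ?d))" by (rule open_preimage[OF N.open_dom[OF d(1)]])
  note O = M.img_open[OF c(1) W]
  have pO: "chmap ?c p \<in> img ?c (U \<inter> f -` (dom ?d))" using c d p by blast
  have "Dmap (\<lambda>x. k (f (chinv ?c x))) (chmap ?c p)
      = Dmap (\<lambda>x. (\<lambda>z. k (chinv ?d z)) (chmap ?d (f (chinv ?c x)))) (chmap ?c p)"
    by (rule Dmap_cong_open[OF O pO]) (auto simp: M.chinv_chmap[OF c(1)] N.chinv_chmap[OF d(1)])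
  also have "\<dots> = (Dmap (\<lambda>z. k (chinv ?d z)) (chmap ?d (f (chinv ?c (chmap ?c p))))
      o\<^sub>L Dmap (\<lambda>x. chmap ?d (f (chinv ?c x))) (chmap ?c p))"
  proof (rule Dmap_compose)
    show "(\<lambda>z. k (chinv ?d z)) differentiable (at (chmap ?d (f (chinv ?c (chmap ?c p)))))"
      unfolding M.chinv_chmap[OF c]
      by (rule smooth_on_differentiable[OF N.smooth_funD[OF k d(1)] N.chmap_in_img[OF d(2) p(2)]])
    show "(\<lambda>x. chmap ?d (f (chinv ?c x))) differentiable (at (chmap ?c p))"
      by (rule smooth_on_differentiable[OF smooth_f_chart[OF c(1) d(1)] pO])
  qed
  finally show ?thesis
    unfolding M.differential_chart_at[OF pc] N.differential_chart_at[OF fpc] tangent_map_def comp_def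
      M.chinv_chmap[OF c] .
qed

lemma tangent_map_chart:
  assumes "p \<in> U" "d \<in> \<B>" "f p \<in> dom d"
  shows "to_chart \<B> d (f p) (tangent_map \<A> \<B> f p v) = differential \<A> (\<lambda>q. chmap d (f q)) p v"
  using differential_pullback[OF N.open_dom[OF assms(2)] N.chmap_smooth_fun[OF assms(2)] assms(1,3)]
  by (simp add: N.differential_chmap)

text \<open>Naturality of the bracket, tested on the coordinate functions of the target pulled back to the source.\<close>

lemma lie_bracket_projects:
  assumes V: "open V" "V \<subseteq> U" and V': "open V'" "f ` V \<subseteq> V'"
    and X: "vector_field \<A> V X" and Y: "vector_field \<A> V Y"
    and X': "vector_field \<B> V' X'" and Y': "vector_field \<B> V' Y'"
    and rX: "field_projects_to \<A> \<B> V f X X'" and rY: "field_projects_to \<A> \<B> V f Y Y'"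
    and p: "p \<in> V"
  shows "tangent_map \<A> \<B> f p (lie_bracket \<A> X Y p) = lie_bracket \<B> X' Y' (f p)"
proof -
  let ?d = "chart_at \<B> (f p)"
  let ?k = "\<lambda>q. chmap ?d (f q)"
  have pU: "p \<in> U" and fV: "f p \<in> V'" using p V V' by auto
  have fpc: "f p \<in> carrier \<B>" using f_carrier[OF pU] .
  note d = N.chart_at[OF fpc]
  have Vc: "V \<subseteq> carrier \<A>" using V U_carrier by blast
  define W where "W = V \<inter> (U \<inter> f -` (dom ?d \<inter> V'))"
  have dV: "open (dom ?d \<inter> V')" using N.open_dom[OF d(1)] V' by blast
  have W: "open W" unfolding W_def by (rule open_Int[OF V(1) open_preimage[OF dV]])
  have pW: "p \<in> W" unfolding W_def using p pU fV d by blast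
  have WV: "W \<subseteq> V" "W \<subseteq> U" "W \<subseteq> carrier \<A>" unfolding W_def using Vc by auto
  have k: "smooth_fun \<A> W ?k"
    by (rule M.smooth_fun_subset[OF smooth_fun_pullback[OF N.open_dom[OF d(1)] N.chmap_smooth_fun[OF d(1)]]])
      (auto simp: W_def)
  have push: "differential \<A> (\<lambda>q. differential \<A> ?k q (Z q)) p v
      = Dmap (vec_rep \<B> ?d Z') (chmap ?d (f p)) (tangent_map \<A> \<B> f p v)"
    if Z': "vector_field \<B> V' Z'" and r: "field_projects_to \<A> \<B> V f Z Z'" for Z Z' v
  proof -
    let ?h = "\<lambda>y. vec_rep \<B> ?d Z' (chmap ?d y)"
    have h: "smooth_fun \<B> (dom ?d \<inter> V') ?h"
    proof (rule N.smooth_fun_local)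
      fix y assume y: "y \<in> dom ?d \<inter> V'"
      have "smooth_on (img ?d (dom ?d \<inter> V')) (vec_rep \<B> ?d Z')"
        by (rule smooth_on_subset[OF N.vector_fieldD[OF Z' d(1)]]) auto
      then have "smooth_on (img ?d (dom ?d \<inter> V')) (\<lambda>x. ?h (chinv ?d x))"
        by (rule smooth_on_cong[OF _ N.img_open[OF d(1) dV]]) (auto simp: N.chinv_chmap[OF d(1)])
      then show "\<exists>c W. c \<in> \<B> \<and> open W \<and> y \<in> W \<and> W \<subseteq> dom c \<and> smooth_on (img c W) (\<lambda>x. ?h (chinv c x))"
        using y d(1) dV by blast
    qed
    have "differential \<A> (\<lambda>q. differential \<A> ?k q (Z q)) p = differential \<A> (\<lambda>q. ?h (f q)) p"
    proof (rule M.differential_cong[OF W pW WV(3)])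
      fix q assume q: "q \<in> W"
      then have q': "q \<in> U" "f q \<in> dom ?d" "q \<in> V" unfolding W_def by auto
      show "differential \<A> ?k q (Z q) = ?h (f q)"
        unfolding tangent_map_chart[OF q'(1) d(1) q'(2), symmetric] N.vec_rep_chmap[OF d(1) q'(2)]
        using r q'(3) unfolding field_projects_to_def by simp
    qed
    also have "\<dots> v = differential \<B> ?h (f p) (tangent_map \<A> \<B> f p v)"
      using differential_pullback[OF dV h pU] d fV by simp
    also have "differential \<B> ?h (f p) = Dmap (vec_rep \<B> ?d Z') (chmap ?d (f p))"
      unfolding N.differential_chart_at[OF fpc]
      by (rule Dmap_cong_open[OF N.img_open[OF d(1) N.open_dom[OF d(1)]] N.chmap_in_img[OF d(2) d(2)]])
        (auto simp: N.chinv_chmap[OF d(1)])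
    finally show ?thesis .
  qed
  have at_p: "vec_rep \<B> ?d Z' (chmap ?d (f p)) = tangent_map \<A> \<B> f p (Z p)"
    if "field_projects_to \<A> \<B> V f Z Z'" for Z Z'
    using that p unfolding field_projects_to_def by (simp add: N.vec_rep_chmap[OF d] N.to_chart_at[OF fpc])
  have "tangent_map \<A> \<B> f p (lie_bracket \<A> X Y p) = differential \<A> ?k p (lie_bracket \<A> X Y p)"
    using tangent_map_chart[OF pU d] by (simp add: N.to_chart_at[OF fpc])
  also have "\<dots> = lie_bracket \<B> X' Y' (f p)"
    unfolding M.lie_bracket_differential[OF W pW WV(3) k M.vector_field_subset[OF X WV(1)] M.vector_field_subset[OF Y WV(1)]]
      push[OF X' rX] push[OF Y' rY] N.lie_bracket_chart_at coord_bracket_def at_p[OF rX] at_p[OF rY] ..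
  finally show ?thesis .
qed

end

section \<open>Quasi-classical generalized CRF structures\<close>

lemma sharp_works:
  fixes P :: "'e::euclidean_space bivec"
  assumes "bilinear P"
  shows "blinfun_apply \<beta> (sharp P \<alpha>) = P \<alpha> \<beta>"
proof -
  have lin: "linear (P \<alpha>)" using assms unfolding bilinear_def by blast
  let ?v = "\<Sum>b\<in>Basis. P \<alpha> (blinfun_inner_left b) *\<^sub>R b"
  have ex: "blinfun_apply \<gamma> ?v = P \<alpha> \<gamma>" for \<gamma>
  proof -
    have "\<gamma> = (\<Sum>b\<in>Basis. \<gamma> b *\<^sub>R blinfun_inner_left b)"
    proof (rule blinfun_eqI)
      fix x
      have "\<gamma> x = \<gamma> (\<Sum>b\<in>Basis. (x \<bullet> b) *\<^sub>R b)" by (simp add: euclidean_representation)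
      then show "\<gamma> x = (\<Sum>b\<in>Basis. \<gamma> b *\<^sub>R blinfun_inner_left b) x"
        by (simp add: blinfun.bilinear_simps blinfun.sum_right blinfun.sum_left mult.commute)
    qed
    from arg_cong[OF this, of "P \<alpha>"] have "P \<alpha> \<gamma> = (\<Sum>b\<in>Basis. P \<alpha> (\<gamma> b *\<^sub>R blinfun_inner_left b))"
      unfolding linear_sum[OF lin] .
    then show ?thesis
      by (simp add: linear_scale[OF lin] blinfun.sum_right blinfun.scaleR_right mult.commute)
  qed
  have "v = ?v" if "\<forall>\<gamma>. blinfun_apply \<gamma> v = P \<alpha> \<gamma>" for v
  proof -
    have "blinfun_apply (blinfun_inner_left b) v = blinfun_apply (blinfun_inner_left b) ?v" for b
      by (simp only: ex spec[OF that])
    then have "v \<bullet> b = ?v \<bullet> b" for b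
      by (simp only: blinfun_inner_left.rep_eq)
    then show ?thesis using vector_eq_rdot by blast
  qed
  then have "sharp P \<alpha> = ?v" unfolding sharp_def using ex by (intro the_equality) auto
  then show ?thesis using ex by simp
qed

lemma covector_eqI:
  fixes v w :: "'e::euclidean_space"
  assumes "\<And>\<beta> :: 'e \<Rightarrow>\<^sub>L real. \<beta> v = \<beta> w"
  shows "v = w"
proof -
  have "v \<bullet> b = w \<bullet> b" for b using assms[of "blinfun_inner_left b"] by simp
  then show ?thesis using vector_eq_rdot by blast
qed

lemma sharp_linear:
  assumes "bilinear P"
  shows "sharp P (\<alpha> + \<beta>) = sharp P \<alpha> + sharp P \<beta>" "sharp P (r *\<^sub>R \<alpha>) = r *\<^sub>R sharp P \<alpha>"
    "sharp P (- \<alpha>) = - sharp P \<alpha>" "sharp P 0 = 0"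
proof -
  show 1: "sharp P (\<alpha> + \<beta>) = sharp P \<alpha> + sharp P \<beta>"
    by (rule covector_eqI) (simp add: sharp_works[OF assms] bilinear_ladd[OF assms] blinfun.add_right)
  show 2: "sharp P (r *\<^sub>R \<alpha>) = r *\<^sub>R sharp P \<alpha>" for r \<alpha>
    by (rule covector_eqI) (simp add: sharp_works[OF assms] bilinear_lmul[OF assms] blinfun.scaleR_right)
  show "sharp P (- \<alpha>) = - sharp P \<alpha>" "sharp P 0 = 0"
    using 2[of "-1" \<alpha>] 2[of 0 0] by simp_all
qed

locale quasi_classical_CRF = manifold \<A>
  for \<A> :: "('a::{t2_space,second_countable_topology}, 'e::euclidean_space) atlas" +
  fixes \<Phi> :: "'a \<Rightarrow> 'e big \<Rightarrow> 'e big" and A :: "'a \<Rightarrow> 'e \<Rightarrow>\<^sub>L 'e" and \<pi> :: "'a \<Rightarrow> 'e bivec"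
  assumes CRF: "gen_CRF_structure \<A> \<Phi>" and defined: "defined_by \<A> \<Phi> A \<pi>"
begin

abbreviation sharp_at :: "'a \<Rightarrow> 'e covec \<Rightarrow> 'e" where
  "sharp_at p \<equiv> sharp (\<pi> p)"

lemma A_cubed: "p \<in> carrier \<A> \<Longrightarrow> A p (A p (A p v)) = - A p v"
  using defined unfolding defined_by_def F_structure_def by (metis add_eq_0_iff2)

lemma pi_bilinear: "p \<in> carrier \<A> \<Longrightarrow> bilinear (\<pi> p)"
  and pi_skew: "p \<in> carrier \<A> \<Longrightarrow> \<pi> p \<alpha> \<beta> = - \<pi> p \<beta> \<alpha>"
  using defined unfolding defined_by_def bivector_field_def by blast+

lemma A_sharp: "p \<in> carrier \<A> \<Longrightarrow> A p (sharp_at p \<alpha>) = sharp_at p (\<alpha> o\<^sub>L A p)"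
  using defined unfolding defined_by_def by blast

lemma Phi_apply: "p \<in> carrier \<A> \<Longrightarrow> \<Phi> p (X, \<alpha>) = (A p X + sharp_at p \<alpha>, - (\<alpha> o\<^sub>L A p))"
  using defined unfolding defined_by_def by blast

lemma sharp_apply: "p \<in> carrier \<A> \<Longrightarrow> blinfun_apply \<beta> (sharp_at p \<alpha>) = \<pi> p \<alpha> \<beta>"
  by (rule sharp_works[OF pi_bilinear])

lemma pi_A: "p \<in> carrier \<A> \<Longrightarrow> \<pi> p (\<alpha> o\<^sub>L A p) \<beta> = \<pi> p \<alpha> (\<beta> o\<^sub>L A p)"
  using A_sharp[of p \<alpha>] sharp_apply[of p \<beta> "\<alpha> o\<^sub>L A p"] sharp_apply[of p "\<beta> o\<^sub>L A p" \<alpha>] by simp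

lemma vector_field_A:
  "open V \<Longrightarrow> V \<subseteq> carrier \<A> \<Longrightarrow> vector_field \<A> V X \<Longrightarrow> vector_field \<A> V (\<lambda>q. A q (X q))"
  using defined unfolding defined_by_def F_structure_def endo_field_def open_in_manifold_def by blast

lemma one_form_sections:
  assumes V: "open V" "V \<subseteq> carrier \<A>" and \<beta>: "one_form \<A> V \<beta>"
  shows "one_form \<A> V (\<lambda>q. \<beta> q o\<^sub>L A q)" "vector_field \<A> V (\<lambda>q. sharp_at q (\<beta> q))"
proof -
  have "big_section \<A> V (\<lambda>q. (0, \<beta> q))"
    using vector_field_zero[OF V(1)] \<beta> unfolding big_section_def by simp
  then have s: "big_section \<A> V (\<lambda>q. \<Phi> q (0, \<beta> q))"
    using CRF V unfolding gen_CRF_structure_def gen_F_structure_def open_in_manifold_def by blast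
  have "one_form \<A> V (\<lambda>q. - (\<beta> q o\<^sub>L A q))"
    by (rule one_form_cong[of V "\<lambda>q. snd (\<Phi> q (0, \<beta> q))"])
      (use s V in \<open>auto simp: big_section_def Phi_apply subset_iff\<close>)
  from one_form_minus[OF V(1) this] show "one_form \<A> V (\<lambda>q. \<beta> q o\<^sub>L A q)" by simp
  show "vector_field \<A> V (\<lambda>q. sharp_at q (\<beta> q))"
    by (rule vector_field_cong[of V "\<lambda>q. fst (\<Phi> q (0, \<beta> q))"])
      (use s V in \<open>auto simp: big_section_def Phi_apply subset_iff blinfun.zero_right\<close>)
qed

lemma integrability:
  assumes "open V" "V \<subseteq> carrier \<A>" "i_eigen_section \<A> \<Phi> V s s'" "i_eigen_section \<A> \<Phi> V t t'" "p \<in> V"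
  shows "\<Phi> p (courant \<A> s t' p + courant \<A> s' t p) = courant \<A> s t p - courant \<A> s' t' p"
  using CRF assms unfolding gen_CRF_structure_def open_in_manifold_def i_eigen_section_def by blast

text \<open>The three kinds of \<open>\<i>\<close>-eigensections \<open>s + \<i> s'\<close> in use. For a field \<open>Z\<close> in the image of \<open>A\<close> the first is
  \<open>AZ + \<i> Z\<close>. The other two have the covector part \<open>\<i> (\<beta> + \<i> \<beta> \<circ> A)\<close> and differ by a section of the first kind; in
  \<open>eigen_form_mixed\<close> the vector part lies in the conjugate of \<open>H\<close>, and in \<open>eigen_form\<close> the section \<open>s'\<close> has no vector
  part, which makes most terms of the Courant bracket of two such sections vanish.\<close>

lemma eigen_field:
  assumes V: "open V" "V \<subseteq> carrier \<A>" and Z: "vector_field \<A> V Z" "\<And>q. q \<in> V \<Longrightarrow> A q (A q (Z q)) = - Z q"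
  shows "i_eigen_section \<A> \<Phi> V (\<lambda>q. (A q (Z q), 0)) (\<lambda>q. (Z q, 0))"
  unfolding i_eigen_section_def big_section_def
  using vector_field_A[OF V Z(1)] Z one_form_zero[OF V(1)] V
  by (auto simp: Phi_apply subset_iff sharp_linear(4)[OF pi_bilinear])

lemma eigen_form_mixed:
  assumes V: "open V" "V \<subseteq> carrier \<A>" and \<beta>: "one_form \<A> V \<beta>" "\<And>q. q \<in> V \<Longrightarrow> ((\<beta> q o\<^sub>L A q) o\<^sub>L A q) = - \<beta> q"
  shows "i_eigen_section \<A> \<Phi> V (\<lambda>q. ((1/2) *\<^sub>R sharp_at q (\<beta> q), - (\<beta> q o\<^sub>L A q)))
    (\<lambda>q. ((1/2) *\<^sub>R sharp_at q (\<beta> q o\<^sub>L A q), \<beta> q))"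
proof -
  note \<beta>A = one_form_sections[OF V \<beta>(1)]
  have half: "(1/2) *\<^sub>R v - v = - ((1/2) *\<^sub>R v)" "v - (1/2) *\<^sub>R v = (1/2) *\<^sub>R v" for v :: 'e
    using scaleR_left_distrib[of "1/2" "1/2" v] by (simp_all add: algebra_simps)
  have "\<Phi> q ((1/2) *\<^sub>R sharp_at q (\<beta> q), - (\<beta> q o\<^sub>L A q)) = - ((1/2) *\<^sub>R sharp_at q (\<beta> q o\<^sub>L A q), \<beta> q)"
    "\<Phi> q ((1/2) *\<^sub>R sharp_at q (\<beta> q o\<^sub>L A q), \<beta> q) = ((1/2) *\<^sub>R sharp_at q (\<beta> q), - (\<beta> q o\<^sub>L A q))"
    if q: "q \<in> V" for q
  proof -
    have qc: "q \<in> carrier \<A>" using q V by blast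
    note sl = sharp_linear[OF pi_bilinear[OF qc]]
    have m: "(- (\<beta> q o\<^sub>L A q) o\<^sub>L A q) = \<beta> q"
      using \<beta>(2)[OF q] by (simp add: bounded_bilinear.minus_left[OF bounded_bilinear_blinfun_compose])
    show "\<Phi> q ((1/2) *\<^sub>R sharp_at q (\<beta> q), - (\<beta> q o\<^sub>L A q)) = - ((1/2) *\<^sub>R sharp_at q (\<beta> q o\<^sub>L A q), \<beta> q)"
      by (simp add: Phi_apply[OF qc] blinfun.scaleR_right A_sharp[OF qc] sl m half(1))
    show "\<Phi> q ((1/2) *\<^sub>R sharp_at q (\<beta> q o\<^sub>L A q), \<beta> q) = ((1/2) *\<^sub>R sharp_at q (\<beta> q), - (\<beta> q o\<^sub>L A q))"
      by (simp add: Phi_apply[OF qc] blinfun.scaleR_right A_sharp[OF qc] \<beta>(2)[OF q] sl half(2))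
  qed
  then show ?thesis
    unfolding i_eigen_section_def big_section_def
    using vector_field_scaleR[OF V(1) \<beta>A(2)] one_form_minus[OF V(1) \<beta>A(1)] \<beta>(1)
      vector_field_scaleR[OF V(1) one_form_sections(2)[OF V \<beta>A(1)]] by simp
qed

lemma eigen_form:
  assumes V: "open V" "V \<subseteq> carrier \<A>" and \<beta>: "one_form \<A> V \<beta>" "\<And>q. q \<in> V \<Longrightarrow> ((\<beta> q o\<^sub>L A q) o\<^sub>L A q) = - \<beta> q"
  shows "i_eigen_section \<A> \<Phi> V (\<lambda>q. (sharp_at q (\<beta> q), - (\<beta> q o\<^sub>L A q))) (\<lambda>q. (0, \<beta> q))"
proof -
  note \<beta>A = one_form_sections[OF V \<beta>(1)]
  have "\<Phi> q (sharp_at q (\<beta> q), - (\<beta> q o\<^sub>L A q)) = - (0, \<beta> q)"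
    "\<Phi> q (0, \<beta> q) = (sharp_at q (\<beta> q), - (\<beta> q o\<^sub>L A q))"
    if q: "q \<in> V" for q
  proof -
    have qc: "q \<in> carrier \<A>" using q V by blast
    have m: "(- (\<beta> q o\<^sub>L A q) o\<^sub>L A q) = \<beta> q"
      using \<beta>(2)[OF q] by (simp add: bounded_bilinear.minus_left[OF bounded_bilinear_blinfun_compose])
    show "\<Phi> q (sharp_at q (\<beta> q), - (\<beta> q o\<^sub>L A q)) = - (0, \<beta> q)"
      by (simp add: Phi_apply[OF qc] A_sharp[OF qc] sharp_linear[OF pi_bilinear[OF qc]] m)
    show "\<Phi> q (0, \<beta> q) = (sharp_at q (\<beta> q), - (\<beta> q o\<^sub>L A q))"
      by (simp add: Phi_apply[OF qc] blinfun.zero_right)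
  qed
  then show ?thesis
    unfolding i_eigen_section_def big_section_def
    using \<beta>A(2) one_form_minus[OF V(1) \<beta>A(1)] \<beta>(1) vector_field_zero[OF V(1)] by simp
qed

lemma nijenhuis_image_A:
  assumes V: "open V" "V \<subseteq> carrier \<A>" "p \<in> V"
    and Z: "vector_field \<A> V Z" "\<And>q. q \<in> V \<Longrightarrow> A q (A q (Z q)) = - Z q"
    and W: "vector_field \<A> V W" "\<And>q. q \<in> V \<Longrightarrow> A q (A q (W q)) = - W q"
  shows "A p (lie_bracket \<A> (\<lambda>q. A q (Z q)) W p + lie_bracket \<A> Z (\<lambda>q. A q (W q)) p)
    = lie_bracket \<A> (\<lambda>q. A q (Z q)) (\<lambda>q. A q (W q)) p - lie_bracket \<A> Z W p"
proof -
  have p: "p \<in> carrier \<A>" using V by blast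
  have "courant \<A> (\<lambda>q. (X q, 0)) (\<lambda>q. (Y q, 0)) p = (lie_bracket \<A> X Y p, 0)" for X Y
    by (simp add: courant_def differential_const[OF p])
  with integrability[OF V(1,2) eigen_field[OF V(1,2) Z] eigen_field[OF V(1,2) W] V(3)]
  show ?thesis
    by (simp add: Phi_apply[OF p] sharp_linear(4)[OF pi_bilinear[OF p]] add.commute)
qed

text \<open>This is the covector part of the integrability condition for the field \<open>Z\<close> and the form \<open>\<beta>\<close>, evaluated on \<open>Y\<close>.
  Covector parts of \<open>\<Phi>\<close> are composed with \<open>A\<close> and vanish on \<open>Y\<close>. The functions \<open>\<beta>(Y)\<close> and \<open>\<beta>(AY)\<close> are zero, so that Lie
  derivatives of forms reduce to brackets of fields.\<close>

lemma bracket_with_kernel: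
  assumes V: "open V" "V \<subseteq> carrier \<A>" "p \<in> V"
    and Z: "vector_field \<A> V Z" "\<And>q. q \<in> V \<Longrightarrow> A q (A q (Z q)) = - Z q"
    and Y: "vector_field \<A> V Y" "\<And>q. q \<in> V \<Longrightarrow> A q (Y q) = 0"
    and \<beta>: "one_form \<A> V \<beta>" "\<And>q. q \<in> V \<Longrightarrow> ((\<beta> q o\<^sub>L A q) o\<^sub>L A q) = - \<beta> q"
  shows "\<beta> p (A p (lie_bracket \<A> (\<lambda>q. A q (Z q)) Y p) + lie_bracket \<A> Z Y p) = 0"
proof -
  let ?AZ = "\<lambda>q. A q (Z q)" and ?\<gamma> = "\<lambda>q. - (\<beta> q o\<^sub>L A q)"
  have p: "p \<in> carrier \<A>" using V by blast
  have AZ: "vector_field \<A> V ?AZ" by (rule vector_field_A[OF V(1,2) Z(1)])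
  have \<gamma>: "one_form \<A> V ?\<gamma>" by (rule one_form_minus[OF V(1) one_form_sections(1)[OF V(1,2) \<beta>(1)]])
  have \<beta>AA: "\<beta> q (A q (A q v)) = - \<beta> q v" if "q \<in> V" for q v
    using arg_cong[OF \<beta>(2)[OF that], of "\<lambda>L. blinfun_apply L v"] by (simp add: blinfun.minus_left)
  have \<beta>Y: "\<beta> q (Y q) = 0" "?\<gamma> q (Y q) = 0" if "q \<in> V" for q
    using \<beta>AA[OF that, of "Y q"] Y(2)[OF that] by (simp_all add: blinfun.zero_right blinfun.minus_left)
  have snd_courant: "snd (courant \<A> (\<lambda>q. (X q, 0)) (\<lambda>q. (W q, \<delta> q)) p)
      = lie_derivative \<A> X \<delta> p + (1/2) *\<^sub>R differential \<A> (\<lambda>q. - \<delta> q (X q)) p" for X W \<delta>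
    by (simp add: courant_def blinfun.zero_left)
  let ?s = "\<lambda>q. (?AZ q, 0)" and ?s' = "\<lambda>q. (Z q, 0)"
    and ?t = "\<lambda>q. ((1/2) *\<^sub>R sharp_at q (\<beta> q), ?\<gamma> q)" and ?t' = "\<lambda>q. ((1/2) *\<^sub>R sharp_at q (\<beta> q o\<^sub>L A q), \<beta> q)"
  have "differential \<A> (\<lambda>q. - ?\<gamma> q (?AZ q)) p = differential \<A> (\<lambda>q. - \<beta> q (Z q)) p"
    by (rule differential_cong[OF V(1,3,2)]) (simp add: blinfun.minus_left \<beta>AA)
  then have form: "snd (courant \<A> ?s ?t p - courant \<A> ?s' ?t' p) = lie_derivative \<A> ?AZ ?\<gamma> p - lie_derivative \<A> Z \<beta> p"
    unfolding snd_diff snd_courant by simp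
  have kill: "snd (\<Phi> p u) (Y p) = 0" for u
    using Y(2)[OF V(3)] by (cases u) (simp add: Phi_apply[OF p] blinfun.minus_left blinfun.zero_right)
  have int: "\<Phi> p (courant \<A> ?s ?t' p + courant \<A> ?s' ?t p) = courant \<A> ?s ?t p - courant \<A> ?s' ?t' p"
    by (rule integrability[OF V(1,2) _ _ V(3)], rule eigen_field[OF V(1,2) Z], assumption,
        rule eigen_form_mixed[OF V(1,2) \<beta>])
  have "(lie_derivative \<A> ?AZ ?\<gamma> p - lie_derivative \<A> Z \<beta> p) (Y p) = 0"
    using kill[of "courant \<A> ?s ?t' p + courant \<A> ?s' ?t p"]
    unfolding int form .
  moreover have "differential \<A> (\<lambda>q. \<beta> q (Y q)) p = 0" "differential \<A> (\<lambda>q. ?\<gamma> q (Y q)) p = 0"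
    using differential_cong[OF V(1,3,2) \<beta>Y(1)] differential_cong[OF V(1,3,2) \<beta>Y(2)] differential_const[OF p, of "0::real"]
    by auto
  ultimately show ?thesis
    using lie_derivative_apply[OF V(1,3,2) AZ Y(1) \<gamma>] lie_derivative_apply[OF V(1,3,2) Z(1) Y(1) \<beta>(1)]
    by (simp add: blinfun.bilinear_simps)
qed

text \<open>The form in \<open>bracket_with_kernel\<close> is arbitrary up to composition with \<open>A \<circ> A\<close>, so that the bracket there is in the
  kernel of \<open>A \<circ> A\<close>.\<close>

lemma kernel_bracket:
  assumes V: "open V" "V \<subseteq> carrier \<A>" "p \<in> V"
    and Z: "vector_field \<A> V Z" "\<And>q. q \<in> V \<Longrightarrow> A q (A q (Z q)) = - Z q"
    and Y: "vector_field \<A> V Y" "\<And>q. q \<in> V \<Longrightarrow> A q (Y q) = 0"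
    and ZY: "A p (lie_bracket \<A> Z Y p) = 0"
  shows "A p (lie_bracket \<A> (\<lambda>q. A q (Z q)) Y p) = 0"
proof -
  have p: "p \<in> carrier \<A>" using V by blast
  let ?c = "chart_at \<A> p"
  note c = chart_at[OF p]
  let ?W = "V \<inter> dom ?c"
  have W: "open ?W" "?W \<subseteq> carrier \<A>" "p \<in> ?W" using V c open_dom[OF c(1)] by auto
  let ?B = "A p (lie_bracket \<A> (\<lambda>q. A q (Z q)) Y p)"
  have "w \<bullet> ?B = 0" for w
  proof -
    \<comment> \<open>The covector field \<open>\<beta>0\<close> has the value \<open>w\<close> at \<open>p\<close>; composition with \<open>A \<circ> A\<close> gives \<open>\<beta> \<circ> A \<circ> A = - \<beta>\<close>.\<close>
    define \<beta>0 where "\<beta>0 = differential \<A> (\<lambda>q. w \<bullet> chmap ?c q)"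
    define \<beta> where "\<beta> q = ((\<beta>0 q o\<^sub>L A q) o\<^sub>L A q)" for q
    have sm: "smooth_fun \<A> ?W (\<lambda>q. w \<bullet> chmap ?c q)"
      by (rule smooth_fun_bounded_linear[OF bounded_linear_inner_right W(1)
            smooth_fun_subset[OF chmap_smooth_fun[OF c(1)]]]) simp
    have "\<beta>0 p v = w \<bullet> v" for v
      unfolding \<beta>0_def using differential_bounded_linear[OF bounded_linear_inner_right
          chmap_smooth_fun[OF c(1)] open_dom[OF c(1)] c(2) p]
      by (simp add: differential_chmap to_chart_at[OF p])
    moreover have "one_form \<A> ?W \<beta>"
      unfolding \<beta>_def \<beta>0_def
      by (rule one_form_sections(1)[OF W(1,2) one_form_sections(1)[OF W(1,2) one_form_differential[OF sm W(1)]]])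
    moreover have "((\<beta> q o\<^sub>L A q) o\<^sub>L A q) = - \<beta> q" if "q \<in> ?W" for q
    proof -
      have qc: "q \<in> carrier \<A>" using that W by blast
      show ?thesis by (rule blinfun_eqI) (simp add: \<beta>_def A_cubed[OF qc] blinfun.bilinear_simps)
    qed
    moreover have "vector_field \<A> ?W Z" "vector_field \<A> ?W Y"
      by (rule vector_field_subset[OF Z(1)], simp) (rule vector_field_subset[OF Y(1)], simp)
    ultimately have "w \<bullet> A p (A p (?B + lie_bracket \<A> Z Y p)) = 0"
      using bracket_with_kernel[OF W, of Z Y \<beta>] Z(2) Y(2) by (simp add: \<beta>_def)
    then show ?thesis by (simp add: blinfun.add_right blinfun.zero_right ZY A_cubed[OF p])
  qed
  then show ?thesis by (metis inner_eq_zero_iff)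
qed

text \<open>A projectable field \<open>X\<close> may be replaced by its component \<open>Z = - AAX\<close> in the image of \<open>A\<close>: the difference lies
  in \<open>Q\<close>, which is involutive, and \<open>AZ = AX\<close>.\<close>

lemma projectable_field_A:
  assumes inv: "involutive \<A> (ker_dist A)" and V: "open V" "V \<subseteq> carrier \<A>"
    and X: "projectable_field \<A> (ker_dist A) V X"
  shows "projectable_field \<A> (ker_dist A) V (\<lambda>p. A p (X p))"
  unfolding projectable_field_def
proof (intro conjI allI impI)
  have Xv: "vector_field \<A> V X" using X unfolding projectable_field_def by blast
  then show "vector_field \<A> V (\<lambda>p. A p (X p))" by (rule vector_field_A[OF V])
  fix W Y assume "open W \<and> W \<subseteq> V \<and> field_in \<A> (ker_dist A) W Y"
  then have W: "open W" "W \<subseteq> V" and Yin: "field_in \<A> (ker_dist A) W Y" by auto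
  have Wc: "W \<subseteq> carrier \<A>" using W V by blast
  have Y: "vector_field \<A> W Y" "\<And>q. q \<in> W \<Longrightarrow> A q (Y q) = 0"
    using Yin unfolding field_in_def ker_dist_def by auto
  have XW: "vector_field \<A> W X" by (rule vector_field_subset[OF Xv W(2)])
  note AX = vector_field_A[OF W(1) Wc XW]
  note AAX = vector_field_A[OF W(1) Wc AX]
  let ?Z = "\<lambda>q. - A q (A q (X q))" and ?N = "\<lambda>q. X q + A q (A q (X q))"
  have Zv: "vector_field \<A> W ?Z" by (rule vector_field_minus[OF W(1) AAX])
  have Nv: "vector_field \<A> W ?N" by (rule vector_field_add[OF W(1) XW AAX])
  have Z: "A q (A q (?Z q)) = - ?Z q" and AZ: "A q (?Z q) = A q (X q)" if "q \<in> W" for q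
    using that Wc A_cubed[of q] by (auto simp: blinfun.minus_right subset_iff)
  have "field_in \<A> (ker_dist A) W ?N"
    using Nv Wc A_cubed unfolding field_in_def ker_dist_def by (auto simp: blinfun.add_right subset_iff)
  then have N: "field_in \<A> (ker_dist A) W (lie_bracket \<A> ?N Y)"
    using inv Yin W(1) Wc unfolding involutive_def open_in_manifold_def by blast
  have XY: "field_in \<A> (ker_dist A) W (lie_bracket \<A> X Y)"
    using X Yin W unfolding projectable_field_def by blast
  show "field_in \<A> (ker_dist A) W (lie_bracket \<A> (\<lambda>p. A p (X p)) Y)"
    unfolding field_in_def
  proof (intro conjI ballI)
    show "vector_field \<A> W (lie_bracket \<A> (\<lambda>p. A p (X p)) Y)"
      by (rule vector_field_lie_bracket[OF W(1) AX Y(1)])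
    fix p assume p: "p \<in> W"
    have "lie_bracket \<A> X Y p = lie_bracket \<A> (\<lambda>q. ?Z q + ?N q) Y p"
      by (rule lie_bracket_cong[OF W(1) p Wc]) simp_all
    also have "\<dots> = lie_bracket \<A> ?Z Y p + lie_bracket \<A> ?N Y p"
      by (rule lie_bracket_add_left[OF W(1) p Wc Zv Nv])
    finally have ZY: "A p (lie_bracket \<A> ?Z Y p) = 0"
      using XY N p unfolding field_in_def ker_dist_def by (auto simp: blinfun.add_right)
    have "A p (lie_bracket \<A> (\<lambda>q. A q (?Z q)) Y p) = 0"
      by (rule kernel_bracket[OF W(1) Wc p Zv Z Y(1) Y(2) ZY])
    moreover have "lie_bracket \<A> (\<lambda>q. A q (?Z q)) Y p = lie_bracket \<A> (\<lambda>q. A q (X q)) Y p"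
      by (rule lie_bracket_cong[OF W(1) p Wc AZ]) simp_all
    ultimately show "lie_bracket \<A> (\<lambda>p. A p (X p)) Y p \<in> ker_dist A p"
      unfolding ker_dist_def by simp
  qed
qed

text \<open>For \<open>s' = (0, da)\<close> and \<open>t' = (0, db)\<close> the partners are \<open>s = \<Phi> s'\<close> and \<open>t = \<Phi> t'\<close>. Since \<open>da\<close> and \<open>db\<close> are closed,
  the Courant brackets are \<open>[s, t'] + [s', t] = (0, dh)\<close> and \<open>[s', t'] = 0\<close>; the claims are the components of \<open>\<Phi>(0, dh) = [s, t]\<close>.\<close>

lemma integrability_exact:
  fixes a b :: "'a \<Rightarrow> real"
  assumes V: "open V" "V \<subseteq> carrier \<A>" "p \<in> V" and a: "smooth_fun \<A> V a" and b: "smooth_fun \<A> V b"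
    and aA: "\<And>q. q \<in> V \<Longrightarrow> ((differential \<A> a q o\<^sub>L A q) o\<^sub>L A q) = - differential \<A> a q"
    and bA: "\<And>q. q \<in> V \<Longrightarrow> ((differential \<A> b q o\<^sub>L A q) o\<^sub>L A q) = - differential \<A> b q"
  defines "h \<equiv> \<lambda>q. \<pi> q (differential \<A> a q) (differential \<A> b q)"
    and "X \<equiv> \<lambda>q. sharp_at q (differential \<A> a q)" and "Y \<equiv> \<lambda>q. sharp_at q (differential \<A> b q)"
    and "\<alpha>' \<equiv> \<lambda>q. - (differential \<A> a q o\<^sub>L A q)" and "\<beta>' \<equiv> \<lambda>q. - (differential \<A> b q o\<^sub>L A q)"
  shows "lie_bracket \<A> X Y p = sharp_at p (differential \<A> h p)"
    and "lie_derivative \<A> X \<beta>' p - lie_derivative \<A> Y \<alpha>' p + (1/2) *\<^sub>R differential \<A> (\<lambda>q. \<alpha>' q (Y q) - \<beta>' q (X q)) p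
      = - (differential \<A> h p o\<^sub>L A p)"
proof -
  have p: "p \<in> carrier \<A>" using V by blast
  let ?\<alpha> = "differential \<A> a" and ?\<beta> = "differential \<A> b"
  have \<alpha>: "one_form \<A> V ?\<alpha>" and \<beta>: "one_form \<A> V ?\<beta>"
    by (rule one_form_differential[OF a V(1)], rule one_form_differential[OF b V(1)])
  have Xv: "vector_field \<A> V X" and Yv: "vector_field \<A> V Y"
    unfolding X_def Y_def by (rule one_form_sections(2)[OF V(1,2) \<alpha>], rule one_form_sections(2)[OF V(1,2) \<beta>])
  have hX: "?\<beta> q (X q) = h q" and hY: "?\<alpha> q (Y q) = - h q" if "q \<in> V" for q
  proof -
    have qc: "q \<in> carrier \<A>" using that V by blast
    show "?\<beta> q (X q) = h q" "?\<alpha> q (Y q) = - h q"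
      unfolding X_def Y_def h_def sharp_apply[OF qc] using pi_skew[OF qc, of "?\<beta> q" "?\<alpha> q"] by simp_all
  qed
  have hs: "smooth_fun \<A> V h"
    by (rule smooth_fun_cong[OF smooth_fun_pairing[OF V(1) \<beta> Xv] V(1)]) (rule hX)
  have minus_h: "differential \<A> (\<lambda>q. - h q) p = - differential \<A> h p"
    by (rule blinfun_eqI)
      (simp add: differential_bounded_linear[OF bounded_linear_minus[OF bounded_linear_ident] hs V(1,3) p] blinfun.minus_left)
  have L\<beta>: "lie_derivative \<A> X ?\<beta> p = differential \<A> h p"
    unfolding lie_derivative_differential[OF V(1,3,2) Xv b] by (rule differential_cong[OF V(1,3,2) hX])
  have L\<alpha>: "lie_derivative \<A> Y ?\<alpha> p = - differential \<A> h p"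
    unfolding lie_derivative_differential[OF V(1,3,2) Yv a] minus_h[symmetric]
    by (rule differential_cong[OF V(1,3,2) hY])
  have half: "D - (1/2) *\<^sub>R D = (1/2) *\<^sub>R D" "- ((1/2) *\<^sub>R D) + D = (1/2) *\<^sub>R D" for D :: "'e covec"
    using scaleR_left_diff_distrib[of 1 "1/2" D] by simp_all
  let ?s = "\<lambda>q. (X q, \<alpha>' q)" and ?s' = "\<lambda>q. (0, ?\<alpha> q)" and ?t = "\<lambda>q. (Y q, \<beta>' q)" and ?t' = "\<lambda>q. (0, ?\<beta> q)"
  have ss: "i_eigen_section \<A> \<Phi> V ?s ?s'" and tt: "i_eigen_section \<A> \<Phi> V ?t ?t'"
    unfolding X_def Y_def \<alpha>'_def \<beta>'_def
    by (rule eigen_form[OF V(1,2) \<alpha> aA], assumption) (rule eigen_form[OF V(1,2) \<beta> bA], assumption)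
  have "differential \<A> (\<lambda>q. - ?\<beta> q (X q)) p = - differential \<A> h p"
    unfolding minus_h[symmetric] by (rule differential_cong[OF V(1,3,2)]) (simp add: hX)
  then have c1: "courant \<A> ?s ?t' p = (0, (1/2) *\<^sub>R differential \<A> h p)"
    by (simp add: courant_def Let_def L\<beta> blinfun.zero_right half)
  have "differential \<A> (\<lambda>q. ?\<alpha> q (Y q)) p = - differential \<A> h p"
    unfolding minus_h[symmetric] by (rule differential_cong[OF V(1,3,2)]) (simp add: hY)
  then have c2: "courant \<A> ?s' ?t p = (0, (1/2) *\<^sub>R differential \<A> h p)"
    by (simp add: courant_def Let_def L\<alpha> blinfun.zero_right half)
  have c3: "courant \<A> ?s' ?t' p = 0"
    by (simp add: courant_def Let_def blinfun.zero_right differential_const[OF p] zero_prod_def)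
  have "courant \<A> ?s ?t' p + courant \<A> ?s' ?t p = (0, differential \<A> h p)"
    unfolding c1 c2 using scaleR_left_distrib[of "1/2" "1/2" "differential \<A> h p"] by simp
  then have "courant \<A> ?s ?t p = (sharp_at p (differential \<A> h p), - (differential \<A> h p o\<^sub>L A p))"
    using integrability[OF V(1,2) ss tt V(3)] by (simp add: c3 Phi_apply[OF p] blinfun.zero_right)
  then show "lie_bracket \<A> X Y p = sharp_at p (differential \<A> h p)"
    and "lie_derivative \<A> X \<beta>' p - lie_derivative \<A> Y \<alpha>' p + (1/2) *\<^sub>R differential \<A> (\<lambda>q. \<alpha>' q (Y q) - \<beta>' q (X q)) p
      = - (differential \<A> h p o\<^sub>L A p)"
    unfolding courant_def Let_def by simp_all
qed

text \<open>If \<open>- da \<circ> A\<close> and \<open>- db \<circ> A\<close> are exact as well, then Cartan's formula applies to the remaining Lie derivatives in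
  \<open>integrability_exact\<close>. With \<open>k = \<pi>(da, db')\<close> the left hand side there is \<open>dk + dk - dk\<close>.\<close>

lemma differential_bracket_conjugate:
  fixes a b a' b' :: "'a \<Rightarrow> real"
  assumes V: "open V" "V \<subseteq> carrier \<A>" "p \<in> V" and a: "smooth_fun \<A> V a" and b: "smooth_fun \<A> V b"
    and a': "smooth_fun \<A> V a'" and b': "smooth_fun \<A> V b'"
    and aa': "\<And>q. q \<in> V \<Longrightarrow> differential \<A> a' q = - (differential \<A> a q o\<^sub>L A q)"
    and bb': "\<And>q. q \<in> V \<Longrightarrow> differential \<A> b' q = - (differential \<A> b q o\<^sub>L A q)"
    and aA: "\<And>q. q \<in> V \<Longrightarrow> ((differential \<A> a q o\<^sub>L A q) o\<^sub>L A q) = - differential \<A> a q"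
    and bA: "\<And>q. q \<in> V \<Longrightarrow> ((differential \<A> b q o\<^sub>L A q) o\<^sub>L A q) = - differential \<A> b q"
  shows "differential \<A> (\<lambda>q. \<pi> q (differential \<A> a q) (differential \<A> b' q)) p
    = - (differential \<A> (\<lambda>q. \<pi> q (differential \<A> a q) (differential \<A> b q)) p o\<^sub>L A p)"
proof -
  have p: "p \<in> carrier \<A>" using V by blast
  let ?\<alpha> = "differential \<A> a" and ?\<beta> = "differential \<A> b"
  let ?X = "\<lambda>q. sharp_at q (?\<alpha> q)" and ?Y = "\<lambda>q. sharp_at q (?\<beta> q)"
  let ?\<alpha>' = "\<lambda>q. - (?\<alpha> q o\<^sub>L A q)" and ?\<beta>' = "\<lambda>q. - (?\<beta> q o\<^sub>L A q)"
  define k where "k = (\<lambda>q. \<pi> q (?\<alpha> q) (differential \<A> b' q))"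
  note X = one_form_sections(2)[OF V(1,2) one_form_differential[OF a V(1)]]
  note Y = one_form_sections(2)[OF V(1,2) one_form_differential[OF b V(1)]]
  have kX: "differential \<A> b' q (?X q) = k q" and kY: "differential \<A> a' q (?Y q) = - k q" if q: "q \<in> V" for q
  proof -
    have qc: "q \<in> carrier \<A>" using q V by blast
    show "differential \<A> b' q (?X q) = k q" unfolding sharp_apply[OF qc] k_def ..
    have "\<pi> q (?\<beta> q) (differential \<A> a' q) = - \<pi> q (differential \<A> a' q) (?\<beta> q)" by (rule pi_skew[OF qc])
    also have "\<dots> = \<pi> q (?\<alpha> q o\<^sub>L A q) (?\<beta> q)" unfolding aa'[OF q] by (simp add: bilinear_lneg[OF pi_bilinear[OF qc]])
    also have "\<dots> = \<pi> q (?\<alpha> q) (?\<beta> q o\<^sub>L A q)" by (rule pi_A[OF qc])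
    also have "\<dots> = - k q" unfolding k_def bb'[OF q] by (simp add: bilinear_rneg[OF pi_bilinear[OF qc]])
    finally show "differential \<A> a' q (?Y q) = - k q" unfolding sharp_apply[OF qc] .
  qed
  have ks: "smooth_fun \<A> V k"
    by (rule smooth_fun_cong[OF smooth_fun_pairing[OF V(1) one_form_differential[OF b' V(1)] X] V(1) kX])
  have minus: "differential \<A> (\<lambda>q. r * k q) p = r *\<^sub>R differential \<A> k p" for r
    by (rule blinfun_eqI)
      (simp add: differential_bounded_linear[OF bounded_linear_mult_right ks V(1,3) p] blinfun.scaleR_left)
  have "lie_derivative \<A> ?X ?\<beta>' p = lie_derivative \<A> ?X (differential \<A> b') p"
    by (rule lie_derivative_cong[OF V(1,3,2)]) (simp add: bb')
  also have "\<dots> = differential \<A> k p"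
    unfolding lie_derivative_differential[OF V(1,3,2) X b'] by (rule differential_cong[OF V(1,3,2) kX])
  finally have 1: "lie_derivative \<A> ?X ?\<beta>' p = differential \<A> k p" .
  have "lie_derivative \<A> ?Y ?\<alpha>' p = lie_derivative \<A> ?Y (differential \<A> a') p"
    by (rule lie_derivative_cong[OF V(1,3,2)]) (simp add: aa')
  also have "\<dots> = differential \<A> (\<lambda>q. -1 * k q) p"
    unfolding lie_derivative_differential[OF V(1,3,2) Y a'] by (rule differential_cong[OF V(1,3,2)]) (simp add: kY)
  finally have 2: "lie_derivative \<A> ?Y ?\<alpha>' p = - differential \<A> k p" unfolding minus by simp
  have "differential \<A> (\<lambda>q. ?\<alpha>' q (?Y q) - ?\<beta>' q (?X q)) p = differential \<A> (\<lambda>q. (-2) * k q) p"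
    by (rule differential_cong[OF V(1,3,2)]) (simp add: aa'[symmetric] bb'[symmetric] kX kY)
  then have 3: "(1/2) *\<^sub>R differential \<A> (\<lambda>q. ?\<alpha>' q (?Y q) - ?\<beta>' q (?X q)) p = - differential \<A> k p"
    unfolding minus by simp
  show ?thesis
    using integrability_exact(2)[OF V a b aA bA] unfolding 1 2 3 k_def[symmetric] by simp
qed

end

section \<open>The complex structure of a local leaf space\<close>

context manifold
begin

lemma open_chmap_preimage:
  assumes "c \<in> \<A>" "open O'"
  shows "open (dom c \<inter> chmap c -` O')"
  using chart_homeomorphism[OF assms(1)] open_dom[OF assms(1)] assms(2)
  unfolding homeomorphism_def by (metis continuous_open_preimage)

end

locale leaf_space = quasi_classical_CRF \<A> \<Phi> A \<pi> + manifold_map \<A> \<B> U f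
  for \<A> :: "('a::{t2_space,second_countable_topology}, 'e::euclidean_space) atlas"
    and \<B> :: "('b::{t2_space,second_countable_topology}, 'f::euclidean_space) atlas"
    and \<Phi> A \<pi> U f +
  assumes onto: "f ` U = carrier \<B>"
    and surj_tangent: "p \<in> U \<Longrightarrow> surj (blinfun_apply (tangent_map \<A> \<B> f p))"
    and ker_tangent: "p \<in> U \<Longrightarrow> tangent_map \<A> \<B> f p v = 0 \<longleftrightarrow> A p v = 0"
    and connected_fibre: "y \<in> carrier \<B> \<Longrightarrow> connected (U \<inter> f -` {y})"
begin

abbreviation T :: "'a \<Rightarrow> 'e \<Rightarrow>\<^sub>L 'f" where
  "T p \<equiv> tangent_map \<A> \<B> f p"

lemma T_A_eqI:
  assumes "p \<in> U" "T p u = T p v"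
  shows "A p u = A p v"
proof -
  have "T p (u - v) = 0" using assms by (simp add: blinfun.diff_right)
  then have "A p (u - v) = 0" using ker_tangent[OF assms(1)] by blast
  then show ?thesis by (simp add: blinfun.diff_right)
qed

lemma T_AA:
  assumes "p \<in> U"
  shows "T p (A p (A p v)) = - T p v"
proof -
  have "A p (A p (A p v) + v) = 0" using A_cubed[of p v] assms U_carrier by (auto simp: blinfun.add_right)
  then have "T p (A p (A p v) + v) = 0" using ker_tangent[OF assms] by blast
  then show ?thesis by (simp add: blinfun.add_right eq_neg_iff_add_eq_0)
qed

lemma tangent_chart_surj:
  assumes p: "p \<in> U" and c: "c \<in> \<A>" "p \<in> dom c" and d: "d \<in> \<B>" "f p \<in> dom d"
  shows "Dmap (\<lambda>x. chmap d (f (chinv c x))) (chmap c p) (to_chart \<A> c p v) = to_chart \<B> d (f p) (T p v)"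
    and "surj (blinfun_apply (Dmap (\<lambda>x. chmap d (f (chinv c x))) (chmap c p)))"
proof -
  have V: "open (U \<inter> f -` dom d)" "p \<in> U \<inter> f -` dom d"
    using open_preimage[OF N.open_dom[OF d(1)]] p d by auto
  have "smooth_fun \<A> (U \<inter> f -` dom d) (\<lambda>q. chmap d (f q))"
    by (rule smooth_fun_pullback[OF N.open_dom[OF d(1)] N.chmap_smooth_fun[OF d(1)]])
  from differential_chart[OF this V(2,1) c]
  show eq: "Dmap (\<lambda>x. chmap d (f (chinv c x))) (chmap c p) (to_chart \<A> c p v) = to_chart \<B> d (f p) (T p v)" for v
    unfolding tangent_map_chart[OF p d] by simp
  show "surj (blinfun_apply (Dmap (\<lambda>x. chmap d (f (chinv c x))) (chmap c p)))"
  proof (rule surjI)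
    fix w
    have "T p (inv (blinfun_apply (T p)) (from_chart \<B> d (f p) w)) = from_chart \<B> d (f p) w"
      by (rule surj_f_inv_f[OF surj_tangent[OF p]])
    then show "Dmap (\<lambda>x. chmap d (f (chinv c x))) (chmap c p)
        (to_chart \<A> c p (inv (blinfun_apply (T p)) (from_chart \<B> d (f p) w))) = w"
      unfolding eq by (simp add: N.to_chart_from_chart[OF d])
  qed
qed

text \<open>A smooth right inverse of \<open>df\<close> in charts gives a lift. Applying \<open>- A \<circ> A\<close> moves it to the image of \<open>A\<close> and does
  not change its projection.\<close>

lemma lift_field:
  assumes p: "p \<in> U" and V': "open V'" "f p \<in> V'" and X': "vector_field \<B> V' X'"
  obtains W Z where "open W" "p \<in> W" "W \<subseteq> U" "f ` W \<subseteq> V'" "vector_field \<A> W Z"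
    "\<And>q. q \<in> W \<Longrightarrow> A q (A q (Z q)) = - Z q" "field_projects_to \<A> \<B> W f Z X'"
proof -
  let ?c = "chart_at \<A> p" and ?d = "chart_at \<B> (f p)"
  let ?g = "\<lambda>x. chmap ?d (f (chinv ?c x))"
  have pc: "p \<in> carrier \<A>" using p U_carrier by blast
  note c = chart_at[OF pc] and d = N.chart_at[OF f_carrier[OF p]]
  have dV: "open (dom ?d \<inter> V')" using N.open_dom[OF d(1)] V' by blast
  let ?V = "U \<inter> f -` (dom ?d \<inter> V')"
  have V: "open ?V" "p \<in> ?V" using open_preimage[OF dV] p d V' by auto
  note O = img_open[OF c(1) V(1)] and pO = chmap_in_img[OF c(2) V(2)]
  have g: "smooth_on (img ?c ?V) ?g"
    by (rule smooth_on_subset[OF smooth_f_chart[OF c(1) d(1)]]) auto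
  obtain O1 R where O1: "open O1" "chmap ?c p \<in> O1" "O1 \<subseteq> img ?c ?V" and R: "smooth_on O1 R"
    and gR: "\<And>x. x \<in> O1 \<Longrightarrow> (Dmap ?g x o\<^sub>L R x) = id_blinfun"
    by (rule submersion_smooth_right_inverse[OF O pO g tangent_chart_surj(2)[OF p c d]]) (rule that; simp)
  define W where "W = dom ?c \<inter> chmap ?c -` O1"
  have W: "open W" "p \<in> W" "W \<subseteq> dom ?c" unfolding W_def using open_chmap_preimage[OF c(1) O1(1)] c O1 by auto
  have imgW: "img ?c W \<subseteq> O1" unfolding W_def by auto
  have WV: "q \<in> U" "f q \<in> dom ?d" "f q \<in> V'" if q: "q \<in> W" for q
  proof -
    have "chmap ?c q \<in> img ?c ?V" using q O1 unfolding W_def by blast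
    then obtain r where "r \<in> dom ?c" "r \<in> ?V" "chmap ?c q = chmap ?c r" by blast
    then have "q = r" using chinv_chmap[OF c(1)] q W(3) by (metis subsetD)
    then show "q \<in> U" "f q \<in> dom ?d" "f q \<in> V'" using \<open>r \<in> ?V\<close> by auto
  qed
  define Y where "Y x = R x (vec_rep \<B> ?d X' (?g x))" for x
  note OW = img_open[OF c(1) W(1)]
  have gW: "smooth_on (img ?c W) ?g" by (rule smooth_on_subset[OF g order_trans[OF imgW O1(3)]])
  have "smooth_on (img ?c W) (\<lambda>x. vec_rep \<B> ?d X' (?g x))"
    by (rule smooth_on_compose[OF OW N.img_open[OF d(1) V'(1)] _ gW N.vector_fieldD[OF X' d(1)]])
      (use WV in \<open>auto simp: chinv_chmap[OF c(1)]\<close>)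
  then have "smooth_on (img ?c W) Y"
    unfolding Y_def by (rule smooth_on_blinfun_apply[OF OW smooth_on_subset[OF R imgW]])
  from vector_field_coord_field[OF c(1) W(1,3) this]
  have Z0: "vector_field \<A> W (coord_field \<A> ?c Y)" .
  have Wc: "W \<subseteq> carrier \<A>" using WV U_carrier by blast
  define Z where "Z q = - A q (A q (coord_field \<A> ?c Y q))" for q
  have Z: "vector_field \<A> W Z" unfolding Z_def
    by (rule vector_field_minus[OF W(1) vector_field_A[OF W(1) Wc vector_field_A[OF W(1) Wc Z0]]])
  have AAZ: "A q (A q (Z q)) = - Z q" if "q \<in> W" for q
    unfolding Z_def using A_cubed[of q] Wc that by (auto simp: blinfun.minus_right)
  have "T q (Z q) = X' (f q)" if q: "q \<in> W" for q
  proof -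
    have qc: "q \<in> dom ?c" and x: "chmap ?c q \<in> O1" using q unfolding W_def by auto
    note q' = WV[OF q]
    have "to_chart \<B> ?d (f q) (T q (coord_field \<A> ?c Y q)) = Dmap ?g (chmap ?c q) (Y (chmap ?c q))"
      unfolding tangent_chart_surj(1)[OF q'(1) c(1) qc d(1) q'(2), symmetric] coord_field_apply[OF c(1) qc] ..
    also have "\<dots> = (Dmap ?g (chmap ?c q) o\<^sub>L R (chmap ?c q)) (vec_rep \<B> ?d X' (chmap ?d (f q)))"
      unfolding Y_def by (simp add: chinv_chmap[OF c(1) qc])
    also have "\<dots> = to_chart \<B> ?d (f q) (X' (f q))"
      unfolding gR[OF x] by (simp add: N.vec_rep_chmap[OF d(1) q'(2)])
    finally have "T q (coord_field \<A> ?c Y q) = X' (f q)"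
      using N.from_chart_to_chart[OF d(1) q'(2)] by metis
    then show ?thesis unfolding Z_def by (simp add: blinfun.minus_right T_AA[OF q'(1)])
  qed
  then have "field_projects_to \<A> \<B> W f Z X'" unfolding field_projects_to_def by blast
  then show ?thesis using that[OF W(1,2) _ _ Z AAZ] WV by blast
qed

text \<open>Extend \<open>v\<close> to a field \<open>Y\<close> in \<open>Q\<close>. The bracket \<open>[Z, Y]\<close> projects to \<open>[X', 0] = 0\<close>, so that \<open>df[AZ, Y] = 0\<close> by
  \<open>kernel_bracket\<close>. As \<open>df(Y) = 0\<close>, what is left of \<open>df[AZ, Y]\<close> is minus the derivative of \<open>df(AZ)\<close> along \<open>Y\<close>.\<close>

lemma differential_push_A:
  assumes W: "open W" "W \<subseteq> U" and d: "d \<in> \<B>" "f ` W \<subseteq> dom d"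
    and Z: "vector_field \<A> W Z" "\<And>q. q \<in> W \<Longrightarrow> A q (A q (Z q)) = - Z q"
    and X': "vector_field \<B> (dom d) X'" and ZX: "field_projects_to \<A> \<B> W f Z X'"
    and q: "q \<in> W" "T q v = 0"
  shows "differential \<A> (\<lambda>r. differential \<A> (\<lambda>s. chmap d (f s)) r (A r (Z r))) q v = 0"
proof -
  let ?k = "\<lambda>s. chmap d (f s)"
  have Wc: "W \<subseteq> carrier \<A>" using W U_carrier by blast
  have qc: "q \<in> carrier \<A>" using q Wc by blast
  obtain V Y0 where V: "open V" "q \<in> V" "V \<subseteq> carrier \<A>" "vector_field \<A> V Y0" and Y0q: "Y0 q = v"
    by (rule extend_vector[OF qc, where v = v])
  let ?O = "W \<inter> V"
  have O: "open ?O" "?O \<subseteq> carrier \<A>" "q \<in> ?O" "?O \<subseteq> U" using W V q Wc by auto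
  \<comment> \<open>The map \<open>1 + A \<circ> A\<close> is the projection to the kernel of \<open>A\<close>.\<close>
  define Y where "Y r = Y0 r + A r (A r (Y0 r))" for r
  have Y0: "vector_field \<A> ?O Y0" by (rule vector_field_subset[OF V(4)]) simp
  have Y: "vector_field \<A> ?O Y" unfolding Y_def
    by (rule vector_field_add[OF O(1) Y0 vector_field_A[OF O(1,2) vector_field_A[OF O(1,2) Y0]]])
  have AY: "A r (Y r) = 0" if "r \<in> ?O" for r
    using A_cubed[of r] O(2) that unfolding Y_def by (auto simp: blinfun.add_right)
  have TY: "T r (Y r) = 0" if "r \<in> ?O" for r using AY[OF that] ker_tangent O(4) that by blast
  have Yq: "Y q = v" unfolding Y_def Y0q using ker_tangent q W by (auto simp: blinfun.zero_right)
  have ZO: "vector_field \<A> ?O Z" by (rule vector_field_subset[OF Z(1)]) simp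
  have AZO: "vector_field \<A> ?O (\<lambda>r. A r (Z r))" by (rule vector_field_A[OF O(1,2) ZO])
  have "T q (lie_bracket \<A> Z Y q) = lie_bracket \<B> X' (\<lambda>y. 0) (f q)"
  proof (rule lie_bracket_projects[OF O(1,4) N.open_dom[OF d(1)] _ ZO Y X' N.vector_field_zero[OF N.open_dom[OF d(1)]] _ _ O(3)])
    show "f ` ?O \<subseteq> dom d" using d by auto
    show "field_projects_to \<A> \<B> ?O f Z X'" using ZX unfolding field_projects_to_def by blast
    show "field_projects_to \<A> \<B> ?O f Y (\<lambda>y. 0)" using TY unfolding field_projects_to_def by blast
  qed
  then have "A q (lie_bracket \<A> Z Y q) = 0" using ker_tangent q W by auto
  then have "A q (lie_bracket \<A> (\<lambda>r. A r (Z r)) Y q) = 0"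
    using kernel_bracket[OF O(1-3) ZO _ Y AY] Z(2) by blast
  then have TAZY: "T q (lie_bracket \<A> (\<lambda>r. A r (Z r)) Y q) = 0" using ker_tangent q W by blast
  have k: "smooth_fun \<A> ?O ?k"
    by (rule smooth_fun_subset[OF smooth_fun_pullback[OF N.open_dom[OF d(1)] N.chmap_smooth_fun[OF d(1)]]])
      (use W d in auto)
  have kT: "differential \<A> ?k r u = to_chart \<B> d (f r) (T r u)" if "r \<in> ?O" for r u
    by (rule tangent_map_chart[OF _ d(1), symmetric]) (use that O(4) d(2) in auto)
  have "differential \<A> (\<lambda>r. differential \<A> ?k r (Y r)) q = differential \<A> (\<lambda>r. 0) q"
    by (rule differential_cong[OF O(1,3,2)]) (simp add: kT TY blinfun.zero_right)
  then have 0: "differential \<A> (\<lambda>r. differential \<A> ?k r (Y r)) q = 0" by (simp add: differential_const[OF qc])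
  show ?thesis
    using lie_bracket_differential[OF O(1,3,2) k AZO Y] kT[OF O(3)] unfolding 0 Yq
    by (simp add: TAZY blinfun.zero_right blinfun.zero_left)
qed

text \<open>Lift a field with the value \<open>w\<close> at \<open>f p\<close>. The vector \<open>df(AZ)\<close> is locally constant on the fibre by
  \<open>differential_push_A\<close>, and it does not depend on the choice of the lift because the kernels of \<open>df\<close> and \<open>A\<close> agree.\<close>

lemma push_A_locally_constant:
  assumes p: "p \<in> U"
  shows "\<exists>W. open W \<and> p \<in> W \<and> W \<subseteq> U \<and> (\<forall>q\<in>W. \<forall>u v. f q = f p \<longrightarrow> T p u = w \<longrightarrow> T q v = w \<longrightarrow> T p (A p u) = T q (A q v))"
proof -
  let ?c = "chart_at \<A> p" and ?d = "chart_at \<B> (f p)"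
  let ?g = "\<lambda>x. chmap ?d (f (chinv ?c x))"
  have pc: "p \<in> carrier \<A>" using p U_carrier by blast
  note c = chart_at[OF pc] and d = N.chart_at[OF f_carrier[OF p]]
  define X' where "X' = coord_field \<B> ?d (\<lambda>x. to_chart \<B> ?d (f p) w)"
  have X': "vector_field \<B> (dom ?d) X'" unfolding X'_def
    by (rule N.vector_field_coord_field[OF d(1) N.open_dom[OF d(1)] _
          smooth_on_const[OF N.img_open[OF d(1) N.open_dom[OF d(1)]]]]) simp
  have X'p: "X' (f p) = w" unfolding X'_def coord_field_def by (rule N.from_chart_to_chart[OF d])
  obtain W Z where W: "open W" "p \<in> W" "W \<subseteq> U" "f ` W \<subseteq> dom ?d" and Z: "vector_field \<A> W Z"
    "\<And>q. q \<in> W \<Longrightarrow> A q (A q (Z q)) = - Z q" and ZX: "field_projects_to \<A> \<B> W f Z X'"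
    by (rule lift_field[OF p N.open_dom[OF d(1)] d(2) X']) (rule that; simp)
  have Wc: "W \<subseteq> carrier \<A>" using W U_carrier by blast
  define F where "F q = differential \<A> (\<lambda>s. chmap ?d (f s)) q (A q (Z q))" for q
  have FT: "F q = to_chart \<B> ?d (f q) (T q (A q (Z q)))" if "q \<in> W" for q
    unfolding F_def by (rule tangent_map_chart[OF _ d(1), symmetric]) (use W that in auto)
  have k: "smooth_fun \<A> W (\<lambda>s. chmap ?d (f s))"
    by (rule smooth_fun_subset[OF smooth_fun_pullback[OF N.open_dom[OF d(1)] N.chmap_smooth_fun[OF d(1)]]])
      (use W in auto)
  have F: "smooth_fun \<A> W F" unfolding F_def
    by (rule smooth_fun_differential_apply[OF W(1) k vector_field_A[OF W(1) Wc Z(1)]])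
  note O = img_open[OF c(1) W(1)] and pO = chmap_in_img[OF c(2) W(2)]
  have g: "smooth_on (img ?c W) ?g"
    by (rule smooth_on_subset[OF smooth_f_chart[OF c(1) d(1)] img_mono]) (use W in auto)
  have kerF: "Dmap (\<lambda>x. F (chinv ?c x)) x v = 0" if x: "x \<in> img ?c W" and 0: "Dmap ?g x v = 0" for x v
  proof -
    obtain q where q: "q \<in> dom ?c" "q \<in> W" "x = chmap ?c q" using x by blast
    have q': "q \<in> U" "f q \<in> dom ?d" using q W by auto
    let ?u = "from_chart \<A> ?c q v"
    have v: "to_chart \<A> ?c q ?u = v" by (rule to_chart_from_chart[OF c(1) q(1)])
    have "to_chart \<B> ?d (f q) (T q ?u) = 0"
      using 0 unfolding tangent_chart_surj(1)[OF q'(1) c(1) q(1) d(1) q'(2), symmetric] v q(3) .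
    then have "T q ?u = 0" using N.from_chart_to_chart[OF d(1) q'(2), of "T q ?u"] by (simp add: blinfun.zero_right)
    then have "differential \<A> F q ?u = 0"
      unfolding F_def using differential_push_A[OF W(1,3) d(1) W(4) Z(1) _ X' ZX q(2)] Z(2) by blast
    then show ?thesis unfolding differential_chart[OF F q(2) W(1) c(1) q(1)] q(3) by (simp add: v)
  qed
  have "\<exists>O1. open O1 \<and> chmap ?c p \<in> O1 \<and> (\<forall>x\<in>O1. ?g x = ?g (chmap ?c p) \<longrightarrow> F (chinv ?c x) = F (chinv ?c (chmap ?c p)))"
    by (rule locally_constant_on_fibres[OF O pO g tangent_chart_surj(2)[OF p c d] smooth_funD[OF F c(1)] kerF]) blast+
  then obtain O1 where O1: "open O1" "chmap ?c p \<in> O1"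
    and const: "\<And>x. x \<in> O1 \<Longrightarrow> ?g x = ?g (chmap ?c p) \<Longrightarrow> F (chinv ?c x) = F (chinv ?c (chmap ?c p))"
    by blast
  define W1 where "W1 = W \<inter> (dom ?c \<inter> chmap ?c -` O1)"
  have W1: "open W1" "p \<in> W1" "W1 \<subseteq> U"
    unfolding W1_def using open_Int[OF W(1) open_chmap_preimage[OF c(1) O1(1)]] W O1 c by auto
  have "T p (A p u) = T q (A q v)" if q: "q \<in> W1" and fq: "f q = f p" and u: "T p u = w" and v: "T q v = w" for q u v
  proof -
    have q': "q \<in> W" "q \<in> dom ?c" "chmap ?c q \<in> O1" "q \<in> U" using q W1 unfolding W1_def by auto
    have "F q = F p"
      using const[OF q'(3)] by (simp add: chinv_chmap[OF c(1)] q'(2) c(2) fq)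
    then have "T q (A q (Z q)) = T p (A p (Z p))"
      unfolding FT[OF q'(1)] FT[OF W(2)] fq using N.from_chart_to_chart[OF d] by metis
    moreover have "T q (Z q) = w" "T p (Z p) = w"
      using ZX q'(1) W(2) X'p fq unfolding field_projects_to_def by auto
    then have "A q v = A q (Z q)" "A p u = A p (Z p)"
      using T_A_eqI[OF q'(4)] T_A_eqI[OF p] u v by simp_all
    ultimately show ?thesis by simp
  qed
  then show ?thesis using W1 by blast
qed

lemma push_A_constant:
  assumes p: "p \<in> U" and q: "q \<in> U" and pq: "f p = f q" and u: "T p u = w" and v: "T q v = w"
  shows "T p (A p u) = T q (A q v)"
proof -
  let ?F = "U \<inter> f -` {f p}"
  define h where "h r = T r (A r (SOME x. T r x = w))" for r
  have some: "T r (SOME x. T r x = w) = w" if "r \<in> U" for r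
  proof -
    have "\<exists>x. T r x = w" using surj_tangent[OF that] by (metis surjD)
    then show ?thesis by (rule someI_ex)
  qed
  have h: "T r (A r x) = h r" if "r \<in> U" "T r x = w" for r x
    unfolding h_def using T_A_eqI[OF that(1), of x] that some[OF that(1)] by metis
  have "h constant_on ?F"
  proof (rule locally_constant_imp_constant)
    show "connected ?F" by (rule connected_fibre[OF f_carrier[OF p]])
    fix a assume a: "a \<in> ?F"
    then obtain W where W: "open W" "a \<in> W" "W \<subseteq> U"
      and const: "\<And>r x y. r \<in> W \<Longrightarrow> f r = f a \<Longrightarrow> T a x = w \<Longrightarrow> T r y = w \<Longrightarrow> T a (A a x) = T r (A r y)"
      using push_A_locally_constant[of a w] by (metis IntD1)
    have "h r = h a" if "r \<in> ?F \<inter> W" for r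
      unfolding h_def by (rule const[symmetric]) (use that a some in auto)
    moreover have "openin (top_of_set ?F) (?F \<inter> W)" using W(1) by (simp add: openin_open_Int)
    ultimately show "\<exists>S. openin (top_of_set ?F) S \<and> a \<in> S \<and> (\<forall>x\<in>S. h x = h a)"
      using a W(2) by blast
  qed
  then have "h p = h q" unfolding constant_on_def using p q pq by auto
  then show ?thesis using h[OF p u] h[OF q v] by simp
qed

text \<open>By \<open>push_A_constant\<close> the value is the same for every point of the fibre and every lift of \<open>w\<close>.\<close>

definition J :: "'b \<Rightarrow> 'f \<Rightarrow>\<^sub>L 'f" where
  "J y = (let p = SOME p. p \<in> U \<and> f p = y in Blinfun (\<lambda>w. T p (A p (SOME u. T p u = w))))"

lemma J_tangent:
  assumes p: "p \<in> U"
  shows "J (f p) (T p u) = T p (A p u)"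
proof -
  define r where "r = (SOME r. r \<in> U \<and> f r = f p)"
  have "r \<in> U \<and> f r = f p" unfolding r_def by (rule someI_ex) (use p in blast)
  then have r: "r \<in> U" "f r = f p" by auto
  define K where "K w = T r (A r (SOME u. T r u = w))" for w
  have some: "T r (SOME x. T r x = w) = w" for w
  proof -
    have "\<exists>x. T r x = w" using surj_tangent[OF r(1)] by (metis surjD)
    then show ?thesis by (rule someI_ex)
  qed
  have K: "K (T r x) = T r (A r x)" for x
    unfolding K_def using T_A_eqI[OF r(1) some] by simp
  have ex: "\<exists>x. w = T r x" for w using some by metis
  have "linear K"
  proof (rule linearI)
    fix v w s
    obtain x y where xy: "v = T r x" "w = T r y" using ex by metis
    show "K (v + w) = K v + K w"
      unfolding xy by (simp only: blinfun.add_right[symmetric] K)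
    show "K (s *\<^sub>R v) = s *\<^sub>R K v"
      unfolding xy by (simp only: blinfun.scaleR_right[symmetric] K)
  qed
  then have "blinfun_apply (J (f p)) = K"
    unfolding J_def Let_def r_def[symmetric] K_def[symmetric]
    by (intro bounded_linear_Blinfun_apply) (simp add: linear_conv_bounded_linear)
  moreover have "K (T p u) = T p (A p u)"
    unfolding K_def by (rule push_A_constant[OF r(1) p r(2) some]) simp
  ultimately show ?thesis by simp
qed

lemma leaf_point:
  assumes "y \<in> carrier \<B>"
  obtains p where "p \<in> U" "f p = y"
  using onto assms by (metis imageE)

lemma T_surjE:
  assumes "p \<in> U"
  obtains u where "T p u = w"
  using surj_tangent[OF assms] by (metis surjD)

lemma J_squared:
  assumes "y \<in> carrier \<B>"
  shows "J y (J y w) = - w"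
proof -
  obtain p where p: "p \<in> U" "f p = y" using leaf_point[OF assms] .
  obtain u where u: "T p u = w" using T_surjE[OF p(1)] .
  show ?thesis unfolding p(2)[symmetric] u[symmetric] by (simp add: J_tangent[OF p(1)] T_AA[OF p(1)])
qed

lemma induces_J: "induces_on_leaf_space \<A> (ker_dist A) U f \<B> A J"
  unfolding induces_on_leaf_space_def
proof (intro allI impI)
  fix V X X'
  assume V: "open V \<and> V \<subseteq> U \<and> projectable_field \<A> (ker_dist A) V X \<and> field_projects_to \<A> \<B> V f X X'"
  show "field_projects_to \<A> \<B> V f (\<lambda>p. A p (X p)) (\<lambda>y. J y (X' y))"
    unfolding field_projects_to_def
  proof
    fix p assume p: "p \<in> V"
    then have pU: "p \<in> U" and Tp: "T p (X p) = X' (f p)" using V unfolding field_projects_to_def by auto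
    show "T p (A p (X p)) = J (f p) (X' (f p))" unfolding Tp[symmetric] J_tangent[OF pU] ..
  qed
qed

text \<open>In charts \<open>J X'\<close> composed with the submersion \<open>f\<close> is \<open>df(AZ)\<close> for a lift \<open>Z\<close> of \<open>X'\<close>, which is smooth;
  and smoothness can be tested after composition with a submersion.\<close>

lemma vector_field_J:
  assumes V': "open V'" and X': "vector_field \<B> V' X'" and V'c: "V' \<subseteq> carrier \<B>"
  shows "vector_field \<B> V' (\<lambda>y. J y (X' y))"
proof (rule N.vector_field_local)
  fix y assume y: "y \<in> V'"
  then obtain p where p: "p \<in> U" "f p = y" using leaf_point V'c by blast
  let ?c = "chart_at \<A> p" and ?d = "chart_at \<B> y"
  let ?g = "\<lambda>x. chmap ?d (f (chinv ?c x))"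
  have pc: "p \<in> carrier \<A>" using p U_carrier by blast
  have yc: "y \<in> carrier \<B>" using y V'c by blast
  note c = chart_at[OF pc] and d = N.chart_at[OF yc]
  let ?V = "dom ?d \<inter> V'"
  have V: "open ?V" using N.open_dom[OF d(1)] V' by blast
  have fpV: "f p \<in> ?V" using d y p by simp
  have X'V: "vector_field \<B> ?V X'" by (rule N.vector_field_subset[OF X']) simp
  obtain W Z where W: "open W" "p \<in> W" "W \<subseteq> U" "f ` W \<subseteq> ?V" and Z: "vector_field \<A> W Z"
    and "\<And>q. q \<in> W \<Longrightarrow> A q (A q (Z q)) = - Z q" and ZX: "field_projects_to \<A> \<B> W f Z X'"
    by (rule lift_field[OF p(1) V fpV X'V]) (rule that; blast)
  have Wc: "W \<subseteq> carrier \<A>" using W U_carrier by blast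
  let ?S = "img ?c W" and ?k = "vec_rep \<B> ?d (\<lambda>y. J y (X' y))"
  note O = img_open[OF c(1) W(1)]
  have g: "smooth_on ?S ?g"
    by (rule smooth_on_subset[OF smooth_f_chart[OF c(1) d(1)] img_mono]) (use W in auto)
  have surj: "surj (blinfun_apply (Dmap ?g x))" if x: "x \<in> ?S" for x
  proof -
    obtain q where q: "q \<in> dom ?c" "q \<in> W" "x = chmap ?c q" using x by blast
    show ?thesis unfolding q(3) by (rule tangent_chart_surj(2)[OF _ c(1) q(1) d(1)]) (use q W in auto)
  qed
  let ?F = "\<lambda>q. differential \<A> (\<lambda>s. chmap ?d (f s)) q (A q (Z q))"
  have k: "smooth_fun \<A> W (\<lambda>s. chmap ?d (f s))"
    by (rule smooth_fun_subset[OF smooth_fun_pullback[OF N.open_dom[OF d(1)] N.chmap_smooth_fun[OF d(1)]]])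
      (use W in auto)
  have "smooth_fun \<A> W ?F"
    by (rule smooth_fun_differential_apply[OF W(1) k vector_field_A[OF W(1) Wc Z]])
  then have "smooth_on ?S (\<lambda>x. ?F (chinv ?c x))" by (rule smooth_funD[OF _ c(1)])
  then have "smooth_on ?S (\<lambda>x. ?k (?g x))"
  proof (rule smooth_on_cong[OF _ O])
    fix x assume "x \<in> ?S"
    then obtain q where q: "q \<in> dom ?c" "q \<in> W" "x = chmap ?c q" by blast
    then have q': "q \<in> U" "f q \<in> dom ?d" using W by auto
    have "T q (Z q) = X' (f q)" using ZX q unfolding field_projects_to_def by blast
    then show "?F (chinv ?c x) = ?k (?g x)"
      unfolding q(3) chinv_chmap[OF c(1) q(1)] N.vec_rep_chmap[OF d(1) q'(2)]
        tangent_map_chart[OF q'(1) d(1) q'(2), symmetric] J_tangent[OF q'(1), symmetric] by simp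
  qed
  note k = smooth_on_factor_through_submersion[OF O g surj this]
  let ?W = "dom ?d \<inter> chmap ?d -` (?g ` ?S)"
  have "open ?W" by (rule N.open_chmap_preimage[OF d(1)], rule k(1))
  moreover have "?g (chmap ?c p) = chmap ?d y" using p by (simp add: chinv_chmap[OF c])
  then have "chmap ?d y \<in> ?g ` ?S" using c(2) W(2) by (metis (no_types, lifting) IntI image_eqI)
  then have "y \<in> ?W" using d(2) by blast
  moreover have "smooth_on (img ?d ?W) ?k" by (rule smooth_on_subset[OF k(2)]) auto
  ultimately show "\<exists>c W. c \<in> \<B> \<and> open W \<and> y \<in> W \<and> W \<subseteq> dom c \<and> smooth_on (img c W) (vec_rep \<B> c (\<lambda>y. J y (X' y)))"
    using d(1) by blast
qed

end

context leaf_space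
begin

text \<open>Lifts \<open>Z\<close> of \<open>X'\<close> and \<open>AZ\<close> of \<open>J X'\<close> exist, and the Nijenhuis identity for the lifts projects.\<close>

lemma nijenhuis_J:
  assumes V': "open V'" "V' \<subseteq> carrier \<B>" "y \<in> V'" and X': "vector_field \<B> V' X'" and Y': "vector_field \<B> V' Y'"
  shows "J y (lie_bracket \<B> (\<lambda>q. J q (X' q)) Y' y + lie_bracket \<B> X' (\<lambda>q. J q (Y' q)) y)
    = lie_bracket \<B> (\<lambda>q. J q (X' q)) (\<lambda>q. J q (Y' q)) y - lie_bracket \<B> X' Y' y"
proof -
  obtain p where p: "p \<in> U" and fp: "f p = y" using leaf_point V' by blast
  have fpV: "f p \<in> V'" using fp V'(3) by simp
  obtain W1 Z where W1: "open W1" "p \<in> W1" "W1 \<subseteq> U" "f ` W1 \<subseteq> V'" and Z1: "vector_field \<A> W1 Z"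
    and AAZ: "\<And>q. q \<in> W1 \<Longrightarrow> A q (A q (Z q)) = - Z q" and ZX: "field_projects_to \<A> \<B> W1 f Z X'"
    by (rule lift_field[OF p V'(1) fpV X']) (rule that; blast)
  obtain W2 Y where W2: "open W2" "p \<in> W2" "W2 \<subseteq> U" "f ` W2 \<subseteq> V'" and Y2: "vector_field \<A> W2 Y"
    and AAY: "\<And>q. q \<in> W2 \<Longrightarrow> A q (A q (Y q)) = - Y q" and YY: "field_projects_to \<A> \<B> W2 f Y Y'"
    by (rule lift_field[OF p V'(1) fpV Y']) (rule that; blast)
  let ?W = "W1 \<inter> W2"
  have W: "open ?W" "?W \<subseteq> U" "f ` ?W \<subseteq> V'" "p \<in> ?W" using W1 W2 by auto
  have Wc: "?W \<subseteq> carrier \<A>" using W(2) U_carrier by blast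
  have Z: "vector_field \<A> ?W Z" and Y: "vector_field \<A> ?W Y"
    by (rule vector_field_subset[OF Z1], simp) (rule vector_field_subset[OF Y2], simp)
  note AZ = vector_field_A[OF W(1) Wc Z] and AY = vector_field_A[OF W(1) Wc Y]
  note JX = vector_field_J[OF V'(1) X' V'(2)] and JY = vector_field_J[OF V'(1) Y' V'(2)]
  have rZ: "field_projects_to \<A> \<B> ?W f Z X'" and rY: "field_projects_to \<A> \<B> ?W f Y Y'"
    using ZX YY unfolding field_projects_to_def by auto
  have rA: "field_projects_to \<A> \<B> ?W f (\<lambda>q. A q (S q)) (\<lambda>q. J q (S' q))" if "field_projects_to \<A> \<B> ?W f S S'" for S S'
    unfolding field_projects_to_def
  proof
    fix q assume q: "q \<in> ?W"
    then have "T q (S q) = S' (f q)" using that unfolding field_projects_to_def by blast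
    then show "T q (A q (S q)) = J (f q) (S' (f q))" using J_tangent[of q "S q"] q W(2) by auto
  qed
  note proj = lie_bracket_projects[OF W(1,2) V'(1) W(3) _ _ _ _ _ _ W(4), unfolded fp]
  have "T p (A p (lie_bracket \<A> (\<lambda>q. A q (Z q)) Y p + lie_bracket \<A> Z (\<lambda>q. A q (Y q)) p))
      = T p (lie_bracket \<A> (\<lambda>q. A q (Z q)) (\<lambda>q. A q (Y q)) p - lie_bracket \<A> Z Y p)"
    using nijenhuis_image_A[OF W(1) Wc W(4) Z _ Y] AAZ AAY by simp
  then show ?thesis
    unfolding J_tangent[OF p, symmetric] fp blinfun.diff_right blinfun.add_right
      proj[OF AZ Y JX Y' rA[OF rZ] rY] proj[OF Z AY X' JY rZ rA[OF rY]] proj[OF AZ AY JX JY rA[OF rZ] rA[OF rY]]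
      proj[OF Z Y X' Y' rZ rY] .
qed

lemma complex_structure_J: "complex_structure \<B> J"
  unfolding complex_structure_def
proof (intro conjI allI impI ballI)
  show "endo_field \<B> J"
    unfolding endo_field_def open_in_manifold_def using vector_field_J by blast
  show "J y (J y v) = - v" if "y \<in> carrier \<B>" for y v by (rule J_squared[OF that])
  fix V X Y y
  assume V: "open_in_manifold \<B> V \<and> vector_field \<B> V X \<and> vector_field \<B> V Y" and y: "y \<in> V"
  then have V': "open V" "V \<subseteq> carrier \<B>" unfolding open_in_manifold_def by auto
  from nijenhuis_J[OF V' y, of X Y] V
  show "lie_bracket \<B> (\<lambda>q. J q (X q)) (\<lambda>q. J q (Y q)) y - J y (lie_bracket \<B> (\<lambda>q. J q (X q)) Y y)
      - J y (lie_bracket \<B> X (\<lambda>q. J q (Y q)) y) - lie_bracket \<B> X Y y = 0"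
    by (simp add: blinfun.add_right algebra_simps)
qed

end


section \<open>The Poisson structure of a local leaf space\<close>

locale leaf_space_bivector = leaf_space \<A> \<B> \<Phi> A \<pi> U f
  for \<A> :: "('a::{t2_space,second_countable_topology}, 'e::euclidean_space) atlas"
    and \<B> :: "('b::{t2_space,second_countable_topology}, 'f::euclidean_space) atlas"
    and \<Phi> A \<pi> U f +
  fixes \<pi>' :: "'b \<Rightarrow> 'f bivec"
  assumes bivector: "bivector_field \<B> \<pi>'" and projects: "bivector_projects_to \<A> \<B> U f \<pi> \<pi>'"
begin

lemma pi'_bilinear: "y \<in> carrier \<B> \<Longrightarrow> bilinear (\<pi>' y)"
  and pi'_skew: "y \<in> carrier \<B> \<Longrightarrow> \<pi>' y \<alpha> \<beta> = - \<pi>' y \<beta> \<alpha>"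
  using bivector unfolding bivector_field_def by blast+

lemma pi_T: "p \<in> U \<Longrightarrow> \<pi> p (\<alpha> o\<^sub>L T p) (\<beta> o\<^sub>L T p) = \<pi>' (f p) \<alpha> \<beta>"
  using projects unfolding bivector_projects_to_def by blast

lemma J_T: "p \<in> U \<Longrightarrow> ((\<alpha> o\<^sub>L J (f p)) o\<^sub>L T p) = ((\<alpha> o\<^sub>L T p) o\<^sub>L A p)"
  by (rule blinfun_eqI) (simp add: J_tangent)

lemma pi'_J:
  assumes "y \<in> carrier \<B>"
  shows "\<pi>' y (\<alpha> o\<^sub>L J y) \<beta> = \<pi>' y \<alpha> (\<beta> o\<^sub>L J y)"
proof -
  obtain p where p: "p \<in> U" and fp: "f p = y" using leaf_point[OF assms] .
  have pc: "p \<in> carrier \<A>" using p U_carrier by blast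
  show ?thesis
    unfolding fp[symmetric] pi_T[OF p, symmetric] J_T[OF p] by (rule pi_A[OF pc])
qed

definition Poisson_bracket :: "('b \<Rightarrow> real) \<Rightarrow> ('b \<Rightarrow> real) \<Rightarrow> 'b \<Rightarrow> real" where
  "Poisson_bracket a b y = \<pi>' y (differential \<B> a y) (differential \<B> b y)"

lemma smooth_Poisson_bracket:
  assumes "open V'" "V' \<subseteq> carrier \<B>" "smooth_fun \<B> V' a" "smooth_fun \<B> V' b"
  shows "smooth_fun \<B> V' (Poisson_bracket a b)"
proof -
  have "smooth_fun \<B> V' (\<lambda>y. \<pi>' y (differential \<B> a y) (differential \<B> b y))"
    using bivector N.one_form_differential[OF assms(3,1)] N.one_form_differential[OF assms(4,1)] assms(1,2)
    unfolding bivector_field_def open_in_manifold_def by blast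
  then show ?thesis unfolding Poisson_bracket_def .
qed

text \<open>Pulled back differentials vanish on \<open>Q\<close>, and \<open>A \<circ> A = - 1\<close> modulo \<open>Q\<close>; so they satisfy the
  hypotheses of \<open>integrability_exact\<close>.\<close>

lemma pullback_function:
  assumes V': "open V'" and a: "smooth_fun \<B> V' a"
  shows "smooth_fun \<A> (U \<inter> f -` V') (\<lambda>q. a (f q))"
    and "q \<in> U \<inter> f -` V' \<Longrightarrow> differential \<A> (\<lambda>q. a (f q)) q = (differential \<B> a (f q) o\<^sub>L T q)"
    and "q \<in> U \<inter> f -` V' \<Longrightarrow>
      ((differential \<A> (\<lambda>q. a (f q)) q o\<^sub>L A q) o\<^sub>L A q) = - differential \<A> (\<lambda>q. a (f q)) q"
proof -
  show "smooth_fun \<A> (U \<inter> f -` V') (\<lambda>q. a (f q))" by (rule smooth_fun_pullback[OF V' a])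
  show eq: "differential \<A> (\<lambda>q. a (f q)) q = (differential \<B> a (f q) o\<^sub>L T q)" if "q \<in> U \<inter> f -` V'"
    by (rule differential_pullback[OF V' a]) (use that in auto)
  show "((differential \<A> (\<lambda>q. a (f q)) q o\<^sub>L A q) o\<^sub>L A q) = - differential \<A> (\<lambda>q. a (f q)) q"
    if q: "q \<in> U \<inter> f -` V'"
    unfolding eq[OF q] by (rule blinfun_eqI) (use q in \<open>simp add: T_AA blinfun.bilinear_simps\<close>)
qed

lemma pi_pullback:
  assumes V': "open V'" and a: "smooth_fun \<B> V' a" and b: "smooth_fun \<B> V' b" and q: "q \<in> U \<inter> f -` V'"
  shows "\<pi> q (differential \<A> (\<lambda>q. a (f q)) q) (differential \<A> (\<lambda>q. b (f q)) q) = Poisson_bracket a b (f q)"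
  unfolding pullback_function(2)[OF V' a q] pullback_function(2)[OF V' b q] Poisson_bracket_def
  by (rule pi_T) (use q in simp)

text \<open>Apply \<open>dc\<close> to \<open>[\<sharp>da, \<sharp>db] = \<sharp>d{a, b}\<close> for the pulled back functions.\<close>

lemma Jacobi_identity:
  assumes V': "open V'" "V' \<subseteq> carrier \<B>" "y \<in> V'"
    and a: "smooth_fun \<B> V' a" and b: "smooth_fun \<B> V' b" and c: "smooth_fun \<B> V' c"
  shows "Poisson_bracket a (Poisson_bracket b c) y + Poisson_bracket b (Poisson_bracket c a) y
    + Poisson_bracket c (Poisson_bracket a b) y = 0"
proof -
  have yc: "y \<in> carrier \<B>" using V' by blast
  obtain p where pU: "p \<in> U" and fp: "f p = y" using leaf_point[OF yc] .
  let ?V = "U \<inter> f -` V'"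
  have V: "open ?V" "?V \<subseteq> carrier \<A>" "p \<in> ?V" using open_preimage[OF V'(1)] U_carrier pU fp V'(3) by auto
  have pc: "p \<in> carrier \<A>" using V by blast
  let ?a = "\<lambda>q. a (f q)" and ?b = "\<lambda>q. b (f q)" and ?c = "\<lambda>q. c (f q)"
  note pa = pullback_function[OF V'(1) a] and pb = pullback_function[OF V'(1) b] and pc' = pullback_function[OF V'(1) c]
  let ?X = "\<lambda>q. sharp_at q (differential \<A> ?a q)" and ?Y = "\<lambda>q. sharp_at q (differential \<A> ?b q)"
  note X = one_form_sections(2)[OF V(1,2) one_form_differential[OF pa(1) V(1)]]
  note Y = one_form_sections(2)[OF V(1,2) one_form_differential[OF pb(1) V(1)]]
  note ab = smooth_Poisson_bracket[OF V'(1,2) a b] and ac = smooth_Poisson_bracket[OF V'(1,2) a c]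
    and bc = smooth_Poisson_bracket[OF V'(1,2) b c]
  have sharp_diff: "differential \<A> (\<lambda>q. k (f q)) q (sharp_at q (differential \<A> (\<lambda>q. l (f q)) q)) = Poisson_bracket l k (f q)"
    if k: "smooth_fun \<B> V' k" and l: "smooth_fun \<B> V' l" and q: "q \<in> ?V" for k l q
  proof -
    have "q \<in> carrier \<A>" using q V by blast
    then show ?thesis unfolding sharp_apply by (rule sharp_apply[THEN trans]) (rule pi_pullback[OF V'(1) l k q])
  qed
  have dab: "differential \<A> (\<lambda>q. \<pi> q (differential \<A> ?a q) (differential \<A> ?b q)) p
      = differential \<A> (\<lambda>q. Poisson_bracket a b (f q)) p"
    by (rule differential_cong[OF V(1,3,2) pi_pullback[OF V'(1) a b]])
  have dbc: "differential \<A> (\<lambda>q. differential \<A> ?c q (?Y q)) p = differential \<A> (\<lambda>q. Poisson_bracket b c (f q)) p"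
    by (rule differential_cong[OF V(1,3,2)]) (rule sharp_diff[OF c b])
  have dac: "differential \<A> (\<lambda>q. differential \<A> ?c q (?X q)) p = differential \<A> (\<lambda>q. Poisson_bracket a c (f q)) p"
    by (rule differential_cong[OF V(1,3,2)]) (rule sharp_diff[OF c a])
  have "lie_bracket \<A> ?X ?Y p = sharp_at p (differential \<A> (\<lambda>q. Poisson_bracket a b (f q)) p)"
    unfolding dab[symmetric] by (rule integrability_exact(1)[OF V pa(1) pb(1) pa(3) pb(3)])
  then have "Poisson_bracket (Poisson_bracket a b) c y
      = Poisson_bracket a (Poisson_bracket b c) y - Poisson_bracket b (Poisson_bracket a c) y"
    using lie_bracket_differential[OF V(1,3,2) pc'(1) X Y] unfolding dbc dac
    by (simp add: sharp_diff[OF c ab V(3)] sharp_diff[OF bc a V(3)] sharp_diff[OF ac b V(3)] fp)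
  moreover have "Poisson_bracket (Poisson_bracket a b) c y = - Poisson_bracket c (Poisson_bracket a b) y"
    unfolding Poisson_bracket_def[of _ _ y] by (rule pi'_skew[OF yc])
  moreover have "Poisson_bracket b (Poisson_bracket a c) y = - Poisson_bracket b (Poisson_bracket c a) y"
  proof -
    have "differential \<B> (Poisson_bracket a c) y = differential \<B> (\<lambda>q. - Poisson_bracket c a q) y"
      by (rule N.differential_cong[OF V'(1,3,2)]) (use pi'_skew V' in \<open>auto simp: Poisson_bracket_def\<close>)
    also have "\<dots> = - differential \<B> (Poisson_bracket c a) y"
      by (rule blinfun_eqI)
        (simp add: N.differential_bounded_linear[OF bounded_linear_minus[OF bounded_linear_ident]
            smooth_Poisson_bracket[OF V'(1,2) c a] V'(1,3) yc] blinfun.minus_left)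
    finally show ?thesis
      unfolding Poisson_bracket_def[of b _ y] by (simp add: bilinear_rneg[OF pi'_bilinear[OF yc]])
  qed
  ultimately show ?thesis by simp
qed

text \<open>In the chart at \<open>y\<close> the covectors are the differentials of linear functions of the coordinates, and \<open>[\<pi>', \<pi>']\<close> is
  twice the Jacobi expression of these functions.\<close>

lemma schouten_zero:
  assumes y: "y \<in> carrier \<B>"
  shows "schouten \<B> \<pi>' \<pi>' y \<alpha> \<beta> \<gamma> = 0"
proof -
  let ?d = "chart_at \<B> y"
  note d = N.chart_at[OF y]
  note V' = N.open_dom[OF d(1)]
  have dc: "dom ?d \<subseteq> carrier \<B>" using N.dom_carrier[OF d(1)] by blast
  let ?fn = "\<lambda>\<alpha> q. blinfun_apply \<alpha> (chmap ?d q)"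
  have sm: "smooth_fun \<B> (dom ?d) (?fn \<alpha>)" for \<alpha> :: "'f covec"
    by (rule N.smooth_fun_bounded_linear[OF blinfun.bounded_linear_right V' N.chmap_smooth_fun[OF d(1)]])
  have diff: "differential \<B> (?fn \<alpha>) q = (\<alpha> o\<^sub>L to_chart \<B> ?d q)" if q: "q \<in> dom ?d" for \<alpha> :: "'f covec" and q
    by (rule blinfun_eqI)
      (simp add: N.differential_bounded_linear[OF blinfun.bounded_linear_right N.chmap_smooth_fun[OF d(1)] V' q
          N.dom_carrier[OF d(1) q]] N.differential_chmap)
  have right_id: "(\<alpha> o\<^sub>L id_blinfun) = \<alpha>" for \<alpha> :: "'f covec"
    by (rule blinfun_eqI) simp
  have id: "differential \<B> (?fn \<alpha>) y = \<alpha>" for \<alpha> :: "'f covec"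
    unfolding diff[OF d(2)] N.to_chart_at[OF y] by (rule right_id)
  have P: "bivec_rep \<B> ?d \<pi>' (chmap ?d y) = \<pi>' y"
    by (intro ext) (simp add: bivec_rep_def N.chinv_chmap[OF d] N.to_chart_at[OF y] right_id)
  have D: "Dmap (\<lambda>x. bivec_rep \<B> ?d \<pi>' x \<beta> \<gamma>) (chmap ?d y) = differential \<B> (Poisson_bracket (?fn \<beta>) (?fn \<gamma>)) y" for \<beta> \<gamma>
    unfolding N.differential_chart_at[OF y]
    by (rule Dmap_cong_open[OF N.img_open[OF d(1) V'] N.chmap_in_img[OF d(2) d(2)]])
      (auto simp: bivec_rep_def Poisson_bracket_def diff N.chinv_chmap[OF d(1)])
  have t: "differential \<B> (Poisson_bracket (?fn \<beta>) (?fn \<gamma>)) y (sharp (\<pi>' y) \<alpha>)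
      = Poisson_bracket (?fn \<alpha>) (Poisson_bracket (?fn \<beta>) (?fn \<gamma>)) y" for \<alpha> \<beta> \<gamma>
    unfolding Poisson_bracket_def[of "?fn \<alpha>"] id sharp_works[OF pi'_bilinear[OF y]] ..
  show ?thesis
    using Jacobi_identity[OF V' dc d(2) sm[of \<alpha>] sm[of \<beta>] sm[of \<gamma>]]
    unfolding schouten_def Let_def P D t by simp
qed

lemma differential_Poisson_bracket_conjugate:
  assumes V': "open V'" "V' \<subseteq> carrier \<B>" "y \<in> V'"
    and a: "smooth_fun \<B> V' a" and b: "smooth_fun \<B> V' b" and a': "smooth_fun \<B> V' a'" and b': "smooth_fun \<B> V' b'"
    and aa': "\<And>q. q \<in> V' \<Longrightarrow> differential \<B> a' q = - (differential \<B> a q o\<^sub>L J q)"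
    and bb': "\<And>q. q \<in> V' \<Longrightarrow> differential \<B> b' q = - (differential \<B> b q o\<^sub>L J q)"
  shows "differential \<B> (Poisson_bracket a b') y = - (differential \<B> (Poisson_bracket a b) y o\<^sub>L J y)"
proof -
  have yc: "y \<in> carrier \<B>" using V' by blast
  obtain p where pU: "p \<in> U" and fp: "f p = y" using leaf_point[OF yc] .
  let ?V = "U \<inter> f -` V'"
  have V: "open ?V" "?V \<subseteq> carrier \<A>" "p \<in> ?V" using open_preimage[OF V'(1)] U_carrier pU fp V'(3) by auto
  note pb = pullback_function[OF V'(1)]
  have conj: "differential \<A> (\<lambda>q. c' (f q)) q = - (differential \<A> (\<lambda>q. c (f q)) q o\<^sub>L A q)"
    if c: "smooth_fun \<B> V' c" and c': "smooth_fun \<B> V' c'" and q: "q \<in> ?V"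
      and cc': "\<And>q. q \<in> V' \<Longrightarrow> differential \<B> c' q = - (differential \<B> c q o\<^sub>L J q)" for c c' q
  proof -
    have "differential \<B> c' (f q) = - (differential \<B> c (f q) o\<^sub>L J (f q))" by (rule cc') (use q in simp)
    then show ?thesis unfolding pb(2)[OF c q] pb(2)[OF c' q]
      by (intro blinfun_eqI) (use q in \<open>simp add: blinfun.minus_left J_tangent\<close>)
  qed
  have cA: "differential \<A> (\<lambda>q. a' (f q)) q = - (differential \<A> (\<lambda>q. a (f q)) q o\<^sub>L A q)" if "q \<in> ?V" for q
    by (rule conj[OF a a' that aa'])
  have cB: "differential \<A> (\<lambda>q. b' (f q)) q = - (differential \<A> (\<lambda>q. b (f q)) q o\<^sub>L A q)" if "q \<in> ?V" for q
    by (rule conj[OF b b' that bb'])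
  have d1: "differential \<A> (\<lambda>q. \<pi> q (differential \<A> (\<lambda>q. a (f q)) q) (differential \<A> (\<lambda>q. b' (f q)) q)) p
      = differential \<A> (\<lambda>q. Poisson_bracket a b' (f q)) p"
    by (rule differential_cong[OF V(1,3,2) pi_pullback[OF V'(1) a b']])
  have d2: "differential \<A> (\<lambda>q. \<pi> q (differential \<A> (\<lambda>q. a (f q)) q) (differential \<A> (\<lambda>q. b (f q)) q)) p
      = differential \<A> (\<lambda>q. Poisson_bracket a b (f q)) p"
    by (rule differential_cong[OF V(1,3,2) pi_pullback[OF V'(1) a b]])
  have "differential \<A> (\<lambda>q. Poisson_bracket a b' (f q)) p
      = - (differential \<A> (\<lambda>q. Poisson_bracket a b (f q)) p o\<^sub>L A p)"
    unfolding d1[symmetric] d2[symmetric]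
    by (rule differential_bracket_conjugate[OF V pb(1)[OF a] pb(1)[OF b] pb(1)[OF a'] pb(1)[OF b'] cA cB
          pb(3)[OF a] pb(3)[OF b]])
  then have eq: "(differential \<B> (Poisson_bracket a b') y o\<^sub>L T p)
      = - ((differential \<B> (Poisson_bracket a b) y o\<^sub>L T p) o\<^sub>L A p)"
    unfolding pb(2)[OF smooth_Poisson_bracket[OF V'(1,2) a b'] V(3)] pb(2)[OF smooth_Poisson_bracket[OF V'(1,2) a b] V(3)] fp .
  show ?thesis
  proof (rule blinfun_eqI)
    fix w
    obtain u where u: "T p u = w" using T_surjE[OF pU] .
    have "J y w = T p (A p u)" unfolding u[symmetric] fp[symmetric] by (rule J_tangent[OF pU])
    then show "differential \<B> (Poisson_bracket a b') y w = (- (differential \<B> (Poisson_bracket a b) y o\<^sub>L J y)) w"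
      using arg_cong[OF eq, of "\<lambda>L. blinfun_apply L u"] by (simp add: u blinfun.minus_left)
  qed
qed

end

section \<open>Complex coordinates and holomorphic coefficients\<close>

text \<open>The real and imaginary parts of the differentials form \<open>2m\<close> independent real covectors on a space of dimension \<open>2m\<close>,
  hence a coordinate system of the tangent space.\<close>

lemma complex_forms_surjective:
  fixes D :: "nat \<Rightarrow> 'f::euclidean_space \<Rightarrow> complex"
  assumes lin: "\<And>j. j < m \<Longrightarrow> linear (D j)" and dim: "DIM('f) = 2 * m"
    and inj: "\<And>v. (\<And>j. j < m \<Longrightarrow> D j v = 0) \<Longrightarrow> v = 0"
  shows "\<exists>v. \<forall>j<m. D j v = w j"
proof -
  obtain h where h: "bij_betw h (Basis :: 'f set) {0..<2 * m}"
    using ex_bij_betw_finite_nat[of "Basis :: 'f set"] dim by auto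
  define part where "part k z = (if even k then Re z else Im z)" for k :: nat and z :: complex
  define G where "G = (\<lambda>u :: nat \<Rightarrow> complex. \<Sum>b\<in>Basis. part (h b) (u (h b div 2)) *\<^sub>R (b :: 'f))"
  have hb: "h b div 2 < m" if "b \<in> Basis" for b
    using bij_betwE[OF h] that by force
  have G_eq: "u j = u' j" if eq: "G u = G u'" and j: "j < m" for u u' j
  proof -
    have "part k (u (k div 2)) = part k (u' (k div 2))" if "k < 2 * m" for k
    proof -
      have "k \<in> h ` Basis" using h that by (simp add: bij_betw_def)
      then obtain b where b: "b \<in> Basis" "h b = k" by blast
      show ?thesis using arg_cong[OF eq, of "\<lambda>x. x \<bullet> b"] b unfolding G_def
        by (simp add: inner_sum_left_Basis)
    qed
    from this[of "2 * j"] this[of "2 * j + 1"] show "u j = u' j"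
      using j by (simp add: part_def complex_eq_iff)
  qed
  let ?K = "\<lambda>v. G (\<lambda>j. D j v)"
  have "linear ?K"
  proof (rule linearI)
    fix v w r
    show "?K (v + w) = ?K v + ?K w"
      unfolding G_def sum.distrib[symmetric]
      by (rule sum.cong[OF refl]) (simp add: linear_add[OF lin[OF hb]] part_def scaleR_left_distrib)
    show "?K (r *\<^sub>R v) = r *\<^sub>R ?K v"
      unfolding G_def scaleR_sum_right
      by (rule sum.cong[OF refl]) (simp add: linear_scale[OF lin[OF hb]] part_def)
  qed
  moreover have "inj ?K"
  proof (rule injI)
    fix v v' assume "?K v = ?K v'"
    from G_eq[OF this] have "v - v' = 0"
      by (intro inj) (simp add: linear_diff[OF lin])
    then show "v = v'" by simp
  qed
  ultimately have "surj ?K" by (rule linear_injective_imp_surjective) (rule refl)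
  then obtain v where "?K v = G w" by (metis surjD)
  from G_eq[OF this] show ?thesis by blast
qed

context manifold
begin

text \<open>The coordinate vectors are specified by a description, which is proper because the differentials of the
  coordinates separate vectors and, by dimension, take all values.\<close>

lemma coordinate_vectors:
  assumes z: "complex_coordinates \<A> J W m z" and y: "y \<in> W"
  shows "j < m \<Longrightarrow> differential \<A> (z j) y (coord_vec \<A> m z y i w) = (if j = i then w else 0)"
    and "v = (\<Sum>i<m. Re (differential \<A> (z i) y v) *\<^sub>R coord_vec \<A> m z y i 1
      + Im (differential \<A> (z i) y v) *\<^sub>R coord_vec \<A> m z y i \<i>)"
proof -
  let ?D = "\<lambda>j. blinfun_apply (differential \<A> (z j) y)"
  have dim: "DIM('e) = 2 * m" and inj: "\<And>v. (\<And>j. j < m \<Longrightarrow> ?D j v = 0) \<Longrightarrow> v = 0"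
    using z y unfolding complex_coordinates_def by blast+
  have lin: "linear (?D j)" for j by (rule bounded_linear.linear[OF blinfun.bounded_linear_right])
  have c: "\<forall>j<m. ?D j (coord_vec \<A> m z y i w) = (if j = i then w else 0)" for i w
    unfolding coord_vec_def
  proof (rule theI')
    obtain v where v: "\<forall>j<m. ?D j v = (if j = i then w else 0)"
      using complex_forms_surjective[of m ?D "\<lambda>j. if j = i then w else 0", OF lin dim inj] by blast
    show "\<exists>!v. \<forall>j<m. ?D j v = (if j = i then w else 0)"
    proof (rule ex1I[of _ v])
      fix v' assume v': "\<forall>j<m. ?D j v' = (if j = i then w else 0)"
      have "v' - v = 0" by (rule inj) (use v v' in \<open>simp add: blinfun.diff_right\<close>)
      then show "v' = v" by simp
    qed (rule v)
  qed
  then show "j < m \<Longrightarrow> ?D j (coord_vec \<A> m z y i w) = (if j = i then w else 0)" by blast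
  let ?s = "\<Sum>i<m. Re (?D i v) *\<^sub>R coord_vec \<A> m z y i 1 + Im (?D i v) *\<^sub>R coord_vec \<A> m z y i \<i>"
  have "?D j ?s = ?D j v" if j: "j < m" for j
  proof -
    have "?D j ?s = (\<Sum>i<m. Re (?D i v) *\<^sub>R ?D j (coord_vec \<A> m z y i 1) + Im (?D i v) *\<^sub>R ?D j (coord_vec \<A> m z y i \<i>))"
      by (simp only: blinfun.sum_right blinfun.add_right blinfun.scaleR_right)
    also have "\<dots> = (\<Sum>i<m. if j = i then ?D i v else 0)"
      by (rule sum.cong[OF refl]) (use c j in \<open>simp add: complex_eq_iff\<close>)
    finally show ?thesis using j by simp
  qed
  then have "v - ?s = 0" by (intro inj) (simp add: blinfun.diff_right)
  then show "v = ?s" by simp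
qed

lemma smooth_fun_complexI:
  assumes "open V" "smooth_fun \<A> V a" "smooth_fun \<A> V b"
  shows "smooth_fun \<A> V (\<lambda>q. Complex (a q) (b q))"
proof -
  have "smooth_fun \<A> V (\<lambda>q. complex_of_real (a q) + \<i> * complex_of_real (b q))"
    by (rule smooth_fun_add[OF assms(1) smooth_fun_bounded_linear[OF bounded_linear_of_real assms(1,2)]
          smooth_fun_bounded_linear[OF bounded_linear_compose[OF bounded_linear_mult_right bounded_linear_of_real] assms(1,3)]])
  then show ?thesis by (simp add: Complex_eq)
qed

lemma differential_complex:
  assumes "open V" "smooth_fun \<A> V a" "smooth_fun \<A> V b" "p \<in> V" "p \<in> carrier \<A>"
  shows "differential \<A> (\<lambda>q. Complex (a q) (b q)) p v = Complex (differential \<A> a p v) (differential \<A> b p v)"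
proof -
  note h = smooth_fun_complexI[OF assms(1-3)]
  have "Re (differential \<A> (\<lambda>q. Complex (a q) (b q)) p v) = differential \<A> a p v"
    using differential_bounded_linear[OF bounded_linear_Re h assms(1,4,5)] by simp
  moreover have "Im (differential \<A> (\<lambda>q. Complex (a q) (b q)) p v) = differential \<A> b p v"
    using differential_bounded_linear[OF bounded_linear_Im h assms(1,4,5)] by simp
  ultimately show ?thesis by (simp add: complex_eq_iff)
qed

lemma J_holomorphic_parts:
  assumes h: "J_holomorphic \<A> J W h" and W: "open W" "W \<subseteq> carrier \<A>"
  shows "smooth_fun \<A> W (\<lambda>y. Re (h y))" "smooth_fun \<A> W (\<lambda>y. Im (h y))"
    and "y \<in> W \<Longrightarrow> differential \<A> h y v = Complex (differential \<A> (\<lambda>y. Re (h y)) y v) (differential \<A> (\<lambda>y. Im (h y)) y v)"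
    and "y \<in> W \<Longrightarrow> differential \<A> (\<lambda>y. Im (h y)) y = - (differential \<A> (\<lambda>y. Re (h y)) y o\<^sub>L J y)"
proof -
  have sm: "smooth_fun \<A> W h" and hol: "\<And>y v. y \<in> W \<Longrightarrow> differential \<A> h y (J y v) = \<i> * differential \<A> h y v"
    using h unfolding J_holomorphic_def by auto
  show "smooth_fun \<A> W (\<lambda>y. Re (h y))" "smooth_fun \<A> W (\<lambda>y. Im (h y))"
    by (rule smooth_fun_bounded_linear[OF bounded_linear_Re W(1) sm] smooth_fun_bounded_linear[OF bounded_linear_Im W(1) sm])+
  show eq: "differential \<A> h y v = Complex (differential \<A> (\<lambda>y. Re (h y)) y v) (differential \<A> (\<lambda>y. Im (h y)) y v)"
    if "y \<in> W" for y v
    using differential_bounded_linear[OF bounded_linear_Re sm W(1) that]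
      differential_bounded_linear[OF bounded_linear_Im sm W(1) that] that W(2) by (auto simp: complex_eq_iff)
  show "differential \<A> (\<lambda>y. Im (h y)) y = - (differential \<A> (\<lambda>y. Re (h y)) y o\<^sub>L J y)" if "y \<in> W"
    by (rule blinfun_eqI) (use hol[OF that] in \<open>simp add: eq[OF that] complex_eq_iff blinfun.minus_left\<close>)
qed

end

lemma antisymmetric_double_sum:
  fixes P :: "nat \<Rightarrow> nat \<Rightarrow> complex"
  assumes "\<And>i j. i < m \<Longrightarrow> j < m \<Longrightarrow> P i j = - P j i"
  shows "(\<Sum>i<m. \<Sum>j<m. P i j * (a i * b j - a j * b i)) = 2 * (\<Sum>i<m. \<Sum>j<m. P i j * (a i * b j))"
proof -
  have "(\<Sum>i<m. \<Sum>j<m. P i j * (a j * b i)) = (\<Sum>j<m. \<Sum>i<m. P i j * (a j * b i))"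
    by (rule sum.swap)
  also have "\<dots> = (\<Sum>j<m. \<Sum>i<m. - (P j i * (a j * b i)))"
  proof (intro sum.cong refl)
    fix j i assume "j \<in> {..<m}" "i \<in> {..<m}"
    then have "P i j = - P j i" by (intro assms) auto
    then show "P i j * (a j * b i) = - (P j i * (a j * b i))" by (simp only: mult_minus_left)
  qed
  finally have "(\<Sum>i<m. \<Sum>j<m. P i j * (a j * b i)) = - (\<Sum>i<m. \<Sum>j<m. P i j * (a i * b j))"
    by (simp add: sum_negf)
  then show ?thesis by (simp add: right_diff_distrib sum_subtractf)
qed

context leaf_space_bivector
begin

text \<open>For holomorphic \<open>z\<^sub>i = x\<^sub>i + \<i> y\<^sub>i\<close> compatibility with \<open>J\<close> gives \<open>{y\<^sub>i, y\<^sub>j} = - {x\<^sub>i, x\<^sub>j}\<close> and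
  \<open>{y\<^sub>i, x\<^sub>j} = {x\<^sub>i, y\<^sub>j}\<close>, so that the complex bilinear extension satisfies
  \<open>{z\<^sub>i, z\<^sub>j} = 2 ({x\<^sub>i, x\<^sub>j} + \<i> {x\<^sub>i, y\<^sub>j})\<close> and \<open>{z\<^sub>i, conj z\<^sub>j} = 0\<close>.\<close>

definition holomorphic_coeff :: "('b \<Rightarrow> complex) \<Rightarrow> ('b \<Rightarrow> complex) \<Rightarrow> 'b \<Rightarrow> complex" where
  "holomorphic_coeff h k y = Complex (2 * Poisson_bracket (\<lambda>y. Re (h y)) (\<lambda>y. Re (k y)) y)
    (2 * Poisson_bracket (\<lambda>y. Re (h y)) (\<lambda>y. Im (k y)) y)"

lemma holomorphic_brackets:
  assumes W: "open W" "W \<subseteq> carrier \<B>" "y \<in> W" and h: "J_holomorphic \<B> J W h" and k: "J_holomorphic \<B> J W k"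
  shows "Poisson_bracket (\<lambda>y. Im (h y)) (\<lambda>y. Re (k y)) y = Poisson_bracket (\<lambda>y. Re (h y)) (\<lambda>y. Im (k y)) y"
    and "Poisson_bracket (\<lambda>y. Im (h y)) (\<lambda>y. Im (k y)) y = - Poisson_bracket (\<lambda>y. Re (h y)) (\<lambda>y. Re (k y)) y"
proof -
  have y: "y \<in> carrier \<B>" using W by blast
  note b = pi'_bilinear[OF y]
  have JJ: "((\<alpha> o\<^sub>L J y) o\<^sub>L J y) = - \<alpha>" for \<alpha> :: "'f covec"
    by (rule blinfun_eqI) (simp add: J_squared[OF y] blinfun.bilinear_simps)
  note dh = N.J_holomorphic_parts(4)[OF h W(1,2,3)] and dk = N.J_holomorphic_parts(4)[OF k W(1,2,3)]
  show "Poisson_bracket (\<lambda>y. Im (h y)) (\<lambda>y. Re (k y)) y = Poisson_bracket (\<lambda>y. Re (h y)) (\<lambda>y. Im (k y)) y"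
    unfolding Poisson_bracket_def dh dk by (simp add: bilinear_lneg[OF b] bilinear_rneg[OF b] pi'_J[OF y])
  show "Poisson_bracket (\<lambda>y. Im (h y)) (\<lambda>y. Im (k y)) y = - Poisson_bracket (\<lambda>y. Re (h y)) (\<lambda>y. Re (k y)) y"
    unfolding Poisson_bracket_def dh dk by (simp add: bilinear_lneg[OF b] bilinear_rneg[OF b] pi'_J[OF y] JJ)
qed

text \<open>Write \<open>{h, k} = 2 (u + \<i> v)\<close>. By \<open>differential_Poisson_bracket_conjugate\<close>, \<open>dv = - du \<circ> J\<close>, which is the Cauchy-Riemann
  equation.\<close>

lemma holomorphic_coeff_holomorphic:
  assumes W: "open W" "W \<subseteq> carrier \<B>" and h: "J_holomorphic \<B> J W h" and k: "J_holomorphic \<B> J W k"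
  shows "J_holomorphic \<B> J W (holomorphic_coeff h k)"
proof -
  note hp = N.J_holomorphic_parts[OF h W] and kp = N.J_holomorphic_parts[OF k W]
  let ?u = "Poisson_bracket (\<lambda>y. Re (h y)) (\<lambda>y. Re (k y))" and ?v = "Poisson_bracket (\<lambda>y. Re (h y)) (\<lambda>y. Im (k y))"
  have u: "smooth_fun \<B> W ?u" and v: "smooth_fun \<B> W ?v"
    by (rule smooth_Poisson_bracket[OF W hp(1) kp(1)], rule smooth_Poisson_bracket[OF W hp(1) kp(2)])
  have u2: "smooth_fun \<B> W (\<lambda>y. 2 * ?u y)" and v2: "smooth_fun \<B> W (\<lambda>y. 2 * ?v y)"
    by (rule N.smooth_fun_bounded_linear[OF bounded_linear_mult_right W(1) u],
        rule N.smooth_fun_bounded_linear[OF bounded_linear_mult_right W(1) v])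
  have eq: "holomorphic_coeff h k = (\<lambda>y. Complex (2 * ?u y) (2 * ?v y))"
    by (rule ext) (simp add: holomorphic_coeff_def)
  have "differential \<B> (holomorphic_coeff h k) y (J y w) = \<i> * differential \<B> (holomorphic_coeff h k) y w"
    if y: "y \<in> W" for y w
  proof -
    have yc: "y \<in> carrier \<B>" using y W by blast
    have dv: "differential \<B> ?v y = - (differential \<B> ?u y o\<^sub>L J y)"
      by (rule differential_Poisson_bracket_conjugate[OF W y hp(1) kp(1) hp(2) kp(2) hp(4) kp(4)])
    have d: "differential \<B> (holomorphic_coeff h k) y x = Complex (2 * differential \<B> ?u y x) (2 * differential \<B> ?v y x)" for x
      unfolding eq N.differential_complex[OF W(1) u2 v2 y yc]
        N.differential_bounded_linear[OF bounded_linear_mult_right u W(1) y yc]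
        N.differential_bounded_linear[OF bounded_linear_mult_right v W(1) y yc] ..
    show ?thesis
      unfolding d dv by (simp add: complex_eq_iff blinfun.minus_left J_squared[OF yc] blinfun.minus_right)
  qed
  moreover have "smooth_fun \<B> W (holomorphic_coeff h k)"
    unfolding eq by (rule N.smooth_fun_complexI[OF W(1) u2 v2])
  ultimately show ?thesis unfolding J_holomorphic_def by blast
qed

text \<open>A real covector is \<open>\<alpha> = 2 Re (\<Sum>\<^sub>i \<alpha>(\<partial>/\<partial>z\<^sub>i) dz\<^sub>i)\<close>. Expanding both arguments, the brackets of coordinates with
  conjugate coordinates drop out by \<open>holomorphic_brackets\<close>.\<close>

lemma bivector_in_coordinates:
  assumes z: "complex_coordinates \<B> J W m z" and y: "y \<in> W"
  defines "P \<equiv> \<lambda>i j. holomorphic_coeff (z i) (z j) y"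
  shows "\<pi>' y \<alpha> \<beta> = 2 * Re (\<Sum>i<m. \<Sum>j<m. P i j * (on_dz \<B> m z y i \<alpha> * on_dz \<B> m z y j \<beta>))"
proof -
  have W: "open W" "W \<subseteq> carrier \<B>" and hol: "\<And>i. i < m \<Longrightarrow> J_holomorphic \<B> J W (z i)"
    using z unfolding complex_coordinates_def open_in_manifold_def by auto
  have yc: "y \<in> carrier \<B>" using y W by blast
  note b = pi'_bilinear[OF yc]
  let ?x = "\<lambda>i. differential \<B> (\<lambda>y. Re (z i y)) y" and ?e = "\<lambda>i. differential \<B> (\<lambda>y. Im (z i y)) y"
  let ?c1 = "\<lambda>\<alpha> i. blinfun_apply \<alpha> (coord_vec \<B> m z y i 1)" and ?c2 = "\<lambda>\<alpha> i. blinfun_apply \<alpha> (coord_vec \<B> m z y i \<i>)"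
  have expand: "\<alpha> = (\<Sum>i<m. ?c1 \<alpha> i *\<^sub>R ?x i + ?c2 \<alpha> i *\<^sub>R ?e i)" for \<alpha> :: "'f covec"
  proof (rule blinfun_eqI)
    fix v
    have D: "Re (differential \<B> (z i) y v) = ?x i v" "Im (differential \<B> (z i) y v) = ?e i v" if "i < m" for i
      using N.J_holomorphic_parts(3)[OF hol[OF that] W y, of v] by simp_all
    have "\<alpha> v = (\<Sum>i<m. Re (differential \<B> (z i) y v) * ?c1 \<alpha> i + Im (differential \<B> (z i) y v) * ?c2 \<alpha> i)"
      by (subst N.coordinate_vectors(2)[OF z y, of v]) (simp add: blinfun.sum_right blinfun.add_right blinfun.scaleR_right)
    also have "\<dots> = (\<Sum>i<m. ?c1 \<alpha> i *\<^sub>R ?x i + ?c2 \<alpha> i *\<^sub>R ?e i) v"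
      unfolding blinfun.sum_left by (rule sum.cong[OF refl]) (simp add: D blinfun.add_left blinfun.scaleR_left mult.commute)
    finally show "\<alpha> v = (\<Sum>i<m. ?c1 \<alpha> i *\<^sub>R ?x i + ?c2 \<alpha> i *\<^sub>R ?e i) v" .
  qed
  have entry: "\<pi>' y (?c1 \<alpha> i *\<^sub>R ?x i + ?c2 \<alpha> i *\<^sub>R ?e i) (?c1 \<beta> j *\<^sub>R ?x j + ?c2 \<beta> j *\<^sub>R ?e j)
      = 2 * Re (P i j * (on_dz \<B> m z y i \<alpha> * on_dz \<B> m z y j \<beta>))" if "i < m" "j < m" for i j
  proof -
    note hb = holomorphic_brackets[OF W y hol[OF that(1)] hol[OF that(2)], unfolded Poisson_bracket_def]
    show ?thesis
      unfolding P_def holomorphic_coeff_def Poisson_bracket_def on_dz_def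
      by (simp add: bilinear_ladd[OF b] bilinear_radd[OF b] bilinear_lmul[OF b] bilinear_rmul[OF b] hb field_simps)
  qed
  have lin1: "linear (\<lambda>\<alpha>. \<pi>' y \<alpha> \<beta>)" and lin2: "linear (\<pi>' y \<alpha>)" for \<alpha> \<beta> using b unfolding bilinear_def by auto
  have "\<pi>' y \<alpha> \<beta> = \<pi>' y (\<Sum>i<m. ?c1 \<alpha> i *\<^sub>R ?x i + ?c2 \<alpha> i *\<^sub>R ?e i) (\<Sum>j<m. ?c1 \<beta> j *\<^sub>R ?x j + ?c2 \<beta> j *\<^sub>R ?e j)"
    by (simp only: expand[symmetric])
  also have "\<dots> = (\<Sum>i<m. \<Sum>j<m. \<pi>' y (?c1 \<alpha> i *\<^sub>R ?x i + ?c2 \<alpha> i *\<^sub>R ?e i) (?c1 \<beta> j *\<^sub>R ?x j + ?c2 \<beta> j *\<^sub>R ?e j))"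
    unfolding linear_sum[OF lin1] linear_sum[OF lin2] by (rule sum.swap)
  also have "\<dots> = (\<Sum>i<m. \<Sum>j<m. 2 * Re (P i j * (on_dz \<B> m z y i \<alpha> * on_dz \<B> m z y j \<beta>)))"
    by (intro sum.cong refl entry) auto
  also have "\<dots> = 2 * Re (\<Sum>i<m. \<Sum>j<m. P i j * (on_dz \<B> m z y i \<alpha> * on_dz \<B> m z y j \<beta>))"
    by (simp add: sum_distrib_left)
  finally show ?thesis .
qed

lemma holomorphic_Poisson_projection: "holomorphic_Poisson \<B> J \<pi>'"
  unfolding holomorphic_Poisson_def
proof (intro conjI allI impI ballI bivector schouten_zero)
  fix W m z
  assume z: "complex_coordinates \<B> J W m z"
  have W: "open W" "W \<subseteq> carrier \<B>" and hol: "\<And>i. i < m \<Longrightarrow> J_holomorphic \<B> J W (z i)"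
    using z unfolding complex_coordinates_def open_in_manifold_def by auto
  let ?P = "\<lambda>i j. holomorphic_coeff (z i) (z j)"
  have antisym: "?P i j y = - ?P j i y" if "i < m" "j < m" "y \<in> W" for i j y
  proof -
    have yc: "y \<in> carrier \<B>" using that W by blast
    show ?thesis
      using holomorphic_brackets(1)[OF W that(3) hol[OF that(2)] hol[OF that(1)]]
        pi'_skew[OF yc, of "differential \<B> (\<lambda>y. Re (z i y)) y" "differential \<B> (\<lambda>y. Re (z j y)) y"]
        pi'_skew[OF yc, of "differential \<B> (\<lambda>y. Re (z i y)) y" "differential \<B> (\<lambda>y. Im (z j y)) y"]
      by (simp add: holomorphic_coeff_def complex_eq_iff Poisson_bracket_def)
  qed
  have "complex_of_real (\<pi>' y \<alpha> \<beta>) = (1/2) * (\<Sum>i<m. \<Sum>j<m.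
      ?P i j y * (on_dz \<B> m z y i \<alpha> * on_dz \<B> m z y j \<beta> - on_dz \<B> m z y j \<alpha> * on_dz \<B> m z y i \<beta>) +
      cnj (?P i j y) * (on_dzbar \<B> m z y i \<alpha> * on_dzbar \<B> m z y j \<beta> - on_dzbar \<B> m z y j \<alpha> * on_dzbar \<B> m z y i \<beta>))"
    if y: "y \<in> W" for y \<alpha> \<beta>
  proof -
    let ?a = "\<lambda>i. on_dz \<B> m z y i \<alpha>" and ?b = "\<lambda>i. on_dz \<B> m z y i \<beta>"
    let ?S = "\<Sum>i<m. \<Sum>j<m. ?P i j y * (?a i * ?b j)"
    let ?Q = "\<lambda>i j. ?P i j y * (?a i * ?b j - ?a j * ?b i)"
    have bar: "on_dzbar \<B> m z y i \<gamma> = cnj (on_dz \<B> m z y i \<gamma>)" for i \<gamma>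
      unfolding on_dz_def on_dzbar_def by simp
    have twice_Re: "2 * s + cnj (2 * s) = 2 * complex_of_real (2 * Re s)" for s
      by (simp add: complex_eq_iff)
    have S: "(\<Sum>i<m. \<Sum>j<m. ?Q i j) = 2 * ?S"
      by (rule antisymmetric_double_sum) (use antisym y in blast)
    have "(\<Sum>i<m. \<Sum>j<m. ?Q i j + cnj (?Q i j)) = 2 * ?S + cnj (2 * ?S)"
      unfolding S[symmetric] by (simp only: sum.distrib cnj_sum)
    also have "\<dots> = 2 * complex_of_real (2 * Re ?S)"
      by (rule twice_Re)
    also have "\<dots> = 2 * complex_of_real (\<pi>' y \<alpha> \<beta>)"
      unfolding bivector_in_coordinates[OF z y] ..
    finally show ?thesis unfolding bar by simp
  qed
  then show "\<exists>P. (\<forall>i<m. \<forall>j<m. J_holomorphic \<B> J W (P i j) \<and> (\<forall>y\<in>W. P i j y = - P j i y)) \<and>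
      (\<forall>y\<in>W. \<forall>\<alpha> \<beta>. complex_of_real (\<pi>' y \<alpha> \<beta>) = (1/2) * (\<Sum>i<m. \<Sum>j<m.
        P i j y * (on_dz \<B> m z y i \<alpha> * on_dz \<B> m z y j \<beta> - on_dz \<B> m z y j \<alpha> * on_dz \<B> m z y i \<beta>) +
        cnj (P i j y) * (on_dzbar \<B> m z y i \<alpha> * on_dzbar \<B> m z y j \<beta> - on_dzbar \<B> m z y j \<alpha> * on_dzbar \<B> m z y i \<beta>)))"
    by (intro exI[of _ ?P] conjI allI impI ballI holomorphic_coeff_holomorphic[OF W hol hol] antisym) auto
qed

end

theorem proposition3p1:
  fixes \<A> :: "('a::{t2_space,second_countable_topology}, 'e::euclidean_space) atlas"
    and \<Phi> :: "'a \<Rightarrow> 'e big \<Rightarrow> 'e big"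
    and A :: "'a \<Rightarrow> 'e \<Rightarrow>\<^sub>L 'e"
    and \<pi> :: "'a \<Rightarrow> 'e bivec"
  assumes "smooth_manifold \<A>"
    and "gen_CRF_structure \<A> \<Phi>"
    and "quasi_classical \<A> \<Phi>"
    and "defined_by \<A> \<Phi> A \<pi>"
    and "involutive \<A> (ker_dist A)"
    and "\<forall>U f (\<B> :: ('b::{t2_space,second_countable_topology}, 'f::euclidean_space) atlas).
           local_leaf_space \<A> (ker_dist A) U f \<B> \<longrightarrow>
           (\<exists>\<pi>'. bivector_field \<B> \<pi>' \<and> bivector_projects_to \<A> \<B> U f \<pi> \<pi>')"
  shows "(\<forall>V X. open_in_manifold \<A> V \<and> projectable_field \<A> (ker_dist A) V X \<longrightarrow>
            projectable_field \<A> (ker_dist A) V (\<lambda>p. A p (X p))) \<and>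
         (\<forall>U f (\<B> :: ('b, 'f) atlas).
            local_leaf_space \<A> (ker_dist A) U f \<B> \<longrightarrow>
            (\<exists>J. induces_on_leaf_space \<A> (ker_dist A) U f \<B> A J \<and> complex_structure \<B> J \<and>
              (\<exists>\<pi>'. bivector_projects_to \<A> \<B> U f \<pi> \<pi>' \<and> holomorphic_Poisson \<B> J \<pi>')))"
proof (intro conjI allI impI)
  interpret quasi_classical_CRF \<A> \<Phi> A \<pi>
    using assms(1,2,4) by unfold_locales
  fix V X assume "open_in_manifold \<A> V \<and> projectable_field \<A> (ker_dist A) V X"
  then show "projectable_field \<A> (ker_dist A) V (\<lambda>p. A p (X p))"
    unfolding open_in_manifold_def by (intro projectable_field_A assms(5)) auto
next
  fix U f and \<B> :: "('b, 'f) atlas"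
  assume leaf: "local_leaf_space \<A> (ker_dist A) U f \<B>"
  with assms(6) obtain \<pi>' where \<pi>': "bivector_field \<B> \<pi>'" "bivector_projects_to \<A> \<B> U f \<pi> \<pi>'" by blast
  interpret leaf_space_bivector \<A> \<B> \<Phi> A \<pi> U f \<pi>'
  proof unfold_locales
    show "smooth_manifold \<A>" "gen_CRF_structure \<A> \<Phi>" "defined_by \<A> \<Phi> A \<pi>" by (fact assms)+
    show "smooth_manifold \<B>" "open U" "U \<subseteq> carrier \<A>" "smooth_map \<A> \<B> U f" "f ` U = carrier \<B>"
      using leaf unfolding local_leaf_space_def open_in_manifold_def by auto
    show "surj (blinfun_apply (tangent_map \<A> \<B> f p))" if "p \<in> U" for p
      using leaf that unfolding local_leaf_space_def by blast
    show "tangent_map \<A> \<B> f p v = 0 \<longleftrightarrow> A p v = 0" if "p \<in> U" for p v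
      using leaf that unfolding local_leaf_space_def ker_dist_def by blast
    show "connected (U \<inter> f -` {y})" if "y \<in> carrier \<B>" for y
      using leaf that unfolding local_leaf_space_def by blast
  qed (fact \<pi>')+
  show "\<exists>J. induces_on_leaf_space \<A> (ker_dist A) U f \<B> A J \<and> complex_structure \<B> J \<and>
      (\<exists>\<pi>'. bivector_projects_to \<A> \<B> U f \<pi> \<pi>' \<and> holomorphic_Poisson \<B> J \<pi>')"
    using induces_J complex_structure_J \<pi>'(2) holomorphic_Poisson_projection by blast
qed

end
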